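(* Let $p>2$ be prime. For $t\in\mathbb{Z}/p\mathbb{Z}$ put $a_t(p) = -\sum_{x \bmod p}\left(\frac{x^3+tx^2+1}{p}\right)$, and let $A_{2}(p)=\sum_{t \bmod p} a_t(p)^2$. Let $n_{3,2,p}$ denote the number of solutions $x\in\mathbb{Z}/p\mathbb{Z}$ of $x^3\equiv 2 \pmod p$. Then \[ A_{2}(p) \;=\; p^2 - n_{3,2,p}\,p - 1 + p\sum_{x \bmod p}\left(\frac{4x^3+1}{p}\right). \] Moreover, for any real numbers $-2\le a<b\le 2$ there are infinitely many primes $p\equiv 1 \pmod 3$ such that \[ A_{2}(p) - \left(p^2 - n_{3,2,p}\,p - 1\right) \in \left[a\,p^{3/2},\, b\,p^{3/2}\right]. \]
   Context: $\left(\frac{\cdot}{p}\right)$ is the Legendre symbol (equal to $0$ at multiples of $p$). The quantity $a_t(p)$ is $p$ minus the number of affine solutions modulo $p$ of $y^2=x^3+tx^2+1$, i.e. the $p$-th coefficient for the member $E_t$ of the one-parameter family $y^2=x^3+Tx^2+1$ over $\mathbb{Q}(T)$. *)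

theory Defs
  imports "HOL-Number_Theory.Number_Theory" Complex_Main
begin

definition a_coef :: "int \<Rightarrow> int \<Rightarrow> int" where
  "a_coef p t = - (\<Sum>x\<in>{0..<p}. Legendre (x^3 + t * x^2 + 1) p)"

definition A2 :: "int \<Rightarrow> int" where
  "A2 p = (\<Sum>t\<in>{0..<p}. (a_coef p t)^2)"

definition n32 :: "int \<Rightarrow> nat" where
  "n32 p = card {x\<in>{0..<p}. [x^3 = 2] (mod p)}"

end

theory Submission
  imports Defs "HOL-Analysis.Analysis"
begin

text \<open>
  For the formula, expand the square and sum over \<open>t\<close> first: for nonzero \<open>x\<close>, \<open>y\<close> the sum over \<open>t\<close> is
  \<open>p - 1\<close> or \<open>-1\<close>, according to whether \<open>(x - y) (x\<^sup>2 y\<^sup>2 - x - y)\<close> vanishes modulo \<open>p\<close>, and the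
  second factor is a quadratic polynomial in \<open>y\<close> of discriminant \<open>4 x\<^sup>3 + 1\<close>.

  For \<open>p\<close> congruent to 1 modulo 3 the remaining sum of Legendre symbols is twice the real part of a
  cubic Jacobi sum, an Eisenstein integer of norm \<open>p\<close> congruent to \<open>-1\<close> modulo 3. So the second claim says
  that the primes congruent to 1 modulo 3 in the Eisenstein integers are dense in angle. This follows as in
  Dirichlet's theorem from the series \<open>L k s\<close>, the sum of \<open>(z / |z|)\<^sup>k |z|\<^sup>-\<^sup>s\<close> over the elements \<open>z\<close>
  congruent to 1 modulo 3: for \<open>k > 0\<close> it is Lipschitz up to \<open>s = 2\<close>, and it does not vanish there by the
  inequality \<open>3 + 4 cos x + cos 2x \<ge> 0\<close>, so that the sum of \<open>cos (k arg z) |z|\<^sup>-\<^sup>s\<close> over the primes stays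
  bounded, while it tends to infinity for \<open>k = 0\<close>. A trigonometric polynomial with positive mean that is
  nonpositive outside the given sector finishes the proof.
\<close>

section \<open>Character sums modulo an odd prime\<close>

text \<open>Only real parts are at stake: the Jacobi sum is needed up to conjugation, and the second
  claim constrains the cosine of an argument, so polynomials in \<open>cos\<close> suffice as test
  functions. The analytic obstacle is to reach \<open>s = 2\<close> for the twisted series without
  theta functions. Multiplication by one element \<open>beta\<close> of norm 7 does it: up to an
  absolutely convergent error it reproduces the series at \<open>s = 2 + t\<close> with the factor
  \<open>sgn beta ^ k * 7 powr (- t / 2)\<close>. For \<open>k > 0\<close> this factor stays away
  from 1; for \<open>k = 0\<close> it tends to 1 and leaves at most a simple pole. A Lipschitz bound
  is wanted rather than continuity, because the inequality excludes only zeros of order above 3/4.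
  As \<open>2 * k > 0\<close> too, there is no analogue of the real characters in Dirichlet's
  theorem. The series also run over real primes, the negatives of rational primes congruent to 2
  modulo 3. They belong to no \<open>p\<close> of the claim, and the test polynomial vanishes at
  cosine 1 and -1 to remove them.\<close>

lemma sum_mod_reindex:
  fixes p :: int and f :: "int \<Rightarrow> 'a::comm_monoid_add"
  assumes "finite S"
    and f: "\<And>x y. [x = y] (mod p) \<Longrightarrow> f x = f y"
    and h: "\<And>x. x \<in> S \<Longrightarrow> h x mod p \<in> S"
    and inj: "\<And>x y. x \<in> S \<Longrightarrow> y \<in> S \<Longrightarrow> [h x = h y] (mod p) \<Longrightarrow> x = y"
  shows "(\<Sum>x\<in>S. f (h x)) = (\<Sum>x\<in>S. f x)"
proof -
  have "inj_on (\<lambda>x. h x mod p) S"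
    using inj by (auto intro!: inj_onI simp: unique_euclidean_semiring_class.cong_def)
  moreover have "(\<lambda>x. h x mod p) ` S \<subseteq> S"
    using h by blast
  ultimately have "bij_betw (\<lambda>x. h x mod p) S S"
    using \<open>finite S\<close> by (simp add: bij_betw_def endo_inj_surj)
  then have "(\<Sum>x\<in>S. f (h x mod p)) = (\<Sum>x\<in>S. f x)"
    by (rule sum.reindex_bij_betw)
  moreover have "f (h x mod p) = f (h x)" for x
    by (rule f) (simp add: unique_euclidean_semiring_class.cong_def)
  ultimately show ?thesis by simp
qed

lemma sum_atLeast1LessThan_int:
  fixes p :: int and f :: "int \<Rightarrow> 'a::ab_group_add"
  assumes "p > 0"
  shows "(\<Sum>x\<in>{1..<p}. f x) = (\<Sum>x\<in>{0..<p}. f x) - f 0"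
proof -
  have "{0..<p} = insert 0 {1..<p}" using assms by auto
  then show ?thesis by simp
qed

locale odd_prime =
  fixes p :: int
  assumes prime_p: "prime p" and p_gt_2: "p > 2"
begin

lemma p_dvd_mult_iff: "p dvd a * b \<longleftrightarrow> p dvd a \<or> p dvd b"
  using prime_p by (rule prime_dvd_mult_iff)

lemma p_dvd_power_iff: "n > 0 \<Longrightarrow> p dvd a ^ n \<longleftrightarrow> p dvd a"
  using prime_p by (rule prime_dvd_power_iff)

lemma not_dvd_unit_residue: "x \<in> {1..<p} \<Longrightarrow> \<not> p dvd x"
  by (auto dest: zdvd_imp_le)

lemma eq_if_cong_residues:
  "x \<in> {0..<p} \<Longrightarrow> y \<in> {0..<p} \<Longrightarrow> [x = y] (mod p) \<Longrightarrow> x = y"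
  by (auto simp: unique_euclidean_semiring_class.cong_def)

lemma p_not_dvd_2: "\<not> p dvd 2"
  using p_gt_2 by (auto dest: zdvd_imp_le)

lemma mod_in_unit_residues: "\<not> p dvd x \<Longrightarrow> x mod p \<in> {1..<p}"
  using p_gt_2 pos_mod_sign[of p x] pos_mod_bound[of p x]
  by (auto simp: dvd_eq_mod_eq_0 simp del: pos_mod_sign pos_mod_bound)

lemma inverse_function_exists: "\<exists>iv. \<forall>x. \<not> p dvd x \<longrightarrow> [x * iv x = 1] (mod p)"
proof -
  have "\<exists>y. [x * y = 1] (mod p)" if "\<not> p dvd x" for x
    using that prime_p
    by (intro cong_solve_coprime_int) (simp add: coprime_commute prime_imp_coprime)
  then show ?thesis by metis
qed

text \<open>Pinned down only modulo \<open>p\<close> and only on units, so it has to be reduced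
  modulo \<open>p\<close> before it permutes the residues.\<close>

definition inv_mod :: "int \<Rightarrow> int" where
  "inv_mod = (SOME iv. \<forall>x. \<not> p dvd x \<longrightarrow> [x * iv x = 1] (mod p))"

lemma inv_mod: "\<not> p dvd x \<Longrightarrow> [x * inv_mod x = 1] (mod p)"
  using someI_ex[OF inverse_function_exists] by (auto simp: inv_mod_def)

lemma inv_mod_not_dvd: "\<not> p dvd x \<Longrightarrow> \<not> p dvd inv_mod x"
  using inv_mod[of x] prime_p
  by (metis cong_dvd_iff dvd_triv_right not_prime_unit p_dvd_mult_iff)

lemma cong_mult_lcancel_p: "\<not> p dvd a \<Longrightarrow> [a * x = a * y] (mod p) \<longleftrightarrow> [x = y] (mod p)"
  by (simp add: cong_iff_dvd_diff right_diff_distrib[symmetric] p_dvd_mult_iff)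

lemma sum_affine_reindex:
  fixes f :: "int \<Rightarrow> 'a::comm_monoid_add"
  assumes f: "\<And>x y. [x = y] (mod p) \<Longrightarrow> f x = f y" and a: "\<not> p dvd a"
  shows "(\<Sum>x\<in>{0..<p}. f (a * x + b)) = (\<Sum>x\<in>{0..<p}. f x)"
proof (rule sum_mod_reindex[where p = p])
  fix x y assume "x \<in> {0..<p}" "y \<in> {0..<p}" "[a * x + b = a * y + b] (mod p)"
  then show "x = y"
    using a by (intro eq_if_cong_residues) (auto simp: cong_add_rcancel cong_mult_lcancel_p)
qed (use f p_gt_2 in auto)

lemma sum_mult_reindex:
  fixes f :: "int \<Rightarrow> 'a::comm_monoid_add"
  assumes f: "\<And>x y. [x = y] (mod p) \<Longrightarrow> f x = f y" and a: "\<not> p dvd a"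
  shows "(\<Sum>x\<in>{1..<p}. f (a * x)) = (\<Sum>x\<in>{1..<p}. f x)"
proof (rule sum_mod_reindex[where p = p])
  show "a * x mod p \<in> {1..<p}" if "x \<in> {1..<p}" for x
    using that a not_dvd_unit_residue by (intro mod_in_unit_residues) (auto simp: p_dvd_mult_iff)
  fix x y assume "x \<in> {1..<p}" "y \<in> {1..<p}" "[a * x = a * y] (mod p)"
  then show "x = y"
    using a by (intro eq_if_cong_residues) (auto simp: cong_mult_lcancel_p)
qed (use f in auto)

lemma sum_inverse_reindex:
  fixes f :: "int \<Rightarrow> 'a::comm_monoid_add"
  assumes f: "\<And>x y. [x = y] (mod p) \<Longrightarrow> f x = f y"
  shows "(\<Sum>x\<in>{1..<p}. f (inv_mod x)) = (\<Sum>x\<in>{1..<p}. f x)"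
proof (rule sum_mod_reindex[where p = p])
  show "inv_mod x mod p \<in> {1..<p}" if "x \<in> {1..<p}" for x
    using that not_dvd_unit_residue inv_mod_not_dvd by (intro mod_in_unit_residues) auto
  fix x y assume xy: "x \<in> {1..<p}" "y \<in> {1..<p}" and c: "[inv_mod x = inv_mod y] (mod p)"
  have nd: "\<not> p dvd x" "\<not> p dvd y" using xy not_dvd_unit_residue by auto
  have "[x * (y * inv_mod y) = x * 1] (mod p)"
    by (intro cong_mult inv_mod nd cong_refl)
  moreover have "[y * (x * inv_mod x) = y * 1] (mod p)"
    by (intro cong_mult inv_mod nd cong_refl)
  moreover have "[y * (x * inv_mod x) = x * (y * inv_mod y)] (mod p)"
    using cong_mult[OF cong_refl c, of "x * y"] by (simp add: ac_simps)
  ultimately have "[x = y] (mod p)"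
    by (metis cong_sym cong_trans mult.right_neutral)
  then show "x = y" using xy by (intro eq_if_cong_residues) auto
qed (use f in auto)

end

text \<open>The range is an arbitrary integral domain so that one theory serves the integer-valued
  Legendre symbol and the complex cubic character.\<close>

locale residue_character = odd_prime +
  fixes \<psi> :: "int \<Rightarrow> 'a::idom"
  assumes char_cong: "[x = y] (mod p) \<Longrightarrow> \<psi> x = \<psi> y"
    and char_mult: "\<psi> (x * y) = \<psi> x * \<psi> y"
    and char_0: "\<psi> 0 = 0"
    and char_1: "\<psi> 1 = 1"
    and char_nontrivial: "\<exists>c. \<not> p dvd c \<and> \<psi> c \<noteq> 1"
begin

lemma char_dvd: "p dvd x \<Longrightarrow> \<psi> x = 0"
  using char_cong[of x 0] char_0 by (simp add: cong_iff_dvd_diff)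

lemma char_inv_mod: "\<not> p dvd x \<Longrightarrow> \<psi> x * \<psi> (inv_mod x) = 1"
  using char_cong[OF inv_mod] char_mult char_1 by metis

lemma char_nonzero: "\<not> p dvd x \<Longrightarrow> \<psi> x \<noteq> 0"
  using char_inv_mod by force

lemma sum_char: "(\<Sum>x\<in>{0..<p}. \<psi> x) = 0"
proof -
  obtain c where c: "\<not> p dvd c" "\<psi> c \<noteq> 1"
    using char_nontrivial by blast
  have "(\<Sum>x\<in>{0..<p}. \<psi> (c * x + 0)) = (\<Sum>x\<in>{0..<p}. \<psi> x)"
    using c(1) char_cong by (intro sum_affine_reindex)
  then have "\<psi> c * (\<Sum>x\<in>{0..<p}. \<psi> x) = (\<Sum>x\<in>{0..<p}. \<psi> x)"
    by (simp add: char_mult sum_distrib_left)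
  then show ?thesis using c(2) by simp
qed

lemma sum_char_units: "(\<Sum>x\<in>{1..<p}. \<psi> x) = 0"
  using p_gt_2 by (simp add: sum_atLeast1LessThan_int sum_char char_0)

lemma sum_char_affine:
  assumes "\<not> p dvd a"
  shows "(\<Sum>x\<in>{0..<p}. \<psi> (a * x + b)) = 0"
  using sum_affine_reindex[of \<psi> a b] char_cong assms sum_char by simp

text \<open>Character correlations end up here after inversion of the variable. A full affine sum
  vanishes, and leaving out \<open>x = 0\<close> costs the term \<open>\<psi> b\<close>.\<close>

lemma sum_char_affine_units:
  "(\<Sum>x\<in>{1..<p}. \<psi> (a * x + b)) = (if p dvd a then of_int (p - 1) * \<psi> b else - \<psi> b)"
proof (cases "p dvd a")
  case True
  then have "\<psi> (a * x + b) = \<psi> b" for x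
    by (intro char_cong) (simp add: cong_iff_dvd_diff)
  then show ?thesis using True p_gt_2 by simp
next
  case False
  then show ?thesis
    using p_gt_2 by (simp add: sum_atLeast1LessThan_int sum_char_affine)
qed

end

section \<open>The Legendre symbol, root counts and the second moment of the family\<close>

context odd_prime
begin

lemma Legendre_cong: "[x = y] (mod p) \<Longrightarrow> Legendre x p = Legendre y p"
  unfolding Legendre_def QuadRes_def by (simp add: unique_euclidean_semiring_class.cong_def)

lemma Legendre_values: "Legendre x p \<in> {-1, 0, 1}"
  by (simp add: Legendre_def)

text \<open>Euler's criterion gives the congruence modulo \<open>p\<close>; both sides lie in {-1,
  0, 1}, so they differ by at most 2, which is less than \<open>p\<close>.\<close>

lemma Legendre_mult: "Legendre (x * y) p = Legendre x p * Legendre y p"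
proof -
  have p: "prime (nat p)" "2 < nat p" "int (nat p) = p"
    using prime_p p_gt_2 by (simp_all add: prime_nat_iff_prime)
  have E: "[Legendre z p = z ^ ((nat p - 1) div 2)] (mod p)" for z
    using euler_criterion[OF p(1,2), of z] p(3) by simp
  have "[Legendre (x * y) p = Legendre x p * Legendre y p] (mod p)"
    using cong_trans[OF E[of "x * y", unfolded power_mult_distrib] cong_sym[OF cong_mult[OF E[of x] E[of y]]]] .
  then have "p dvd Legendre (x * y) p - Legendre x p * Legendre y p"
    by (simp add: cong_iff_dvd_diff)
  moreover have "\<bar>Legendre (x * y) p - Legendre x p * Legendre y p\<bar> \<le> 2"
    using Legendre_values[of x] Legendre_values[of y] Legendre_values[of "x * y"] by auto
  ultimately show ?thesis
    using p_gt_2 dvd_imp_le_int[of "Legendre (x * y) p - Legendre x p * Legendre y p" p] by auto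
qed

lemma Legendre_square: "\<not> p dvd x \<Longrightarrow> Legendre (x^2) p = 1"
  using p_dvd_power_iff[of 2 x]
  by (auto simp: Legendre_def QuadRes_def cong_0_iff) (use cong_refl in blast)

text \<open>Pigeonhole: 1 and \<open>p - 1\<close> have the same square, so the squares of 1, ...,
  \<open>p - 2\<close> already exhaust the nonzero squares and cannot fill \<open>p - 1\<close>
  residues.\<close>

lemma Legendre_nontrivial: "\<exists>c. \<not> p dvd c \<and> Legendre c p \<noteq> 1"
proof (rule ccontr)
  assume "\<not> ?thesis"
  then have QR: "QuadRes p c" if "\<not> p dvd c" for c
    using that by (auto simp: Legendre_def cong_0_iff split: if_splits)
  have "{1..<p} \<subseteq> (\<lambda>y. y^2 mod p) ` {1..<p-1}"
  proof
    fix x assume x: "x \<in> {1..<p}"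
    then obtain y where y: "[y^2 = x] (mod p)"
      using QR not_dvd_unit_residue unfolding QuadRes_def by blast
    define z where "z = y mod p"
    have z: "[z^2 = x] (mod p)"
      using y unfolding z_def by (simp add: unique_euclidean_semiring_class.cong_def power_mod)
    then have "\<not> p dvd z"
      using x not_dvd_unit_residue p_dvd_power_iff[of 2 z] cong_dvd_iff[OF z] by auto
    then have zr: "z \<in> {1..<p}"
      using p_gt_2 mod_in_unit_residues[of z] unfolding z_def by (auto simp: mod_mod_trivial)
    have x': "x = z^2 mod p" using z x by (simp add: unique_euclidean_semiring_class.cong_def)
    show "x \<in> (\<lambda>y. y^2 mod p) ` {1..<p-1}"
    proof (cases "z = p - 1")
      case True
      have "z^2 = 1 + p * (p - 2)" by (simp add: True power2_eq_square algebra_simps)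
      then have "x = 1\<^sup>2 mod p" unfolding x' by simp
      then show ?thesis using p_gt_2 by (intro image_eqI[of _ _ 1]) auto
    next
      case False
      then show ?thesis using zr x' by auto
    qed
  qed
  then have "card {1..<p} \<le> card ((\<lambda>y. y^2 mod p) ` {1..<p-1})"
    by (intro card_mono) auto
  also have "\<dots> \<le> card {1..<p-1}" by (rule card_image_le) simp
  finally show False using p_gt_2 by simp
qed

sublocale leg: residue_character p "\<lambda>x. Legendre x p"
proof
  show "Legendre 1 p = 1" using Legendre_square[of 1] p_gt_2 by auto
qed (use Legendre_cong Legendre_mult Legendre_nontrivial in \<open>auto simp: Legendre_def\<close>)

text \<open>With \<open>u = c * t + d\<close> the first factor becomes \<open>m * u + n\<close>,
  where \<open>m\<close> is \<open>a / c\<close> modulo \<open>p\<close>. For a unit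
  \<open>u\<close>, \<open>(m * u + n) * u\<close> is the square \<open>u^2\<close> times
  \<open>m + n / u\<close>, so the quadratic sum turns into an affine one in \<open>1 / u\<close>.
  It is large exactly when \<open>p\<close> divides \<open>n\<close>, that is, when the two linear
  forms are proportional.\<close>

lemma sum_Legendre_product:
  assumes a: "\<not> p dvd a" and c: "\<not> p dvd c"
  shows "(\<Sum>t\<in>{0..<p}. Legendre (a * t + b) p * Legendre (c * t + d) p) =
         Legendre (a * c) p * (p * of_bool ([a * d = b * c] (mod p)) - 1)"
proof -
  define m where "m = a * inv_mod c"
  define n where "n = b - m * d"
  have ic: "[c * inv_mod c = 1] (mod p)" using c by (rule inv_mod)
  have mc: "[m * c = a] (mod p)"
    using cong_mult[OF cong_refl ic, of a] by (simp add: m_def ac_simps)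
  define f where "f u = Legendre (m * u + n) p * Legendre u p" for u
  have f_cong: "f x = f y" if "[x = y] (mod p)" for x y
    unfolding f_def using that
    by (intro arg_cong2[where f="(*)"] Legendre_cong cong_add cong_mult cong_refl)
  have "Legendre (a * t + b) p * Legendre (c * t + d) p = f (c * t + d)" for t
  proof -
    have "[a * t + b = (m * c) * t + b] (mod p)"
      using mc by (intro cong_add cong_mult cong_refl) (rule cong_sym)
    also have "(m * c) * t + b = m * (c * t + d) + n" by (simp add: n_def algebra_simps)
    finally show ?thesis unfolding f_def by (simp add: Legendre_cong)
  qed
  then have "(\<Sum>t\<in>{0..<p}. Legendre (a * t + b) p * Legendre (c * t + d) p) = (\<Sum>t\<in>{0..<p}. f (c * t + d))"
    by simp
  also have "\<dots> = (\<Sum>u\<in>{0..<p}. f u)" using c f_cong by (rule sum_affine_reindex[rotated])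
  also have "\<dots> = (\<Sum>u\<in>{1..<p}. f u)"
    using p_gt_2 by (simp add: sum_atLeast1LessThan_int f_def leg.char_0)
  also have "\<dots> = (\<Sum>u\<in>{1..<p}. Legendre (n * inv_mod u + m) p)"
  proof (rule sum.cong)
    fix u assume "u \<in> {1..<p}"
    then have u: "\<not> p dvd u" by (rule not_dvd_unit_residue)
    have "[m * u + n * (u * inv_mod u) = m * u + n * 1] (mod p)"
      by (intro cong_add cong_mult cong_refl inv_mod u)
    then have "Legendre (m * u + n) p = Legendre (u * (n * inv_mod u + m)) p"
      by (intro Legendre_cong) (simp add: algebra_simps cong_sym)
    then have "f u = Legendre (u^2) p * Legendre (n * inv_mod u + m) p"
      unfolding f_def by (simp add: Legendre_mult power2_eq_square ac_simps)
    then show "f u = Legendre (n * inv_mod u + m) p" using u by (simp add: Legendre_square)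
  qed simp
  also have "\<dots> = (\<Sum>v\<in>{1..<p}. Legendre (n * v + m) p)"
    by (rule sum_inverse_reindex[where f = "\<lambda>v. Legendre (n * v + m) p"])
       (intro Legendre_cong cong_add cong_mult cong_refl)
  also have "\<dots> = (if p dvd n then (p - 1) * Legendre m p else - Legendre m p)"
    by (simp add: leg.sum_char_affine_units)
  also have "\<dots> = Legendre m p * (p * of_bool (p dvd n) - 1)"
    by (auto simp: algebra_simps)
  also have "Legendre m p = Legendre (a * c) p"
  proof -
    have "Legendre (a * c) p = Legendre (m * c * c) p"
      by (intro Legendre_cong cong_mult cong_refl) (rule cong_sym[OF mc])
    also have "\<dots> = Legendre m p * Legendre (c^2) p"
      by (simp add: Legendre_mult power2_eq_square)
    finally show ?thesis using c by (simp add: Legendre_square)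
  qed
  also have "p dvd n \<longleftrightarrow> [a * d = b * c] (mod p)"
  proof -
    have "p dvd n \<longleftrightarrow> p dvd c * n" using c by (simp add: p_dvd_mult_iff)
    also have "c * n = b * c - (m * c) * d" by (simp add: n_def algebra_simps)
    also have "p dvd \<dots> \<longleftrightarrow> [b * c = (m * c) * d] (mod p)" by (simp add: cong_iff_dvd_diff)
    also have "\<dots> \<longleftrightarrow> [b * c = a * d] (mod p)"
      using cong_mult[OF mc cong_refl[of d]] by (meson cong_sym cong_trans)
    finally show ?thesis by (simp add: cong_sym_eq)
  qed
  finally show ?thesis .
qed

lemma count_square_roots:
  "(\<Sum>y\<in>{0..<p}. of_bool ([y^2 = a] (mod p))) = 1 + Legendre a p"
proof -
  let ?R = "{y\<in>{0..<p}. [y^2 = a] (mod p)}"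
  have card: "(\<Sum>y\<in>{0..<p}. of_bool ([y^2 = a] (mod p))) = int (card ?R)"
    by (simp add: Int_def)
  show ?thesis
  proof (cases "p dvd a")
    case True
    have "[y^2 = a] (mod p) \<longleftrightarrow> p dvd y" for y
      using True p_dvd_power_iff[of 2 y] by (metis cong_dvd_iff cong_0_iff cong_sym cong_trans zero_less_numeral)
    then have "?R = {0}" using p_gt_2 by (auto dest: zdvd_imp_le)
    then show ?thesis using True card by (simp add: leg.char_dvd)
  next
    case a: False
    show ?thesis
    proof (cases "QuadRes p a")
      case False
      then have "?R = {}" by (auto simp: QuadRes_def)
      then show ?thesis using card a False by (simp add: Legendre_def cong_0_iff)
    next
      case True
      then obtain z where z: "[z^2 = a] (mod p)" by (auto simp: QuadRes_def)
      then have nz: "\<not> p dvd z" using a p_dvd_power_iff[of 2 z] cong_dvd_iff by fastforce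
      have iff: "[y^2 = a] (mod p) \<longleftrightarrow> [y = z] (mod p) \<or> [y = - z] (mod p)" for y
      proof -
        have "[y^2 = a] (mod p) \<longleftrightarrow> [y^2 = z^2] (mod p)" using z by (meson cong_sym cong_trans)
        also have "\<dots> \<longleftrightarrow> p dvd (y - z) * (y + z)"
          by (simp add: cong_iff_dvd_diff power2_eq_square algebra_simps)
        finally show ?thesis by (simp add: p_dvd_mult_iff cong_iff_dvd_diff)
      qed
      have "?R = {z mod p, (- z) mod p}"
        unfolding iff using p_gt_2 by (auto simp: unique_euclidean_semiring_class.cong_def)
      moreover have "z mod p \<noteq> (- z) mod p"
      proof
        assume "z mod p = (- z) mod p"
        then have "p dvd 2 * z" by (metis mod_eq_dvd_iff diff_minus_eq_add mult_2)
        then show False using nz p_not_dvd_2 by (simp add: p_dvd_mult_iff)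
      qed
      ultimately show ?thesis using card a True by (simp add: Legendre_def cong_0_iff)
    qed
  qed
qed

lemma count_quadratic_roots:
  assumes "\<not> p dvd a"
  shows "(\<Sum>y\<in>{0..<p}. of_bool (p dvd a * y^2 + b * y + c)) = 1 + Legendre (b^2 - 4 * a * c) p"
proof -
  have "(\<Sum>y\<in>{0..<p}. of_bool (p dvd a * y^2 + b * y + c)) =
        (\<Sum>y\<in>{0..<p}. of_bool ([(2 * a * y + b)^2 = b^2 - 4 * a * c] (mod p)) :: int)"
  proof (rule sum.cong)
    fix y
    have "p dvd a * y^2 + b * y + c \<longleftrightarrow> p dvd (2 * 2 * a) * (a * y^2 + b * y + c)"
      using assms p_not_dvd_2 by (simp only: p_dvd_mult_iff) simp
    also have "(2 * 2 * a) * (a * y^2 + b * y + c) = (2 * a * y + b)^2 - (b^2 - 4 * a * c)"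
      by (simp add: power2_eq_square algebra_simps)
    finally show "of_bool (p dvd a * y^2 + b * y + c) =
        (of_bool ([(2 * a * y + b)^2 = b^2 - 4 * a * c] (mod p)) :: int)"
      by (simp add: cong_iff_dvd_diff)
  qed simp
  also have "\<dots> = (\<Sum>y\<in>{0..<p}. of_bool ([y^2 = b^2 - 4 * a * c] (mod p)))"
  proof (rule sum_affine_reindex)
    show "\<not> p dvd 2 * a" using assms p_not_dvd_2 by (simp add: p_dvd_mult_iff)
    show "of_bool ([x^2 = b^2 - 4 * a * c] (mod p)) = (of_bool ([y^2 = b^2 - 4 * a * c] (mod p)) :: int)"
      if "[x = y] (mod p)" for x y
      using cong_pow[OF that, of 2] by (simp add: unique_euclidean_semiring_class.cong_def)
  qed
  also have "\<dots> = 1 + Legendre (b^2 - 4 * a * c) p" by (rule count_square_roots)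
  finally show ?thesis .
qed

text \<open>The difference of the two sides is \<open>y - x\<close> times a quadratic in
  \<open>y\<close>, and at \<open>y = x\<close> the quadratic is \<open>x * (x^3 - 2)\<close>. So
  the two ways to vanish overlap exactly at the cube roots of 2, which is how \<open>n32\<close>
  enters.\<close>

lemma coincidence_count:
  assumes x: "x \<in> {1..<p}" and y: "y \<in> {1..<p}"
  shows "of_bool ([x^2 * (y^3 + 1) = (x^3 + 1) * y^2] (mod p)) =
    (of_bool (y = x) + of_bool (p dvd x^2 * y^2 + (-1) * y + (-x)) - of_bool (y = x) * of_bool ([x^3 = 2] (mod p)) :: int)"
proof -
  have "[x^2 * (y^3 + 1) = (x^3 + 1) * y^2] (mod p) \<longleftrightarrow> p dvd (y - x) * (x^2 * y^2 + (-1) * y + (-x))"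
  proof -
    have "x^2 * (y^3 + 1) - (x^3 + 1) * y^2 = (y - x) * (x^2 * y^2 + (-1) * y + (-x))"
      by (simp add: power2_eq_square power3_eq_cube algebra_simps)
    then show ?thesis by (simp add: cong_iff_dvd_diff)
  qed
  also have "\<dots> \<longleftrightarrow> p dvd y - x \<or> p dvd x^2 * y^2 + (-1) * y + (-x)" by (rule p_dvd_mult_iff)
  also have "p dvd y - x \<longleftrightarrow> y = x"
    using eq_if_cong_residues[of y x] x y by (auto simp: cong_iff_dvd_diff)
  finally have 1: "[x^2 * (y^3 + 1) = (x^3 + 1) * y^2] (mod p) \<longleftrightarrow>
     y = x \<or> p dvd x^2 * y^2 + (-1) * y + (-x)" .
  have "p dvd x^2 * x^2 + (-1) * x + (-x) \<longleftrightarrow> [x^3 = 2] (mod p)"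
  proof -
    have "x^2 * x^2 + (-1) * x + (-x) = x * (x^3 - 2)"
      by (simp add: power2_eq_square power3_eq_cube algebra_simps)
    then show ?thesis using not_dvd_unit_residue[OF x] by (simp add: p_dvd_mult_iff cong_iff_dvd_diff)
  qed
  then show ?thesis unfolding 1 by auto
qed

theorem A2_formula:
  "A2 p = p^2 - int (n32 p) * p - 1 + p * (\<Sum>x\<in>{0..<p}. Legendre (4 * x^3 + 1) p)"
proof -
  \<comment> \<open>The cubic is linear in \<open>t\<close> with leading coefficient
    \<open>x^2\<close>, so \<open>sum_Legendre_product\<close> handles pairs of units;
    \<open>x = 0\<close> and \<open>y = 0\<close> are treated apart because there this coefficient
    vanishes.\<close>
  define T where "T x y = (\<Sum>t\<in>{0..<p}. Legendre (x^2 * t + (x^3 + 1)) p * Legendre (y^2 * t + (y^3 + 1)) p)" for x y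
  define S where "S = (\<Sum>x\<in>{0..<p}. Legendre (4 * x^3 + 1) p)"
  define B where "B x y = (of_bool ([x^2 * (y^3 + 1) = (x^3 + 1) * y^2] (mod p)) :: int)" for x y
  have "A2 p = (\<Sum>t\<in>{0..<p}. \<Sum>x\<in>{0..<p}. \<Sum>y\<in>{0..<p}.
      Legendre (x^2 * t + (x^3 + 1)) p * Legendre (y^2 * t + (y^3 + 1)) p)"
  proof -
    have eq: "x^3 + t * x^2 + 1 = x^2 * t + (x^3 + 1)" for x t :: int by simp
    show ?thesis
      unfolding A2_def a_coef_def power2_minus power2_eq_square[of "sum _ _"] sum_product eq ..
  qed
  also have "\<dots> = (\<Sum>x\<in>{0..<p}. \<Sum>y\<in>{0..<p}. T x y)"
    unfolding T_def by (subst sum.swap) (intro sum.cong refl sum.swap)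
  finally have A2: "A2 p = (\<Sum>x\<in>{0..<p}. \<Sum>y\<in>{0..<p}. T x y)" .
  have T00: "T 0 0 = p" using p_gt_2 by (simp add: T_def leg.char_1)
  have T0: "T 0 y = 0" if "y \<in> {1..<p}" for y
    using leg.sum_char_affine[of "y^2" "y^3 + 1"] not_dvd_unit_residue[OF that]
    by (simp add: T_def leg.char_1 p_dvd_power_iff)
  have T_commute: "T x y = T y x" for x y
    by (simp add: T_def mult.commute)
  have T: "T x y = p * B x y - 1" if "x \<in> {1..<p}" "y \<in> {1..<p}" for x y
  proof -
    have nd: "\<not> p dvd x" "\<not> p dvd y" using that not_dvd_unit_residue by auto
    then have "Legendre (x^2 * y^2) p = 1"
      by (simp add: Legendre_mult Legendre_square)
    then show ?thesis
      using sum_Legendre_product[of "x^2" "y^2" "x^3 + 1" "y^3 + 1"] nd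
      by (simp add: T_def B_def p_dvd_power_iff)
  qed
  have split0: "(\<Sum>x\<in>{0..<p}. f x) = f 0 + (\<Sum>x\<in>{1..<p}. f x)" for f :: "int \<Rightarrow> int"
    using p_gt_2 by (simp add: sum_atLeast1LessThan_int)
  have "A2 p = p + (\<Sum>x\<in>{1..<p}. \<Sum>y\<in>{1..<p}. T x y)"
  proof -
    have "(\<Sum>y\<in>{0..<p}. T 0 y) = p" by (simp add: split0 T00 T0)
    moreover have "(\<Sum>y\<in>{0..<p}. T x y) = (\<Sum>y\<in>{1..<p}. T x y)" if "x \<in> {1..<p}" for x
      using that by (simp add: split0 T_commute[of x 0] T0)
    ultimately show ?thesis unfolding A2 by (subst split0) simp
  qed
  also have "(\<Sum>x\<in>{1..<p}. \<Sum>y\<in>{1..<p}. T x y) = (\<Sum>x\<in>{1..<p}. \<Sum>y\<in>{1..<p}. p * B x y - 1)"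
    by (intro sum.cong refl T)
  also have "\<dots> = p * (\<Sum>x\<in>{1..<p}. \<Sum>y\<in>{1..<p}. B x y) - (p - 1)^2"
    using p_gt_2 by (simp add: sum_subtractf sum_distrib_left power2_eq_square)
  \<comment> \<open>For fixed \<open>x\<close> the 2 collects the solution \<open>y = x\<close> and
    the constant 1 of the quadratic root count.\<close>
  also have "(\<Sum>x\<in>{1..<p}. \<Sum>y\<in>{1..<p}. B x y) = (\<Sum>x\<in>{1..<p}. 2 + Legendre (4 * x^3 + 1) p - of_bool ([x^3 = 2] (mod p)))"
  proof (rule sum.cong)
    fix x assume x: "x \<in> {1..<p}"
    then have nd: "\<not> p dvd x" using not_dvd_unit_residue by auto
    have "(\<Sum>y\<in>{1..<p}. of_bool (p dvd x^2 * y^2 + (-1) * y + (-x))) =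
        (\<Sum>y\<in>{0..<p}. of_bool (p dvd x^2 * y^2 + (-1) * y + (-x)) :: int)"
      using nd by (simp add: split0)
    also have "\<dots> = 1 + Legendre (4 * x^3 + 1) p"
      using nd by (subst count_quadratic_roots) (simp_all add: p_dvd_mult_iff power2_eq_square power3_eq_cube algebra_simps)
    finally have q: "(\<Sum>y\<in>{1..<p}. of_bool (p dvd x^2 * y^2 + (-1) * y + (-x))) = 1 + Legendre (4 * x^3 + 1) p" .
    have "(\<Sum>y\<in>{1..<p}. B x y) = (\<Sum>y\<in>{1..<p}. of_bool (y = x) +
        of_bool (p dvd x^2 * y^2 + (-1) * y + (-x)) - of_bool (y = x) * of_bool ([x^3 = 2] (mod p)))"
      unfolding B_def by (intro sum.cong refl coincidence_count[OF x])
    also have "\<dots> = (\<Sum>y\<in>{1..<p}. of_bool (y = x)) + (1 + Legendre (4 * x^3 + 1) p)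
       - (\<Sum>y\<in>{1..<p}. of_bool (y = x)) * of_bool ([x^3 = 2] (mod p))"
      by (simp only: sum.distrib sum_subtractf sum_distrib_right q)
    also have "(\<Sum>y\<in>{1..<p}. of_bool (y = x)) = (1::int)"
      using x by (simp add: sum.delta of_bool_def)
    finally show "(\<Sum>y\<in>{1..<p}. B x y) = 2 + Legendre (4 * x^3 + 1) p - of_bool ([x^3 = 2] (mod p))"
      by simp
  qed simp
  also have "\<dots> = 2 * (p - 1) + (S - 1) - int (n32 p)"
  proof -
    \<comment> \<open>Both sums are extended to \<open>x = 0\<close>: this is no cube root of 2, as
      \<open>p\<close> is odd, while the Legendre sum gains the value 1, whence
      \<open>S - 1\<close>.\<close>
    have "(\<Sum>x\<in>{1..<p}. of_bool ([x^3 = 2] (mod p))) = (\<Sum>x\<in>{0..<p}. of_bool ([x^3 = 2] (mod p)) :: int)"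
      using p_not_dvd_2 by (subst split0) (simp add: cong_iff_dvd_diff)
    also have "\<dots> = int (n32 p)" by (simp add: n32_def Int_def)
    finally show ?thesis
      using p_gt_2 by (simp add: sum.distrib sum_subtractf S_def split0 leg.char_1)
  qed
  finally show ?thesis unfolding S_def by (simp add: power2_eq_square algebra_simps)
qed

end

section \<open>Primary Eisenstein integers\<close>

definition omega :: complex ("\<omega>") where
  "\<omega> = Complex (-1/2) (sqrt 3 / 2)"

definition eis :: "int \<Rightarrow> int \<Rightarrow> complex" where
  "eis a b = of_int a + of_int b * \<omega>"

definition eisenstein :: "complex set" where
  "eisenstein = {eis a b | a b. True}"

lemma Re_omega [simp]: "Re \<omega> = -1/2" and Im_omega [simp]: "Im \<omega> = sqrt 3 / 2"
  by (simp_all add: omega_def)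

lemma omega_squared: "\<omega> * \<omega> = -1 - \<omega>"
  by (simp add: complex_eq_iff)

lemma cnj_omega: "cnj \<omega> = -1 - \<omega>"
  by (simp add: complex_eq_iff)

lemma Re_eis [simp]: "Re (eis a b) = a - b / 2" and Im_eis [simp]: "Im (eis a b) = b * sqrt 3 / 2"
  by (simp_all add: eis_def)

lemma eis_eq_iff [simp]: "eis a b = eis c d \<longleftrightarrow> a = c \<and> b = d"
  by (auto simp: complex_eq_iff)

lemma eis_add: "eis a b + eis c d = eis (a + c) (b + d)"
  and eis_diff: "eis a b - eis c d = eis (a - c) (b - d)"
  and eis_uminus: "- eis a b = eis (- a) (- b)"
  and of_int_eis: "of_int n = eis n 0"
  by (simp_all add: eis_def algebra_simps)

lemma eis_mult: "eis a b * eis c d = eis (a * c - b * d) (a * d + b * c - b * d)"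
proof -
  have "eis a b * eis c d = of_int (a * c) + of_int (a * d + b * c) * \<omega> + of_int (b * d) * (\<omega> * \<omega>)"
    by (simp add: eis_def algebra_simps)
  then show ?thesis by (simp add: omega_squared eis_def algebra_simps)
qed

lemma cnj_eis: "cnj (eis a b) = eis (a - b) (- b)"
  by (simp add: complex_eq_iff)

lemma cmod_eis_squared: "(cmod (eis a b))^2 = of_int (a^2 - a * b + b^2)"
proof -
  have "(cmod (eis a b))^2 = (of_int a - of_int b / 2)^2 + (of_int b * sqrt 3 / 2)^2"
    by (simp add: cmod_power2)
  also have "(of_int b * sqrt 3 / 2)^2 = 3 * (of_int b)^2 / 4"
    by (simp add: power_mult_distrib power_divide)
  finally show ?thesis by (simp add: power2_eq_square field_simps)
qed

lemma eisenstein_eis [simp, intro]: "eis a b \<in> eisenstein"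
  by (auto simp: eisenstein_def)

lemma eisensteinE: assumes "z \<in> eisenstein" obtains a b where "z = eis a b"
  using assms by (auto simp: eisenstein_def)

lemma eisenstein_of_int [simp, intro]: "of_int n \<in> eisenstein"
  by (simp add: of_int_eis)

lemma eisenstein_0 [simp, intro]: "0 \<in> eisenstein"
  and eisenstein_1 [simp, intro]: "1 \<in> eisenstein"
  and eisenstein_numeral [simp, intro]: "numeral n \<in> eisenstein"
  using eisenstein_of_int[of 0] eisenstein_of_int[of 1] eisenstein_of_int[of "numeral n"] by simp_all

lemma eisenstein_omega [simp, intro]: "\<omega> \<in> eisenstein"
  using eisenstein_eis[of 0 1] by (simp add: eis_def)

lemma eisenstein_add [intro]: "x \<in> eisenstein \<Longrightarrow> y \<in> eisenstein \<Longrightarrow> x + y \<in> eisenstein"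
  by (auto elim!: eisensteinE simp: eis_add)

lemma eisenstein_diff [intro]: "x \<in> eisenstein \<Longrightarrow> y \<in> eisenstein \<Longrightarrow> x - y \<in> eisenstein"
  by (auto elim!: eisensteinE simp: eis_diff)

lemma eisenstein_uminus [intro]: "x \<in> eisenstein \<Longrightarrow> - x \<in> eisenstein"
  by (auto elim!: eisensteinE simp: eis_uminus)

lemma eisenstein_mult [intro]: "x \<in> eisenstein \<Longrightarrow> y \<in> eisenstein \<Longrightarrow> x * y \<in> eisenstein"
  by (auto elim!: eisensteinE simp: eis_mult)

lemma eisenstein_cnj [intro]: "x \<in> eisenstein \<Longrightarrow> cnj x \<in> eisenstein"
  by (auto elim!: eisensteinE simp: cnj_eis)

section \<open>Euclidean division and greatest common divisors\<close>

lemma eisenstein_division: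
  assumes "x \<in> eisenstein" "y \<in> eisenstein" "y \<noteq> 0"
  obtains q where "q \<in> eisenstein" "cmod (x - q * y) < cmod y"
proof -
  define z where "z = x / y"
  define v where "v = 2 * Im z / sqrt 3"
  define u where "u = Re z + v / 2"
  \<comment> \<open>\<open>u\<close> and \<open>v\<close> are the coordinates of the quotient with
    respect to 1 and \<omega>. Rounding leaves errors of at most 1/2 in each, hence an error of norm
    at most 3/4.\<close>
  define q where "q = eis (round u) (round v)"
  define s t where "s = u - round u" and "t = v - round v"
  have st: "\<bar>s\<bar> \<le> 1/2" "\<bar>t\<bar> \<le> 1/2"
    unfolding s_def t_def using of_int_round_abs_le[of u] of_int_round_abs_le[of v]
    by (simp_all add: abs_minus_commute)
  have "Re z = u - v / 2" "Im z = v * sqrt 3 / 2" by (simp_all add: u_def v_def)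
  then have "z - q = Complex (s - t / 2) (t * sqrt 3 / 2)"
    by (simp add: complex_eq_iff q_def s_def t_def diff_divide_distrib left_diff_distrib)
  then have "(cmod (z - q))^2 = (s - t/2)^2 + (t * sqrt 3 / 2)^2"
    by (simp add: cmod_power2)
  also have "(t * sqrt 3 / 2)^2 = 3 * t^2 / 4"
    by (simp add: power_mult_distrib power_divide)
  also have "(s - t/2)^2 + 3 * t^2 / 4 = s^2 - s * t + t^2"
    by (simp add: power2_eq_square field_simps)
  also have "\<dots> \<le> \<bar>s\<bar>^2 + \<bar>s\<bar> * \<bar>t\<bar> + \<bar>t\<bar>^2"
    using abs_ge_minus_self[of "s * t"] by (simp add: abs_mult)
  also have "\<dots> \<le> (1/2)^2 + (1/2) * (1/2) + (1/2)^2"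
    using st by (intro add_mono power_mono mult_mono) auto
  also have "\<dots> < 1^2" by (simp add: power2_eq_square)
  finally have "cmod (z - q) < 1"
    by (rule power_less_imp_less_base) simp
  moreover have "x - q * y = (z - q) * y"
    using assms(3) by (simp add: z_def field_simps)
  ultimately have "cmod (x - q * y) < cmod y"
    using assms(3) by (simp add: norm_mult)
  moreover have "q \<in> eisenstein" by (simp add: q_def)
  ultimately show ?thesis using that by blast
qed

lemma eisenstein_norm_nat:
  assumes "z \<in> eisenstein"
  shows "\<exists>n::nat. (cmod z)^2 = real n"
proof -
  obtain a b where z: "z = eis a b" using assms by (rule eisensteinE)
  have "0 \<le> (cmod z)^2" by simp
  then have "a^2 - a * b + b^2 \<ge> 0" unfolding z cmod_eis_squared by linarith
  then have "(cmod z)^2 = real (nat (a^2 - a * b + b^2))" unfolding z cmod_eis_squared by simp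
  then show ?thesis ..
qed

text \<open>\<open>d\<close> is a nonzero element of least norm in the ideal generated by
  \<open>x\<close> and \<open>y\<close>; the remainder of any element of the ideal on division by
  \<open>d\<close> has smaller norm, hence is zero.\<close>

lemma eisenstein_bezout:
  assumes E: "x \<in> eisenstein" "y \<in> eisenstein" "x \<noteq> 0"
  obtains d r s where "d \<in> eisenstein" "d \<noteq> 0" "r \<in> eisenstein" "s \<in> eisenstein" "d = r * x + s * y"
    "\<exists>k\<in>eisenstein. x = d * k" "\<exists>k\<in>eisenstein. y = d * k"
proof -
  define I where "I = {r * x + s * y | r s. r \<in> eisenstein \<and> s \<in> eisenstein}"
  have I_E: "I \<subseteq> eisenstein" using E by (auto simp: I_def)
  have I_diff: "u - q * v \<in> I" if u: "u \<in> I" and v: "v \<in> I" and q: "q \<in> eisenstein" for u v q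
  proof -
    obtain r s r' s' where rs: "r \<in> eisenstein" "s \<in> eisenstein" "r' \<in> eisenstein" "s' \<in> eisenstein"
      "u = r * x + s * y" "v = r' * x + s' * y"
      using u v by (auto simp: I_def)
    then have "u - q * v = (r - q * r') * x + (s - q * s') * y"
      by (simp add: algebra_simps)
    moreover have "r - q * r' \<in> eisenstein" "s - q * s' \<in> eisenstein"
      using rs q by auto
    ultimately show ?thesis by (auto simp: I_def)
  qed
  have "x = 1 * x + 0 * y" "y = 0 * x + 1 * y" by simp_all
  then have xy: "x \<in> I" "y \<in> I" unfolding I_def by blast+
  obtain m :: "complex \<Rightarrow> nat" where m: "\<And>z. z \<in> eisenstein \<Longrightarrow> (cmod z)^2 = real (m z)"
    using eisenstein_norm_nat by metis
  obtain d where d: "d \<in> I" "d \<noteq> 0" and least: "\<And>z. z \<in> I \<Longrightarrow> z \<noteq> 0 \<Longrightarrow> m d \<le> m z"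
    using ex_has_least_nat[of "\<lambda>z. z \<in> I \<and> z \<noteq> 0" x m] xy E(3) by auto
  have dvd: "\<exists>k\<in>eisenstein. u = d * k" if u: "u \<in> I" for u
  proof -
    obtain q where q: "q \<in> eisenstein" "cmod (u - q * d) < cmod d"
      using eisenstein_division[of u d] u d I_E by blast
    have uI: "u - q * d \<in> I" using I_diff u d q by blast
    have "(cmod (u - q * d))^2 < (cmod d)^2" using q by (intro power_strict_mono) auto
    then have "m (u - q * d) < m d"
      using m[of d] m[of "u - q * d"] d(1) uI I_E by (metis of_nat_less_iff subsetD)
    then have "u - q * d = 0" using least[OF uI] by fastforce
    then show ?thesis using q(1) by (auto simp: mult.commute)
  qed
  obtain r s where "r \<in> eisenstein" "s \<in> eisenstein" "d = r * x + s * y"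
    using d(1) by (auto simp: I_def)
  then show ?thesis using that d dvd[OF xy(1)] dvd[OF xy(2)] I_E by blast
qed

text \<open>
  Every Eisenstein integer prime to 3 has exactly one associate that is congruent to 1 modulo 3, so the
  multiplicative monoid \<open>primary\<close> stands in for the ideals prime to 3.
\<close>
definition primary :: "complex set" where
  "primary = {z. \<exists>x\<in>eisenstein. z = 1 + 3 * x}"

lemma primary_eisenstein: "z \<in> primary \<Longrightarrow> z \<in> eisenstein"
  by (auto simp: primary_def)

lemma primaryI: "x \<in> eisenstein \<Longrightarrow> 1 + 3 * x \<in> primary"
  by (auto simp: primary_def)

lemma primary_1 [simp, intro]: "1 \<in> primary"
  using primaryI[of 0] by simp

lemma eis_primary_iff: "eis a b \<in> primary \<longleftrightarrow> a mod 3 = 1 \<and> b mod 3 = 0"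
proof
  assume "eis a b \<in> primary"
  then obtain c d where "eis a b = 1 + 3 * eis c d"
    by (auto simp: primary_def elim!: eisensteinE)
  also have "\<dots> = eis (1 + 3 * c) (3 * d)" by (simp add: eis_def algebra_simps)
  finally show "a mod 3 = 1 \<and> b mod 3 = 0" by simp
next
  assume "a mod 3 = 1 \<and> b mod 3 = 0"
  then have "a = 1 + 3 * (a div 3)" "b = 3 * (b div 3)" by presburger+
  then have "eis a b = eis (1 + 3 * (a div 3)) (3 * (b div 3))" by simp
  also have "\<dots> = 1 + 3 * eis (a div 3) (b div 3)" by (simp add: eis_def algebra_simps)
  finally show "eis a b \<in> primary" by (auto simp: primary_def)
qed

lemma of_int_primary_iff: "of_int n \<in> primary \<longleftrightarrow> n mod 3 = 1"
  by (simp add: of_int_eis eis_primary_iff)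

lemma primary_mult [intro]:
  assumes "x \<in> primary" "y \<in> primary"
  shows "x * y \<in> primary"
proof -
  obtain u v where "x = 1 + 3 * u" "y = 1 + 3 * v" "u \<in> eisenstein" "v \<in> eisenstein"
    using assms by (auto simp: primary_def)
  moreover from this have "x * y = 1 + 3 * (u + v + 3 * u * v)" by (simp add: algebra_simps)
  moreover have "u + v + 3 * u * v \<in> eisenstein"
    using calculation by (intro eisenstein_add eisenstein_mult) auto
  ultimately show ?thesis by (metis primaryI)
qed

lemma primary_power [intro]: "x \<in> primary \<Longrightarrow> x ^ n \<in> primary"
  by (induction n) auto

lemma primary_cnj [intro]: "x \<in> primary \<Longrightarrow> cnj x \<in> primary"
  by (auto simp: primary_def intro!: bexI[where x = "cnj _"])

lemma primary_quotient:
  assumes "x \<in> primary" "x * y \<in> primary" "y \<in> eisenstein"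
  shows "y \<in> primary"
proof -
  obtain u v where "x = 1 + 3 * u" "x * y = 1 + 3 * v" "u \<in> eisenstein" "v \<in> eisenstein"
    using assms by (auto simp: primary_def)
  moreover from this have "y = 1 + 3 * (v - u * y)" by (simp add: algebra_simps)
  ultimately show ?thesis using assms(3) by (metis eisenstein_diff eisenstein_mult primaryI)
qed

lemma primary_norm:
  assumes "z \<in> primary"
  obtains n :: int where "(cmod z)^2 = of_int n" "n mod 3 = 1" "n \<ge> 1"
proof -
  obtain a b where z: "z = eis a b" using assms primary_eisenstein by (blast elim: eisensteinE)
  have ab: "a mod 3 = 1" "b mod 3 = 0" using assms by (auto simp: z eis_primary_iff)
  define n where "n = a^2 - a * b + b^2"
  obtain c d where cd: "a = 1 + 3 * c" "b = 3 * d"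
    using ab by (metis add.commute add_0 mult_div_mod_eq)
  have "n = 1 + 3 * (2 * c + 3 * c^2 - a * d + 3 * d^2)"
    by (simp add: n_def cd power2_eq_square algebra_simps)
  then have "n mod 3 = 1 mod 3" by (simp only: mod_mult_self2)
  then have "n mod 3 = 1" by simp
  moreover have N: "(cmod z)^2 = of_int n" by (simp add: n_def z cmod_eis_squared)
  moreover have "n \<ge> 0" using zero_le_power2[of "cmod z"] unfolding N by simp
  moreover have "n \<noteq> 0" using \<open>n mod 3 = 1\<close> by auto
  ultimately show ?thesis using that by auto
qed

lemma primary_cmod_ge_1: "z \<in> primary \<Longrightarrow> cmod z \<ge> 1"
  by (erule primary_norm) (use power2_le_imp_le[of 1 "cmod z"] in auto)

lemma primary_nonzero: "z \<in> primary \<Longrightarrow> z \<noteq> 0"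
  using primary_cmod_ge_1 by fastforce

text \<open>The norm is congruent to 1 modulo 3, so it is 1 or at least 4. Norm 1 means a unit, and
  among the six units only 1 is congruent to 1 modulo 3.\<close>

lemma primary_cmod_ge_2:
  assumes "z \<in> primary" "z \<noteq> 1"
  shows "cmod z \<ge> 2"
proof -
  obtain n :: int where n: "(cmod z)^2 = of_int n" "n mod 3 = 1" "n \<ge> 1"
    using assms(1) by (rule primary_norm)
  have "n \<noteq> 1"
  proof
    assume "n = 1"
    obtain a b where z: "z = eis a b" using assms(1) primary_eisenstein by (blast elim: eisensteinE)
    have ab: "a mod 3 = 1" "b mod 3 = 0" using assms(1) by (auto simp: z eis_primary_iff)
    have "real_of_int (a^2 - a * b + b^2) = of_int 1"
      using n(1) unfolding \<open>n = 1\<close> z cmod_eis_squared .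
    then have "a^2 - a * b + b^2 = 1" by (simp only: of_int_eq_iff)
    then have eq: "(2 * a - b)^2 + 3 * b^2 = 4" by (simp add: power2_eq_square algebra_simps)
    then have "3 * b^2 \<le> 4" using zero_le_power2[of "2 * a - b"] by linarith
    then have "b^2 < 2^2" by simp
    then have "\<bar>b\<bar> < 2" using power2_less_imp_less[of "\<bar>b\<bar>" 2] by simp
    then have "b = 0" using ab by presburger
    then have "a^2 = 1" using eq by (simp add: power2_eq_square)
    then have "a = 1 \<or> a = -1" by (simp add: power2_eq_1_iff)
    then have "a = 1" using ab by auto
    then show False using assms(2) z \<open>b = 0\<close> by (simp add: eis_def)
  qed
  then have "n \<ge> 4" using n(2,3) by presburger
  then have "2^2 \<le> (cmod z)^2" unfolding n(1) by simp
  then show ?thesis by (rule power2_le_imp_le) simp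
qed

text \<open>Modulo 3 the norm of \<open>eis a b\<close> is \<open>(a + b)^2\<close>, so six residue
  pairs remain, and each is moved to (1, 0) by one of the six units. Being a unit is expressed by
  \<open>u * cnj u = 1\<close>.\<close>

lemma primary_associate:
  assumes "z \<in> eisenstein" "(cmod z)^2 = of_int n" "\<not> 3 dvd n"
  obtains u where "u \<in> eisenstein" "u * cnj u = 1" "u * z \<in> primary"
proof -
  obtain a b where z: "z = eis a b" using assms(1) by (rule eisensteinE)
  have n: "n = a^2 - a * b + b^2"
    using assms(2) by (simp add: z cmod_eis_squared del: of_int_add of_int_diff of_int_mult of_int_power)
  have "n = (a + b)^2 - 3 * (a * b)" by (simp add: n power2_eq_square algebra_simps)
  then have "\<not> 3 dvd a + b" using assms(3) by (auto simp: power2_eq_square)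
  then have "(a mod 3 + b mod 3) mod 3 \<noteq> 0" by (simp add: mod_add_eq dvd_eq_mod_eq_0)
  moreover have "a mod 3 = 0 \<or> a mod 3 = 1 \<or> a mod 3 = 2" "b mod 3 = 0 \<or> b mod 3 = 1 \<or> b mod 3 = 2"
    by presburger+
  ultimately consider "a mod 3 = 1" "b mod 3 = 0" | "a mod 3 = 2" "b mod 3 = 0" | "a mod 3 = 2" "b mod 3 = 2"
    | "a mod 3 = 1" "b mod 3 = 1" | "a mod 3 = 0" "b mod 3 = 1" | "a mod 3 = 0" "b mod 3 = 2"
    by fastforce
  then have "\<exists>c d. eis c d * cnj (eis c d) = 1 \<and> eis c d * eis a b \<in> primary"
  proof cases
    case 1
    then have "eis a b \<in> primary" unfolding eis_primary_iff by presburger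
    then show ?thesis
      by (intro exI[of _ 1] exI[of _ 0]) (simp add: eis_mult cnj_eis eis_def)
  next
    case 2
    then have "eis (-a) (-b) \<in> primary" unfolding eis_primary_iff by presburger
    then show ?thesis
      by (intro exI[of _ "-1"] exI[of _ 0]) (simp add: eis_mult cnj_eis, simp add: eis_def)
  next
    case 3
    then have "eis (-b) (a - b) \<in> primary" unfolding eis_primary_iff by presburger
    then show ?thesis
      by (intro exI[of _ 0] exI[of _ 1]) (simp add: eis_mult cnj_eis, simp add: eis_def)
  next
    case 4
    then have "eis b (b - a) \<in> primary" unfolding eis_primary_iff by presburger
    then show ?thesis
      by (intro exI[of _ 0] exI[of _ "-1"]) (simp add: eis_mult cnj_eis, simp add: eis_def)
  next
    case 5
    then have "eis (b - a) (- a) \<in> primary" unfolding eis_primary_iff by presburger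
    then show ?thesis
      by (intro exI[of _ "-1"] exI[of _ "-1"]) (simp add: eis_mult cnj_eis, simp add: eis_def)
  next
    case 6
    then have "eis (a - b) a \<in> primary" unfolding eis_primary_iff by presburger
    then show ?thesis
      by (intro exI[of _ 1] exI[of _ 1]) (simp add: eis_mult cnj_eis, simp add: eis_def)
  qed
  then show ?thesis using that z by blast
qed

section \<open>Prime elements of the monoid\<close>

definition primary_primes :: "complex set" where
  "primary_primes = {z \<in> primary. z \<noteq> 1 \<and> (\<forall>x\<in>primary. \<forall>y\<in>primary. z = x * y \<longrightarrow> x = 1 \<or> y = 1)}"

lemma primary_primes_primary: "\<pi> \<in> primary_primes \<Longrightarrow> \<pi> \<in> primary"
  by (simp add: primary_primes_def)

lemma primary_primes_cmod: "\<pi> \<in> primary_primes \<Longrightarrow> cmod \<pi> \<ge> 2"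
  by (simp add: primary_primes_def primary_cmod_ge_2)

text \<open>Irreducibility is known only inside \<open>primary\<close>, while the common divisor
  \<open>d\<close> of \<open>\<pi>\<close> and \<open>x\<close> lives in the whole ring. Its norm
  divides that of \<open>\<pi>\<close>, which is 1 modulo 3, so \<open>d\<close> has a primary
  associate \<open>u * d\<close>, and this must be 1 or \<open>\<pi>\<close>.\<close>

lemma primary_prime_euclid:
  assumes \<pi>: "\<pi> \<in> primary_primes" and E: "x \<in> eisenstein" "y \<in> eisenstein" "k \<in> eisenstein"
    and eq: "x * y = \<pi> * k"
  shows "(\<exists>q\<in>eisenstein. x = \<pi> * q) \<or> (\<exists>q\<in>eisenstein. y = \<pi> * q)"
proof -
  have \<pi>P: "\<pi> \<in> primary" "\<pi> \<in> eisenstein" "\<pi> \<noteq> 0"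
    using \<pi> primary_primes_primary primary_eisenstein primary_nonzero by blast+
  obtain d r s l m where d: "d \<in> eisenstein" "d \<noteq> 0" "r \<in> eisenstein" "s \<in> eisenstein" "d = r * \<pi> + s * x"
    and l: "l \<in> eisenstein" "\<pi> = d * l" and m: "m \<in> eisenstein" "x = d * m"
    using eisenstein_bezout[OF \<pi>P(2) E(1) \<pi>P(3)] by metis
  obtain n where n: "(cmod d)^2 = real n" using eisenstein_norm_nat[OF d(1)] by blast
  obtain n' where n': "(cmod l)^2 = real n'" using eisenstein_norm_nat[OF l(1)] by blast
  obtain N where N: "(cmod \<pi>)^2 = of_int N" "N mod 3 = 1" using \<pi>P(1) by (rule primary_norm)
  have "real_of_int N = of_int (int n * int n')"
    using N(1) unfolding l(2) norm_mult power_mult_distrib n n' by simp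
  then have "N = int n * int n'" by (simp only: of_int_eq_iff)
  then have "3 dvd int n \<longrightarrow> 3 dvd N" by simp
  then have "\<not> 3 dvd int n" using N(2) by auto
  then obtain u where u: "u \<in> eisenstein" "u * cnj u = 1" "u * d \<in> primary"
    using primary_associate[OF d(1), of "int n"] n by auto
  have d': "d = cnj u * (u * d)" using u(2) by (simp add: algebra_simps)
  have \<pi>': "\<pi> = (u * d) * (cnj u * l)" using u(2) l(2) by (simp add: algebra_simps)
  have "cnj u * l \<in> primary"
    using primary_quotient[OF u(3), of "cnj u * l"] \<pi>' \<pi>P(1) u(1) l(1) by auto
  then consider "u * d = 1" | "cnj u * l = 1"
    using \<pi> u(3) \<pi>' by (auto simp: primary_primes_def)
  then show ?thesis
  proof cases
    case 1
    have "y = (u * d) * y" using 1 by simp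
    also have "\<dots> = u * r * \<pi> * y + u * s * (x * y)"
      by (subst d(5)) (simp add: algebra_simps)
    also have "\<dots> = \<pi> * (u * r * y + u * s * k)" unfolding eq by (simp add: algebra_simps)
    finally show ?thesis using u(1) d E by blast
  next
    case 2
    then have "\<pi> = u * d" using \<pi>' by simp
    then have "d = cnj u * \<pi>" using d' by simp
    then have "x = \<pi> * (cnj u * m)" using m(2) by (simp add: algebra_simps)
    then show ?thesis using u(1) m(1) by blast
  qed
qed

lemma primary_prime_divisor_exists:
  assumes "z \<in> primary" "z \<noteq> 1"
  shows "\<exists>\<pi>\<in>primary_primes. \<exists>q\<in>primary. z = \<pi> * q"
  using assms
proof (induction "nat \<lfloor>(cmod z)^2\<rfloor>" arbitrary: z rule: less_induct)
  case less
  show ?case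
  proof (cases "z \<in> primary_primes")
    case True
    then show ?thesis using primary_1 by force
  next
    case False
    then obtain x y where xy: "x \<in> primary" "y \<in> primary" "z = x * y" "x \<noteq> 1" "y \<noteq> 1"
      using less.prems by (auto simp: primary_primes_def)
    obtain n where n: "(cmod z)^2 = of_int n" "n \<ge> 1" using less.prems(1) by (rule primary_norm)
    obtain m where m: "(cmod x)^2 = of_int m" "m \<ge> 1" using xy(1) by (rule primary_norm)
    have "cmod x \<ge> 2" "cmod y \<ge> 2" using xy primary_cmod_ge_2 by auto
    then have "cmod x * 1 < cmod x * cmod y" by (intro mult_strict_left_mono) auto
    then have "cmod x < cmod z" using xy(3) by (simp add: norm_mult)
    then have "(cmod x)^2 < (cmod z)^2" by (intro power_strict_mono) auto
    then have "nat \<lfloor>(cmod x)^2\<rfloor> < nat \<lfloor>(cmod z)^2\<rfloor>" using n m by simp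
    then obtain \<pi> q where "\<pi> \<in> primary_primes" "q \<in> primary" "x = \<pi> * q"
      using less.hyps xy by blast
    then show ?thesis using xy by (metis mult.assoc primary_mult)
  qed
qed

lemma primary_cmod_eq_1: "z \<in> primary \<Longrightarrow> cmod z = 1 \<Longrightarrow> z = 1"
  using primary_cmod_ge_2 by fastforce

text \<open>Meant for the norm \<open>\<pi> * cnj \<pi>\<close>. Rational primes are stripped off
  \<open>n\<close> until one is divisible by \<open>\<pi>\<close>; they cannot run out, since
  \<open>\<pi>\<close> does not divide 1.\<close>

lemma primary_prime_divides_rational_prime:
  assumes \<pi>: "\<pi> \<in> primary_primes" and "n > 1" "k \<in> eisenstein" "of_int n = \<pi> * k"
  shows "\<exists>p::int. prime p \<and> (\<exists>k\<in>eisenstein. of_int p = \<pi> * k)"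
  using assms(2-)
proof (induction "nat n" arbitrary: n k rule: less_induct)
  case less
  obtain p where p: "prime p" "p dvd n"
    using less.prems(1) prime_factor_int[of n] by auto
  then obtain m where m: "n = p * m" by blast
  have "of_int p * of_int m = \<pi> * k" using less.prems(3) m by simp
  then consider q where "q \<in> eisenstein" "of_int p = \<pi> * q" | q where "q \<in> eisenstein" "of_int m = \<pi> * q"
    using primary_prime_euclid[OF \<pi> _ _ less.prems(2), of "of_int p" "of_int m"] by auto
  then show ?case
  proof cases
    case 1
    then show ?thesis using p by blast
  next
    case (2 q)
    have p2: "p \<ge> 2" using p(1) by (rule prime_ge_2_int)
    have "0 < p * m" using m less.prems(1) by simp
    then have "m > 0" using p2 by (simp add: zero_less_mult_iff)
    have "m \<noteq> 1"
    proof
      assume "m = 1"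
      then have "\<pi> * q = 1" using 2 by simp
      then have "cmod \<pi> * cmod q = 1" by (metis norm_mult norm_one)
      moreover obtain l where l: "(cmod q)^2 = real l" using eisenstein_norm_nat 2(1) by blast
      ultimately have "(cmod \<pi>)^2 * real l = 1" by (metis power_mult_distrib power_one)
      moreover have "l \<noteq> 0" using calculation by (cases l) auto
      then have "real l \<ge> 1" by simp
      moreover have "(cmod \<pi>)^2 \<ge> 2^2" using primary_primes_cmod[OF \<pi>] by (intro power_mono) auto
      ultimately show False
        using mult_mono[of "2^2" "(cmod \<pi>)^2" 1 "real l"] by simp
    qed
    then have "m > 1" using \<open>m > 0\<close> by simp
    moreover have "m < n" using mult_right_mono[OF p2, of m] m \<open>m > 0\<close> by linarith
    ultimately show ?thesis using less.hyps[of m q] 2 by simp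
  qed
qed

text \<open>\<open>\<pi>\<close> divides a rational prime \<open>p\<close>, so its norm
  \<open>n\<close> divides \<open>p^2\<close> and is not 1. If \<open>n = p^2\<close>, the cofactor
  is a unit, and comparing residues modulo 3 shows that \<open>\<pi>\<close> is \<open>p\<close> or
  \<open>-p\<close>, against \<open>nonreal\<close>.\<close>

lemma primary_prime_norm:
  assumes \<pi>: "\<pi> \<in> primary_primes" and nonreal: "Im \<pi> \<noteq> 0"
  obtains p :: int where "prime p" "p mod 3 = 1" "(cmod \<pi>)^2 = of_int p"
proof -
  have \<pi>P: "\<pi> \<in> primary" using \<pi> by (rule primary_primes_primary)
  obtain n :: int where n: "(cmod \<pi>)^2 = of_int n" "n mod 3 = 1" "n \<ge> 1" using \<pi>P by (rule primary_norm)
  have "(cmod \<pi>)^2 \<ge> 2^2" using primary_primes_cmod[OF \<pi>] by (intro power_mono) auto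
  then have n4: "n \<ge> 4" using n(1) by simp
  have "of_int n = \<pi> * cnj \<pi>" using n(1) by (metis complex_norm_square of_real_of_int_eq)
  moreover have "cnj \<pi> \<in> eisenstein" using \<pi>P primary_eisenstein by blast
  ultimately obtain p k where p: "prime p" "k \<in> eisenstein" "of_int p = \<pi> * k"
    using primary_prime_divides_rational_prime[OF \<pi>, of n "cnj \<pi>"] n4 by auto
  obtain m where m: "(cmod k)^2 = real m" using eisenstein_norm_nat p(2) by blast
  have "(cmod (of_int p))^2 = (cmod \<pi>)^2 * (cmod k)^2"
    unfolding p(3) norm_mult power_mult_distrib ..
  then have "real_of_int (p^2) = of_int (n * int m)" using n(1) m by simp
  then have pn: "p^2 = n * int m" by (simp only: of_int_eq_iff)
  then have "n dvd p^2" by simp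
  then obtain i where i: "i \<le> 2" "n = p^i"
    using divides_primepow[OF p(1), of n 2] n4 by auto
  consider "i = 0" | "i = 1" | "i = 2" using i(1) by linarith
  then have "n = p"
  proof cases
    case 3
    then have "n * int m = n * 1" using pn i by simp
    then have "int m = 1" using n4 by simp
    then have k1: "cmod k = 1" using m by (simp add: power2_eq_1_iff) (use norm_ge_zero[of k] in linarith)
    have "n = p * p" using 3 i by (simp add: power2_eq_square)
    then have "3 dvd p \<longrightarrow> 3 dvd n" by simp
    then have "\<not> 3 dvd p" using n(2) by auto
    then have "p mod 3 = 1 \<or> p mod 3 = 2" by presburger
    then have False
    proof
      assume "p mod 3 = 1"
      then have "of_int p \<in> primary" by (simp add: of_int_primary_iff)
      then have "k \<in> primary" using primary_quotient[OF \<pi>P] p by metis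
      then have "k = 1" using k1 primary_cmod_eq_1 by blast
      then have "\<pi> = of_int p" using p(3) by simp
      then show False using nonreal by simp
    next
      assume "p mod 3 = 2"
      then have "(- p) mod 3 = 1" by presburger
      then have "of_int (- p) \<in> primary" by (simp add: of_int_primary_iff del: of_int_minus)
      moreover have "of_int (- p) = \<pi> * (- k)" using p(3) by simp
      ultimately have "- k \<in> primary" using primary_quotient[OF \<pi>P, of "- k"] p(2) by auto
      then have "- k = 1" using k1 primary_cmod_eq_1[of "- k"] by simp
      then have "\<pi> = of_int (- p)" using p(3) by (metis mult_minus_right mult.right_neutral minus_equation_iff of_int_minus)
      then show False using nonreal by simp
    qed
    then show ?thesis ..
  qed (use i n4 in auto)
  then show ?thesis using that[of p] p n by simp
qed

text \<open>\<open>\<pi>\<close> divides \<open>J * cnj J\<close>, hence one of the two factors; the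
  quotient is primary of absolute value 1, and so equal to 1.\<close>

lemma primary_same_norm:
  assumes \<pi>: "\<pi> \<in> primary_primes" and J: "J \<in> primary" and eq: "cmod J = cmod \<pi>"
  shows "J = \<pi> \<or> J = cnj \<pi>"
proof -
  have \<pi>P: "\<pi> \<in> primary" using \<pi> by (rule primary_primes_primary)
  have "J * cnj J = \<pi> * cnj \<pi>" by (simp add: complex_norm_square[symmetric] eq)
  then consider q where "q \<in> eisenstein" "J = \<pi> * q" | q where "q \<in> eisenstein" "cnj J = \<pi> * q"
    using primary_prime_euclid[OF \<pi>, of J "cnj J" "cnj \<pi>"] J \<pi>P primary_eisenstein by blast
  then show ?thesis
  proof cases
    case (1 q)
    then have "q \<in> primary" using primary_quotient[OF \<pi>P] J by metis
    moreover have "cmod q = 1" using 1 eq primary_nonzero[OF \<pi>P] by (simp add: norm_mult)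
    ultimately have "q = 1" by (rule primary_cmod_eq_1)
    then show ?thesis using 1 by simp
  next
    case (2 q)
    then have "q \<in> primary" using primary_quotient[OF \<pi>P, of q] J by (metis primary_cnj)
    moreover have "cmod (cnj J) = cmod \<pi> * cmod q" unfolding 2(2) by (rule norm_mult)
    then have "cmod q = 1" using eq primary_nonzero[OF \<pi>P] by simp
    ultimately have "q = 1" by (rule primary_cmod_eq_1)
    then show ?thesis using 2 by (metis complex_cnj_cnj mult.right_neutral)
  qed
qed

section \<open>The cubic Jacobi sum\<close>

text \<open>An orbit of \<open>T\<close> that is not a fixed point has three elements with a common
  value and contributes a multiple of 3; the induction removes one such orbit at a time.\<close>

lemma sum_order_3_orbits:
  fixes f :: "'a \<Rightarrow> complex"
  assumes "finite A"
    and "\<And>x. x \<in> A \<Longrightarrow> T x \<in> A" "\<And>x. x \<in> A \<Longrightarrow> T (T (T x)) = x"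
    and "\<And>x. x \<in> A \<Longrightarrow> f (T x) = f x" "\<And>x. x \<in> A \<Longrightarrow> f x \<in> eisenstein"
  shows "\<exists>e\<in>eisenstein. sum f A = sum f {x \<in> A. T x = x} + 3 * e"
  using assms
proof (induction A rule: finite_psubset_induct)
  case (psubset A)
  show ?case
  proof (cases "\<exists>x\<in>A. T x \<noteq> x")
    case False
    then have "{x \<in> A. T x = x} = A" by auto
    then show ?thesis by (auto intro!: bexI[of _ 0])
  next
    case True
    then obtain x where x: "x \<in> A" "T x \<noteq> x" by blast
    define O3 where "O3 = {x, T x, T (T x)}"
    note clo = psubset.prems(1) and T3 = psubset.prems(2) and inv = psubset.prems(3) and fE = psubset.prems(4)
    have inA: "T x \<in> A" "T (T x) \<in> A" using x clo by auto
    have ne: "T (T x) \<noteq> x" "T (T x) \<noteq> T x"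
      using x T3[OF x(1)] T3[OF inA(1)] by metis+
    have O3: "O3 \<subseteq> A" using x inA by (auto simp: O3_def)
    have sumO: "sum f O3 = 3 * f x"
      using x ne inv[OF x(1)] inv[OF inA(1)] by (simp add: O3_def)
    have nofix: "{y \<in> A. T y = y} = {y \<in> A - O3. T y = y}"
      using x ne T3[OF x(1)] by (auto simp: O3_def)
    have "\<exists>e\<in>eisenstein. sum f (A - O3) = sum f {y \<in> A - O3. T y = y} + 3 * e"
    proof (rule psubset.IH)
      show "A - O3 \<subset> A" using x by (auto simp: O3_def)
      show "T y \<in> A - O3" if "y \<in> A - O3" for y
      proof -
        have "y = T (T (T y))" using that T3 by auto
        then have "T y \<notin> O3"
          using that T3[OF x(1)] unfolding O3_def by (metis DiffD2 O3_def insertCI insertE empty_iff)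
        then show ?thesis using that clo by auto
      qed
    qed (use T3 inv fE in auto)
    then obtain e where e: "e \<in> eisenstein" "sum f (A - O3) = sum f {y \<in> A - O3. T y = y} + 3 * e" by blast
    have "sum f A = sum f (A - O3) + sum f O3"
      using O3 psubset.hyps by (subst sum.subset_diff[of O3 A]) auto
    also have "\<dots> = sum f {y \<in> A. T y = y} + 3 * (e + f x)"
      unfolding nofix e(2) sumO by (simp add: algebra_simps)
    finally show ?thesis using e(1) fE[OF x(1)] by blast
  qed
qed

section \<open>Cubic residue characters\<close>

lemma omega_powers: "\<omega>^3 = 1" "\<omega>^2 = -1 - \<omega>"
  by (simp_all add: complex_eq_iff power2_eq_square power3_eq_cube)

lemma omega_power_cong: "[i = j] (mod 3) \<Longrightarrow> \<omega>^i = \<omega>^j"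
proof -
  have "\<omega>^i = \<omega>^(i mod 3)" for i
  proof -
    have "\<omega>^i = \<omega>^(3 * (i div 3) + i mod 3)" by simp
    then show ?thesis by (simp only: power_add power_mult omega_powers) simp
  qed
  then show "[i = j] (mod 3) \<Longrightarrow> \<omega>^i = \<omega>^j"
    by (metis unique_euclidean_semiring_class.cong_def)
qed

text \<open>\<open>char_eq_1\<close> and \<open>cube_root_of_unity\<close> record what is used of a
  primitive root modulo \<open>p\<close>, so that the computations with the character do not mention
  discrete logarithms.\<close>

locale cubic_character = residue_character p \<psi> for p :: int and \<psi> :: "int \<Rightarrow> complex" +
  assumes p_mod_3: "p mod 3 = 1"
    and char_values: "\<not> p dvd x \<Longrightarrow> \<psi> x \<in> {1, \<omega>, \<omega>^2}"
    and char_eq_1: "\<psi> x = 1 \<Longrightarrow> \<exists>y. [y^3 = x] (mod p)"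
    and cube_root_of_unity: "\<exists>r. p dvd r^2 + r + 1"
begin

lemma char_cube: "\<not> p dvd x \<Longrightarrow> \<psi> x ^ 3 = 1"
proof -
  have "(\<omega>^2)^3 = 1" using omega_powers(1) by (metis mult.commute power_mult power_one)
  then show "\<not> p dvd x \<Longrightarrow> \<psi> x ^ 3 = 1" using char_values[of x] omega_powers(1) by auto
qed

lemma char_square: "\<psi> x ^ 2 = cnj (\<psi> x)"
proof (cases "p dvd x")
  case True
  then show ?thesis by (simp add: char_dvd)
next
  case False
  have "(\<omega>^2)^2 = \<omega>" using omega_powers by (simp add: power2_eq_square power3_eq_cube algebra_simps)
  moreover have "cnj (\<omega>^2) = \<omega>" "cnj \<omega> = \<omega>^2" using omega_powers(2) cnj_omega by simp_all
  ultimately show ?thesis using char_values[OF False] by auto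
qed

lemma char_cnj_mult: "\<not> p dvd x \<Longrightarrow> \<psi> x * cnj (\<psi> x) = 1"
  using char_cube[of x] by (simp add: char_square[symmetric] power2_eq_square power3_eq_cube mult.assoc)

lemma cnj_char_inv: "\<not> p dvd x \<Longrightarrow> cnj (\<psi> x) = \<psi> (inv_mod x)"
  using char_cnj_mult[of x] char_inv_mod[of x] char_nonzero[of x] by (metis mult_left_cancel)

lemma char_minus_1: "\<psi> (-1) = 1"
proof -
  have "\<not> p dvd -1" using p_gt_2 by auto
  moreover have "\<psi> (-1) ^ 3 = \<psi> (-1)" using char_mult[of "-1" "-1"] char_1 char_mult[of 1 "-1"]
    by (simp add: power3_eq_cube)
  ultimately show ?thesis using char_cube by metis
qed

lemma p_not_dvd_3: "\<not> p dvd 3"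
proof
  assume "p dvd 3"
  then have "p = 3" using p_gt_2 zdvd_imp_le[of p 3] by simp
  then show False using p_mod_3 by simp
qed

text \<open>The right side is 3 at nonzero cubes, 0 at noncubes and 1 at multiples of
  \<open>p\<close>. The roots of a nonzero cube are \<open>z\<close>, \<open>r * z\<close> and
  \<open>(- 1 - r) * z\<close>, with \<open>r\<close> a primitive cube root of unity modulo
  \<open>p\<close>.\<close>

lemma count_cube_roots:
  "(\<Sum>x\<in>{0..<p}. of_bool ([x^3 = y] (mod p))) = 1 + \<psi> y + \<psi> y ^ 2"
proof (cases "p dvd y")
  case True
  have "[x^3 = y] (mod p) \<longleftrightarrow> p dvd x" for x
    using True p_dvd_power_iff[of 3 x] by (metis cong_dvd_iff cong_0_iff cong_sym cong_trans zero_less_numeral)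
  then have "{0..<p} \<inter> {x. [x^3 = y] (mod p)} = {0}" using p_gt_2 by (auto dest: zdvd_imp_le)
  then show ?thesis using True by (simp add: char_dvd)
next
  case y: False
  show ?thesis
  proof (cases "\<psi> y = 1")
    case True
    then obtain z where z: "[z^3 = y] (mod p)" using char_eq_1 by blast
    then have nz: "\<not> p dvd z" using y p_dvd_power_iff[of 3 z] cong_dvd_iff by fastforce
    obtain r where r: "p dvd r^2 + r + 1" using cube_root_of_unity by blast
    have iff: "[x^3 = y] (mod p) \<longleftrightarrow> [x = z] (mod p) \<or> [x = r * z] (mod p) \<or> [x = (- 1 - r) * z] (mod p)" for x
    proof -
      have "[x^3 = y] (mod p) \<longleftrightarrow> [x^3 = z^3] (mod p)" using z by (meson cong_sym cong_trans)
      also have "\<dots> \<longleftrightarrow> p dvd x^3 - z^3" by (rule cong_iff_dvd_diff)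
      also have "x^3 - z^3 = (x - z) * ((x - r * z) * (x - (- 1 - r) * z)) + (r^2 + r + 1) * (z^2 * (x - z))"
        by (simp add: power2_eq_square power3_eq_cube algebra_simps)
      also have "p dvd \<dots> \<longleftrightarrow> p dvd (x - z) * ((x - r * z) * (x - (- 1 - r) * z))"
        using r by (intro dvd_add_left_iff) simp
      finally show ?thesis by (simp only: p_dvd_mult_iff cong_iff_dvd_diff)
    qed
    have nd: "\<not> [z = r * z] (mod p)" "\<not> [z = (- 1 - r) * z] (mod p)" "\<not> [r * z = (- 1 - r) * z] (mod p)"
    proof -
      \<comment> \<open>Modulo \<open>r^2 + r + 1\<close> each of these three numbers divides 3,
        which \<open>p\<close> does not divide; so the cube roots of unity are distinct.\<close>
      have no: "\<not> p dvd r - 1" "\<not> p dvd r + 2" "\<not> p dvd 2 * r + 1"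
      proof -
        have 1: "3 = (r^2 + r + 1) - (r - 1) * (r + 2)" by (simp add: power2_eq_square algebra_simps)
        show "\<not> p dvd r - 1" "\<not> p dvd r + 2"
          using p_not_dvd_3 r 1 by (metis dvd_diff dvd_mult2, metis dvd_diff dvd_mult)
        have 2: "3 = 2 * 2 * (r^2 + r + 1) - (2 * r + 1) * (2 * r + 1)"
          by (simp add: power2_eq_square algebra_simps)
        show "\<not> p dvd 2 * r + 1"
          using p_not_dvd_3 r 2 by (metis dvd_diff dvd_mult)
      qed
      have "z - r * z = - (r - 1) * z" "z - (- 1 - r) * z = (r + 2) * z" "r * z - (- 1 - r) * z = (2 * r + 1) * z"
        by (simp_all add: algebra_simps)
      then show "\<not> [z = r * z] (mod p)" "\<not> [z = (- 1 - r) * z] (mod p)" "\<not> [r * z = (- 1 - r) * z] (mod p)"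
        using no nz by (simp_all only: cong_iff_dvd_diff p_dvd_mult_iff dvd_minus_iff simp_thms)
    qed
    have "{0..<p} \<inter> {x. [x^3 = y] (mod p)} = {z mod p, (r * z) mod p, ((- 1 - r) * z) mod p}"
      unfolding iff using p_gt_2 by (auto simp: unique_euclidean_semiring_class.cong_def)
    moreover have "card \<dots> = 3"
      using nd by (simp add: unique_euclidean_semiring_class.cong_def)
    ultimately show ?thesis using True by simp
  next
    case False
    have "\<not> [x^3 = y] (mod p)" for x
    proof
      assume c: "[x^3 = y] (mod p)"
      then have "\<not> p dvd x" using y p_dvd_power_iff[of 3 x] cong_dvd_iff by fastforce
      moreover have "\<psi> y = \<psi> x ^ 3" using char_cong[OF c] by (simp add: power3_eq_cube char_mult)
      ultimately show False using char_cube False by simp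
    qed
    moreover have "1 + \<psi> y + \<psi> y ^ 2 = 0"
    proof -
      have "(\<psi> y - 1) * (1 + \<psi> y + \<psi> y ^ 2) = \<psi> y ^ 3 - 1"
        by (simp add: power2_eq_square power3_eq_cube algebra_simps)
      then show ?thesis using char_cube[OF y] False by simp
    qed
    ultimately show ?thesis by simp
  qed
qed

text \<open>Since \<open>\<psi> (-1) = 1\<close>, this is the usual Jacobi sum \<open>J(\<psi>, \<psi>)\<close>.\<close>
definition jacobi :: complex where
  "jacobi = (\<Sum>v\<in>{0..<p}. \<psi> v * \<psi> (v + 1))"

text \<open>The solutions of \<open>x^3 = v * (v + 1)\<close> modulo \<open>p\<close> are counted
  twice. For fixed \<open>x\<close> the quadratic in \<open>v\<close> has discriminant
  \<open>4 * x^3 + 1\<close>; for fixed \<open>v\<close> the number of cube roots is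
  \<open>1 + \<psi> + \<psi>^2\<close> at \<open>v * (v + 1)\<close>, and squaring a value of
  \<open>\<psi>\<close> conjugates it.\<close>

lemma Legendre_sum_eq_jacobi:
  "of_int (\<Sum>x\<in>{0..<p}. Legendre (4 * x^3 + 1) p) = jacobi + cnj jacobi"
proof -
  have L: "Legendre (4 * x^3 + 1) p = (\<Sum>v\<in>{0..<p}. of_bool ([x^3 = v * (v + 1)] (mod p))) - 1" for x
  proof -
    have "(\<Sum>v\<in>{0..<p}. of_bool ([x^3 = v * (v + 1)] (mod p))) = (\<Sum>v\<in>{0..<p}. of_bool (p dvd 1 * v^2 + 1 * v + (- (x^3))) :: int)"
    proof (intro sum.cong refl arg_cong[where f = of_bool])
      fix v
      have "1 * v^2 + 1 * v + (- (x^3)) = v * (v + 1) - x^3" by (simp add: power2_eq_square algebra_simps)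
      then show "[x^3 = v * (v + 1)] (mod p) = (p dvd 1 * v^2 + 1 * v + (- (x^3)))"
        by (metis cong_iff_dvd_diff cong_sym_eq)
    qed
    also have "\<dots> = 1 + Legendre (1^2 - 4 * 1 * (- (x^3))) p"
      using p_gt_2 by (intro count_quadratic_roots) auto
    finally show ?thesis by (simp add: add.commute)
  qed
  have "of_int (\<Sum>x\<in>{0..<p}. Legendre (4 * x^3 + 1) p) =
     (\<Sum>x\<in>{0..<p}. \<Sum>v\<in>{0..<p}. of_bool ([x^3 = v * (v + 1)] (mod p))) - (of_int p :: complex)"
    unfolding L using p_gt_2 by (simp add: sum_subtractf)
  also have "(\<Sum>x\<in>{0..<p}. \<Sum>v\<in>{0..<p}. of_bool ([x^3 = v * (v + 1)] (mod p))) =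
     (\<Sum>v\<in>{0..<p}. 1 + \<psi> (v * (v + 1)) + \<psi> (v * (v + 1)) ^ 2)"
    by (subst sum.swap) (simp only: count_cube_roots)
  also have "\<dots> = of_int p + jacobi + cnj jacobi"
    using p_gt_2 by (simp add: sum.distrib jacobi_def char_mult power_mult_distrib char_square)
  finally show ?thesis by simp
qed

lemma char_eisenstein: "\<psi> x \<in> eisenstein"
proof -
  have "\<omega>^2 \<in> eisenstein" unfolding power2_eq_square by (intro eisenstein_mult eisenstein_omega)
  then show ?thesis using char_values[of x] char_dvd[of x] by (cases "p dvd x") auto
qed

text \<open>
  The summand \<open>\<psi> v * \<psi> (v + 1)\<close> is invariant under the map \<open>v \<mapsto> -1 / (1 + v)\<close> of order three, whose
  fixed points are the two roots of \<open>v\<^sup>2 + v + 1\<close>, where the summand is 1. Hence the sum is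
  congruent to 2 modulo 3.
\<close>
lemma minus_jacobi_primary: "- jacobi \<in> primary"
proof -
  \<comment> \<open>The residues 0 and -1 are left out: the summand vanishes there, and the map
    sends 0 to -1 and -1 to infinity.\<close>
  define A where "A = {1..<p-1}"
  define T where "T v = (- inv_mod (1 + v)) mod p" for v
  define f where "f v = \<psi> v * \<psi> (v + 1)" for v
  have A: "v \<in> A \<longleftrightarrow> v \<in> {0..<p} \<and> \<not> p dvd v \<and> \<not> p dvd 1 + v" for v
  proof
    assume "v \<in> A"
    then show "v \<in> {0..<p} \<and> \<not> p dvd v \<and> \<not> p dvd 1 + v"
      by (auto simp: A_def dest: zdvd_imp_le)
  next
    assume v: "v \<in> {0..<p} \<and> \<not> p dvd v \<and> \<not> p dvd 1 + v"
    then have "v \<noteq> 0" "v \<noteq> p - 1" by auto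
    then show "v \<in> A" using v by (auto simp: A_def)
  qed
  have T: "[(1 + v) * T v = -1] (mod p)" "[(1 + v) * (1 + T v) = v] (mod p)" if "\<not> p dvd 1 + v" for v
  proof -
    have "[(1 + v) * T v = (1 + v) * (- inv_mod (1 + v))] (mod p)"
      unfolding T_def by (intro cong_mult cong_refl) (simp add: unique_euclidean_semiring_class.cong_def)
    also have "(1 + v) * (- inv_mod (1 + v)) = - ((1 + v) * inv_mod (1 + v))" by simp
    also have "[\<dots> = -1] (mod p)" using inv_mod[OF that] by (simp only: cong_minus_minus_iff)
    finally show 1: "[(1 + v) * T v = -1] (mod p)" .
    show "[(1 + v) * (1 + T v) = v] (mod p)"
      using cong_add[OF cong_refl[of "1 + v"] 1] by (simp add: algebra_simps)
  qed
  have TA: "T v \<in> A" if "v \<in> A" for v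
  proof -
    have v: "\<not> p dvd v" "\<not> p dvd 1 + v" using that A by auto
    have "\<not> p dvd (1 + v) * T v" using cong_dvd_iff[OF T(1)[OF v(2)]] p_gt_2 by auto
    moreover have "\<not> p dvd (1 + v) * (1 + T v)" using cong_dvd_iff[OF T(2)[OF v(2)]] v by auto
    ultimately show ?thesis using p_gt_2 unfolding A by (auto simp: T_def p_dvd_mult_iff)
  qed
  have T3: "T (T (T v)) = v" if v: "v \<in> A" for v
  proof -
    define a b c where "a = T v" and "b = T a" and "c = T b"
    have nd: "\<not> p dvd 1 + v" "\<not> p dvd 1 + a" "\<not> p dvd 1 + b" "\<not> p dvd a" "\<not> p dvd v"
      and abc: "a \<in> A" "b \<in> A" "c \<in> A"
      using v TA A by (auto simp: a_def b_def c_def)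
    have 1: "[(1 + v) * a = -1] (mod p)" "[(1 + v) * (1 + a) = v] (mod p)"
      and 2: "[(1 + a) * b = -1] (mod p)" "[(1 + a) * (1 + b) = a] (mod p)"
      and 3: "[(1 + b) * c = -1] (mod p)"
      using T nd by (auto simp: a_def b_def c_def)
    have "[a * c = (1 + a) * (1 + b) * c] (mod p)"
      using cong_mult[OF 2(2) cong_refl[of c]] by (rule cong_sym)
    also have "(1 + a) * (1 + b) * c = (1 + a) * ((1 + b) * c)" by simp
    also have "[\<dots> = (1 + a) * (-1)] (mod p)" using 3 by (intro cong_mult cong_refl)
    finally have 4: "[(1 + v) * (a * c) = (1 + v) * ((1 + a) * (-1))] (mod p)"
      by (rule cong_mult[OF cong_refl])
    have "[(1 + v) * (a * c) = (-1) * c] (mod p)"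
      using cong_mult[OF 1(1) cong_refl[of c]] by (simp only: mult.assoc)
    moreover have "[(1 + v) * ((1 + a) * (-1)) = v * (-1)] (mod p)"
      using cong_mult[OF 1(2) cong_refl[of "-1"]] by (simp only: mult.assoc)
    ultimately have "[(-1) * c = v * (-1)] (mod p)"
      using cong_trans[OF cong_sym cong_trans[OF 4]] by blast
    then have "[c = v] (mod p)" by (simp add: cong_minus_minus_iff)
    then show ?thesis using eq_if_cong_residues[of c v] abc v A by (auto simp: a_def b_def c_def)
  qed
  have fT: "f (T v) = f v" if v: "v \<in> A" for v
  proof -
    have nd: "\<not> p dvd 1 + v" using v A by auto
    have 1: "\<psi> (1 + v) * \<psi> (T v) = 1" "\<psi> (1 + v) * \<psi> (1 + T v) = \<psi> v"
      using char_cong[OF T(1)[OF nd]] char_cong[OF T(2)[OF nd]] by (simp_all add: char_mult char_minus_1)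
    \<comment> \<open>Multiplication by \<open>\<psi> (1 + v) ^ 2\<close> clears both denominators;
      the surplus factor is a cube, hence 1.\<close>
    have "\<psi> (1 + v) ^ 2 * f (T v) = (\<psi> (1 + v) * \<psi> (T v)) * (\<psi> (1 + v) * \<psi> (1 + T v))"
      by (simp add: f_def power2_eq_square add.commute)
    also have "\<dots> = \<psi> (1 + v) ^ 3 * \<psi> v" using 1 char_cube[OF nd] by simp
    also have "\<dots> = \<psi> (1 + v) ^ 2 * f v" by (simp add: f_def power2_eq_square power3_eq_cube add.commute)
    finally show ?thesis using char_nonzero[OF nd] by simp
  qed
  have "finite A" by (simp add: A_def)
  moreover have "f v \<in> eisenstein" for v
    unfolding f_def by (intro eisenstein_mult char_eisenstein)
  ultimately obtain e where e: "e \<in> eisenstein" "sum f A = sum f {v \<in> A. T v = v} + 3 * e"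
    using sum_order_3_orbits[of A T f] TA T3 fT by blast
  have fixed: "T v = v \<longleftrightarrow> p dvd 1 * v^2 + 1 * v + 1" if v: "v \<in> A" for v
  proof -
    have nd: "\<not> p dvd 1 + v" and r: "v \<in> {0..<p}" using v A by auto
    have "T v \<in> {0..<p}" using TA[OF v] unfolding A by simp
    then have "T v = v \<longleftrightarrow> [T v = v] (mod p)"
      using eq_if_cong_residues[OF _ r, of "T v"] by auto
    also have "\<dots> \<longleftrightarrow> [(1 + v) * T v = (1 + v) * v] (mod p)" using nd by (simp add: cong_mult_lcancel_p)
    also have "\<dots> \<longleftrightarrow> [(1 + v) * v = -1] (mod p)"
      using T(1)[OF nd] by (auto simp: unique_euclidean_semiring_class.cong_def)
    also have "\<dots> \<longleftrightarrow> p dvd 1 * v^2 + 1 * v + 1"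
      by (simp add: cong_iff_dvd_diff power2_eq_square algebra_simps)
    finally show ?thesis .
  qed
  have fixA: "{v \<in> A. T v = v} = {v \<in> {0..<p}. p dvd 1 * v^2 + 1 * v + 1}"
  proof -
    have "v \<in> A" if "v \<in> {0..<p}" "p dvd 1 * v^2 + 1 * v + 1" for v
    proof -
      have "1 = (1 * v^2 + 1 * v + 1) - v * (1 + v)" by (simp add: power2_eq_square algebra_simps)
      then have "\<not> p dvd v * (1 + v)" using that(2) not_prime_unit prime_p by (metis dvd_diff)
      then show ?thesis using that(1) A by (auto simp: p_dvd_mult_iff)
    qed
    then show ?thesis using fixed A by auto
  qed
  have f_fixed: "f v = 1" if "v \<in> {v \<in> A. T v = v}" for v
  proof -
    have nd: "\<not> p dvd 1 + v" using that A by auto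
    have "f v = \<psi> ((1 + v) * T v)" using that by (simp add: f_def char_mult mult.commute add.commute)
    also have "\<dots> = 1" using char_cong[OF T(1)[OF nd]] char_minus_1 by simp
    finally show ?thesis .
  qed
  have "sum f {v \<in> A. T v = v} = of_nat (card {v \<in> {0..<p}. p dvd 1 * v^2 + 1 * v + 1})"
    using f_fixed by (simp add: fixA)
  also have "\<dots> = of_int (\<Sum>v\<in>{0..<p}. of_bool (p dvd 1 * v^2 + 1 * v + 1))"
    by (simp add: Int_def)
  also have "(\<Sum>v\<in>{0..<p}. of_bool (p dvd 1 * v^2 + 1 * v + 1)) = 1 + Legendre (1^2 - 4 * 1 * 1) p"
    using p_gt_2 by (intro count_quadratic_roots) auto
  also have "Legendre (1^2 - 4 * 1 * 1) p = 1"
  proof -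
    obtain r where r: "p dvd r^2 + r + 1" using cube_root_of_unity by blast
    \<comment> \<open>\<open>2 * r + 1\<close> is a square root of the discriminant -3, so there are
      exactly two fixed points.\<close>
    have "(2 * r + 1)^2 - (1^2 - 4 * 1 * 1) = 4 * (r^2 + r + 1)" by (simp add: power2_eq_square algebra_simps)
    then have "[(2 * r + 1)^2 = 1^2 - 4 * 1 * 1] (mod p)" using r by (metis cong_iff_dvd_diff dvd_mult)
    then have "QuadRes p (1^2 - 4 * 1 * 1)" unfolding QuadRes_def by blast
    moreover have "\<not> [1^2 - 4 * 1 * 1 = 0] (mod p)" using p_not_dvd_3 by (simp add: cong_0_iff)
    ultimately show ?thesis by (simp only: Legendre_def if_False if_True)
  qed
  finally have "sum f A = 2 + 3 * e" using e(2) by simp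
  moreover have "jacobi = sum f A"
  proof -
    have "sum f {0..<p} = sum f A"
    proof (rule sum.mono_neutral_right)
      show "\<forall>v\<in>{0..<p} - A. f v = 0"
      proof
        fix v assume "v \<in> {0..<p} - A"
        then have "p dvd v \<or> p dvd v + 1" using A[of v] by (auto simp: add.commute)
        then show "f v = 0" by (auto simp: f_def char_dvd)
      qed
    qed (auto simp: A_def)
    then show ?thesis by (simp add: jacobi_def f_def)
  qed
  ultimately have "- jacobi = 1 + 3 * (- 1 - e)" by (simp add: algebra_simps)
  then show ?thesis using e(1) by (metis eisenstein_1 eisenstein_diff eisenstein_uminus primaryI)
qed

text \<open>In the product with the conjugate put \<open>x = y * t\<close>: then
  \<open>\<psi> x * cnj (\<psi> y)\<close> is \<open>\<psi> t\<close>, and the inner sum over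
  \<open>y\<close> is a correlation, evaluated by inversion as for the Legendre symbol. Only
  \<open>t = 1\<close> produces \<open>p\<close>; what remains are complete character sums, which
  vanish.\<close>

lemma jacobi_norm: "(cmod jacobi)^2 = of_int p"
proof -
  let ?U = "{1..<p}"
  have jU: "jacobi = (\<Sum>v\<in>?U. \<psi> v * \<psi> (v + 1))"
    using p_gt_2 by (simp add: jacobi_def sum_atLeast1LessThan_int char_0)
  have K: "(\<Sum>y\<in>{0..<p}. \<psi> (t * y + 1) * cnj (\<psi> (y + 1))) =
     (if t = 1 then of_int p * \<psi> t else 0) - \<psi> t" if t: "t \<in> ?U" for t
  proof -
    define g where "g w = \<psi> (t * w + (1 - t)) * cnj (\<psi> w)" for w
    have g_cong: "g x = g y" if "[x = y] (mod p)" for x y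
    proof -
      have "\<psi> (t * x + (1 - t)) = \<psi> (t * y + (1 - t))" "\<psi> x = \<psi> y"
        using that by (auto intro!: char_cong cong_add cong_mult)
      then show ?thesis by (simp add: g_def)
    qed
    have "(\<Sum>y\<in>{0..<p}. \<psi> (t * y + 1) * cnj (\<psi> (y + 1))) = (\<Sum>y\<in>{0..<p}. g (1 * y + 1))"
      by (simp add: g_def algebra_simps)
    also have "\<dots> = (\<Sum>y\<in>{0..<p}. g y)"
      using p_gt_2 g_cong by (intro sum_affine_reindex) auto
    also have "\<dots> = (\<Sum>w\<in>?U. g w)"
      using p_gt_2 by (simp add: sum_atLeast1LessThan_int g_def char_0)
    also have "\<dots> = (\<Sum>w\<in>?U. \<psi> ((1 - t) * inv_mod w + t))"
    proof (rule sum.cong)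
      fix w assume "w \<in> ?U"
      then have w: "\<not> p dvd w" by (rule not_dvd_unit_residue)
      have "g w = \<psi> ((t * w + (1 - t)) * inv_mod w)"
        using w by (simp add: g_def cnj_char_inv char_mult)
      also have "\<dots> = \<psi> ((1 - t) * inv_mod w + t)"
      proof (rule char_cong)
        have "(t * w + (1 - t)) * inv_mod w = (1 - t) * inv_mod w + t * (w * inv_mod w)"
          by (simp add: algebra_simps)
        also have "[\<dots> = (1 - t) * inv_mod w + t * 1] (mod p)"
          by (intro cong_add cong_mult cong_refl inv_mod w)
        finally show "[(t * w + (1 - t)) * inv_mod w = (1 - t) * inv_mod w + t] (mod p)" by simp
      qed
      finally show "g w = \<psi> ((1 - t) * inv_mod w + t)" .
    qed simp
    also have "\<dots> = (\<Sum>v\<in>?U. \<psi> ((1 - t) * v + t))"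
      by (rule sum_inverse_reindex[where f = "\<lambda>v. \<psi> ((1 - t) * v + t)"])
         (intro char_cong cong_add cong_mult cong_refl)
    also have "\<dots> = (if p dvd 1 - t then of_int (p - 1) * \<psi> t else - \<psi> t)"
      by (rule sum_char_affine_units)
    also have "p dvd 1 - t \<longleftrightarrow> t = 1"
      using eq_if_cong_residues[of 1 t] t p_gt_2 by (auto simp: cong_iff_dvd_diff)
    finally show ?thesis by (auto simp: algebra_simps)
  qed
  have "jacobi * cnj jacobi = (\<Sum>y\<in>?U. \<Sum>x\<in>?U. (\<psi> x * \<psi> (x + 1)) * (cnj (\<psi> y) * cnj (\<psi> (y + 1))))"
    unfolding jU by (simp add: sum_distrib_left sum_distrib_right)
  also have "\<dots> = (\<Sum>y\<in>?U. \<Sum>t\<in>?U. \<psi> t * (\<psi> (t * y + 1) * cnj (\<psi> (y + 1))))"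
  proof (rule sum.cong)
    fix y assume "y \<in> ?U"
    then have y: "\<not> p dvd y" by (rule not_dvd_unit_residue)
    define h where "h x = (\<psi> x * \<psi> (x + 1)) * (cnj (\<psi> y) * cnj (\<psi> (y + 1)))" for x
    have h_cong: "h a = h b" if "[a = b] (mod p)" for a b
    proof -
      have "\<psi> a = \<psi> b" "\<psi> (a + 1) = \<psi> (b + 1)"
        using that by (auto intro!: char_cong cong_add)
      then show ?thesis by (simp add: h_def)
    qed
    have "(\<Sum>x\<in>?U. h x) = (\<Sum>t\<in>?U. h (y * t))"
      using sum_mult_reindex[of h y] h_cong y by simp
    also have "\<dots> = (\<Sum>t\<in>?U. \<psi> t * (\<psi> (t * y + 1) * cnj (\<psi> (y + 1))))"
    proof (rule sum.cong)
      fix t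
      have "h (y * t) = (\<psi> y * cnj (\<psi> y)) * (\<psi> t * (\<psi> (t * y + 1) * cnj (\<psi> (y + 1))))"
        by (simp add: h_def char_mult ac_simps)
      then show "h (y * t) = \<psi> t * (\<psi> (t * y + 1) * cnj (\<psi> (y + 1)))" using char_cnj_mult[OF y] by simp
    qed simp
    finally show "(\<Sum>x\<in>?U. (\<psi> x * \<psi> (x + 1)) * (cnj (\<psi> y) * cnj (\<psi> (y + 1)))) =
       (\<Sum>t\<in>?U. \<psi> t * (\<psi> (t * y + 1) * cnj (\<psi> (y + 1))))" by (simp add: h_def)
  qed simp
  also have "\<dots> = (\<Sum>t\<in>?U. \<psi> t * (\<Sum>y\<in>?U. \<psi> (t * y + 1) * cnj (\<psi> (y + 1))))"
    by (subst sum.swap) (simp add: sum_distrib_left)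
  also have "\<dots> = (\<Sum>t\<in>?U. (if t = 1 then of_int p else 0) - \<psi> t ^ 2 - \<psi> t)"
  proof (rule sum.cong)
    fix t assume t: "t \<in> ?U"
    \<comment> \<open>Passing from all residues, as in \<open>K\<close>, to the units drops the term
      1 at \<open>y = 0\<close>.\<close>
    have "(\<Sum>y\<in>?U. \<psi> (t * y + 1) * cnj (\<psi> (y + 1))) = (if t = 1 then of_int p * \<psi> t else 0) - \<psi> t - 1"
      using K[OF t] p_gt_2 by (simp add: sum_atLeast1LessThan_int char_1)
    then show "\<psi> t * (\<Sum>y\<in>?U. \<psi> (t * y + 1) * cnj (\<psi> (y + 1))) = (if t = 1 then of_int p else 0) - \<psi> t ^ 2 - \<psi> t"
      by (simp only:) (simp add: right_diff_distrib char_1 power2_eq_square)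
  qed simp
  also have "\<dots> = of_int p - cnj (\<Sum>t\<in>?U. \<psi> t) - (\<Sum>t\<in>?U. \<psi> t)"
    using p_gt_2 by (simp add: sum_subtractf char_square)
  also have "\<dots> = of_int p" by (simp add: sum_char_units)
  finally have "complex_of_real ((cmod jacobi)^2) = of_real (of_int p)"
    by (simp only: complex_norm_square of_real_of_int_eq)
  then show ?thesis by (simp only: of_real_eq_iff)
qed

end

text \<open>\<open>g ^ i\<close> is sent to \<open>\<omega> ^ i\<close> for a primitive root
  \<open>g\<close>; the exponent is determined modulo \<open>p - 1\<close>, hence modulo 3.\<close>

lemma cubic_character_exists:
  fixes p :: int
  assumes p: "prime p" "p mod 3 = 1"
  shows "\<exists>\<psi>. cubic_character p \<psi>"
proof -
  have p2: "p > 2"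
  proof -
    have "p \<noteq> 2" using p(2) by auto
    then show ?thesis using prime_ge_2_int[OF p(1)] by simp
  qed
  interpret odd_prime p using p p2 by unfold_locales
  define n where "n = nat p"
  have n: "prime n" "int n = p" using p p2 by (simp_all add: n_def)
  obtain g where g: "residue_primroot n g" using prime_primitive_root_exists[of n] n(1) prime_gt_1_nat by blast
  have cop: "coprime n g" and ord: "ord n g = n - 1"
    using g n(1) by (auto simp: residue_primroot_def totient_prime)
  have n3: "3 dvd n - 1"
  proof -
    have "int (n - 1) = p - 1" using n p2 by auto
    moreover have "3 dvd p - 1" using p(2) by presburger
    ultimately show ?thesis by (metis int_dvd_int_iff of_nat_numeral)
  qed
  have log_ex: "\<exists>i. [int g ^ i = x] (mod p)" if "\<not> p dvd x" for x
  proof -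
    have "x mod p \<in> {1..<p}" using that by (rule mod_in_unit_residues)
    then have "nat (x mod p) \<in> totatives n"
      using n by (auto simp: totatives_prime n_def nat_less_eq_zless)
    then obtain i where "nat (x mod p) = g ^ i mod n"
      using residue_primroot_is_generator[OF prime_gt_1_nat[OF n(1)] g] by (auto simp: bij_betw_def)
    then have "int (g ^ i mod n) = int (nat (x mod p))" by simp
    also have "\<dots> = x mod p" using p2 by simp
    finally have "int (g ^ i mod n) = x mod p" .
    then have "[int g ^ i = x] (mod p)" by (simp add: unique_euclidean_semiring_class.cong_def zmod_int n(2))
    then show ?thesis ..
  qed
  have log_unique: "\<omega>^i = \<omega>^j" if "[int g ^ i = int g ^ j] (mod p)" for i j
  proof -
    have "[g ^ i = g ^ j] (mod n)" using that n(2) by (metis cong_int_iff of_nat_power)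
    then have "[i = j] (mod (n - 1))" using order_divides_expdiff[OF cop] ord by simp
    then have "[i = j] (mod 3)" using n3 cong_dvd_modulus_nat by blast
    then show ?thesis by (rule omega_power_cong)
  qed
  have gnd: "\<not> p dvd int g ^ i" for i
  proof -
    have "\<not> n dvd g" using cop n(1) by (metis coprime_absorb_left not_prime_unit)
    then show ?thesis using n(2) prime_p by (metis int_dvd_int_iff prime_dvd_power)
  qed
  define \<psi> where "\<psi> x = (if p dvd x then 0 else \<omega> ^ (SOME i. [int g ^ i = x] (mod p)))" for x
  have psi: "\<psi> x = \<omega> ^ i" if c: "[int g ^ i = x] (mod p)" for x i
  proof -
    have nd: "\<not> p dvd x" using gnd cong_dvd_iff[OF c] by simp
    then have "[int g ^ (SOME i. [int g ^ i = x] (mod p)) = x] (mod p)" using log_ex by (metis someI_ex)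
    then show ?thesis unfolding \<psi>_def using nd c by (simp add: log_unique cong_trans[OF _ cong_sym[OF c]])
  qed
  have "cubic_character p \<psi>"
  proof unfold_locales
    fix x y :: int
    show "\<psi> x = \<psi> y" if "[x = y] (mod p)"
    proof (cases "p dvd x")
      case True
      then show ?thesis using cong_dvd_iff[OF that] by (simp add: \<psi>_def)
    next
      case False
      then obtain i where "[int g ^ i = x] (mod p)" using log_ex by blast
      then show ?thesis using psi that cong_trans by metis
    qed
    show "\<psi> (x * y) = \<psi> x * \<psi> y"
    proof (cases "p dvd x * y")
      case True
      then show ?thesis using p_dvd_mult_iff by (auto simp: \<psi>_def)
    next
      case False
      then obtain i j where ij: "[int g ^ i = x] (mod p)" "[int g ^ j = y] (mod p)"
        using log_ex by (meson dvd_mult dvd_mult2)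
      then have "[int g ^ (i + j) = x * y] (mod p)" by (simp add: power_add cong_mult)
      then show ?thesis using psi[OF ij(1)] psi[OF ij(2)] psi by (metis power_add)
    qed
    show "\<psi> 0 = 0" by (simp add: \<psi>_def)
    show "\<psi> 1 = 1" using psi[of 0 1] by simp
    have "\<psi> (int g) = \<omega>" using psi[of 1 "int g"] by simp
    moreover have "\<omega> \<noteq> 1" by (simp add: complex_eq_iff)
    ultimately show "\<exists>c. \<not> p dvd c \<and> \<psi> c \<noteq> 1" using gnd[of 1] by auto
    show "p mod 3 = 1" by fact
    show "\<psi> x \<in> {1, \<omega>, \<omega>^2}" if nd: "\<not> p dvd x"
    proof -
      obtain i where i: "[int g ^ i = x] (mod p)" using log_ex nd by blast
      have "\<omega>^i = \<omega>^(i mod 3)" by (rule omega_power_cong) (simp add: unique_euclidean_semiring_class.cong_def)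
      moreover have "i mod 3 \<in> {0, 1, 2}" by auto
      ultimately show ?thesis using psi[OF i] by auto
    qed
    show "\<exists>y. [y^3 = x] (mod p)" if one: "\<psi> x = 1"
    proof -
      have nd: "\<not> p dvd x" using one by (auto simp: \<psi>_def)
      then obtain i where i: "[int g ^ i = x] (mod p)" using log_ex by blast
      have "\<omega>^(i mod 3) = \<omega>^i" by (rule omega_power_cong) (simp add: unique_euclidean_semiring_class.cong_def)
      then have "\<omega>^(i mod 3) = 1" using psi[OF i] one by simp
      moreover have "i mod 3 = 0 \<or> i mod 3 = 1 \<or> i mod 3 = 2" by linarith
      moreover have "\<omega> \<noteq> 1" "\<omega>^2 \<noteq> 1" by (simp_all add: omega_powers complex_eq_iff)
      ultimately have "i mod 3 = 0" by auto
      then have "int g ^ i = (int g ^ (i div 3)) ^ 3" by (metis power_mult mult.commute mult_div_mod_eq add_0_right)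
      then show ?thesis using i by metis
    qed
    show "\<exists>r. p dvd r^2 + r + 1"
    proof -
      \<comment> \<open>The power of \<open>g\<close> with this exponent has order 3; it is not 1,
        so it is a root of the other factor of \<open>r^3 - 1\<close>.\<close>
      define k where "k = (n - 1) div 3"
      have k: "3 * k = n - 1" using n3 by (simp add: k_def)
      define r where "r = int g ^ k"
      have "[r^3 = 1] (mod p)"
      proof -
        have "[g ^ (n - 1) = 1] (mod n)" using ord by (metis ord_works)
        then have "[int (g ^ (n - 1)) = int 1] (mod int n)" by (simp only: cong_int_iff)
        moreover have "r^3 = int (g ^ (n - 1))"
          unfolding r_def power_mult[symmetric] mult.commute[of k] k by simp
        ultimately show ?thesis using n(2) by simp
      qed
      then have "p dvd r^3 - 1" by (simp add: cong_iff_dvd_diff)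
      moreover have "r^3 - 1 = (r - 1) * (r^2 + r + 1)" by (simp add: power2_eq_square power3_eq_cube algebra_simps)
      moreover have "\<not> p dvd r - 1"
      proof
        assume "p dvd r - 1"
        then have "[int (g ^ k) = int 1] (mod int n)" by (simp add: cong_iff_dvd_diff r_def n(2))
        then have "[g ^ k = 1] (mod n)" by (simp only: cong_int_iff)
        then have "ord n g dvd k" by (simp only: ord_divides)
        then have "n - 1 dvd k" using ord by simp
        moreover have "k > 0" "k < n - 1" using k p2 n(2) by auto
        ultimately show False by (meson nat_dvd_not_less)
      qed
      ultimately show ?thesis using p_dvd_mult_iff by auto
    qed
  qed
  then show ?thesis by blast
qed

text \<open>Whether \<open>- jacobi\<close> is \<open>\<pi>\<close> or its conjugate depends on the
  choice of \<open>\<psi>\<close>, but the real part does not. The minus sign is there because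
  \<open>- jacobi\<close>, not \<open>jacobi\<close>, is primary.\<close>

theorem Legendre_sum_primary_prime:
  assumes \<pi>: "\<pi> \<in> primary_primes" and p: "prime p" "p mod 3 = 1" "(cmod \<pi>)^2 = of_int p"
  shows "real_of_int (\<Sum>x\<in>{0..<p}. Legendre (4 * x^3 + 1) p) = - 2 * Re \<pi>"
proof -
  obtain \<psi> where "cubic_character p \<psi>" using cubic_character_exists p by blast
  then interpret cubic_character p \<psi> .
  have "(cmod (- jacobi))^2 = (cmod \<pi>)^2" using jacobi_norm p(3) by simp
  then have "cmod (- jacobi) = cmod \<pi>" by (rule power2_eq_imp_eq) auto
  then have "- jacobi = \<pi> \<or> - jacobi = cnj \<pi>"
    using primary_same_norm[OF \<pi> minus_jacobi_primary] by simp
  then have J: "Re jacobi = - Re \<pi>" by (metis minus_complex.sel(1) uminus_complex.sel(1) cnj.sel(1) minus_minus)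
  have "complex_of_int (\<Sum>x\<in>{0..<p}. Legendre (4 * x^3 + 1) p) = jacobi + cnj jacobi"
    by (rule Legendre_sum_eq_jacobi)
  then have "Re (complex_of_int (\<Sum>x\<in>{0..<p}. Legendre (4 * x^3 + 1) p)) = 2 * Re jacobi"
    by (simp only: complex_add_cnj complex_Re_of_int)  simp
  then show ?thesis using J by simp
qed

section \<open>Sums over primary Eisenstein integers\<close>

text \<open>
  The exponent \<open>s\<close> is attached to the absolute value and not to the norm, so the abscissa of
  convergence of the sums below is \<open>s = 2\<close>.
\<close>
definition twist :: "nat \<Rightarrow> real \<Rightarrow> complex \<Rightarrow> complex" where
  "twist k s z = sgn z ^ k * of_real (cmod z powr (- s))"

lemma twist_mult: "twist k s (x * y) = twist k s x * twist k s y"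
  by (simp add: twist_def sgn_mult power_mult_distrib norm_mult powr_mult)

lemma twist_1 [simp]: "twist k s 1 = 1"
  by (simp add: twist_def)

lemma twist_power: "twist k s (x ^ m) = twist k s x ^ m"
  by (induction m) (simp_all add: twist_mult)

lemma norm_twist: "z \<noteq> 0 \<Longrightarrow> cmod (twist k s z) = cmod z powr (- s)"
  by (simp add: twist_def norm_mult norm_power norm_sgn)

section \<open>Absolute convergence for s > 2\<close>

lemma summable_on_int_powr:
  assumes "q > 1"
  shows "(\<lambda>i::int. (1 + \<bar>real_of_int i\<bar>) powr (- q)) summable_on UNIV"
proof -
  have "summable (\<lambda>n. real (Suc n) powr (- q))"
    using assms by (subst summable_Suc_iff) (simp add: summable_real_powr_iff)
  then have nat: "(\<lambda>n. (1 + real n) powr (- q)) summable_on UNIV"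
    by (subst summable_on_UNIV_nonneg_real_iff) simp_all
  have 1: "(\<lambda>i::int. (1 + \<bar>real_of_int i\<bar>) powr (- q)) summable_on range int"
    using nat by (subst summable_on_reindex) (simp_all add: o_def)
  have 2: "(\<lambda>i::int. (1 + \<bar>real_of_int i\<bar>) powr (- q)) summable_on range (\<lambda>n. - int n)"
    using nat by (subst summable_on_reindex) (auto simp: o_def intro!: injI)
  have "(UNIV :: int set) = range int \<union> range (\<lambda>n. - int n)"
    by (auto intro: int_cases2)
  then show ?thesis using summable_on_union[OF 1 2] by simp
qed

lemma primary_eq_image: "primary = (\<lambda>(i, j). eis (1 + 3 * i) (3 * j)) ` UNIV"
proof (intro equalityI subsetI)
  fix z assume z: "z \<in> primary"
  then obtain a b where ab: "z = eis a b" using primary_eisenstein by (blast elim: eisensteinE)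
  then have m: "a mod 3 = 1" "b mod 3 = 0" using z by (auto simp: eis_primary_iff)
  have "a = 1 + 3 * (a div 3)" "b = 3 * (b div 3)" using m by presburger+
  then show "z \<in> (\<lambda>(i, j). eis (1 + 3 * i) (3 * j)) ` UNIV"
    unfolding ab by (intro image_eqI[of _ _ "(a div 3, b div 3)"]) auto
next
  fix z assume "z \<in> (\<lambda>(i, j). eis (1 + 3 * i) (3 * j)) ` (UNIV :: (int \<times> int) set)"
  then show "z \<in> primary" by (auto simp: eis_primary_iff)
qed

lemma inj_primary_param: "inj (\<lambda>(i::int, j::int). eis (1 + 3 * i) (3 * j))"
  by (auto intro!: injI)

text \<open>A product replaces the quadratic form, so that the double sum in
  \<open>primary_summable_powr\<close> is dominated by a product of two sums over the integers, and
  both coordinates are bounded on a disc.\<close>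

lemma cmod_primary_lower:
  "(1 + \<bar>real_of_int i\<bar>) * (1 + \<bar>real_of_int j\<bar>) / 16 \<le> (cmod (eis (1 + 3 * i) (3 * j)))^2"
proof -
  define a b u v where "a = real_of_int (1 + 3 * i)" and "b = real_of_int (3 * j)"
    and "u = 1 + \<bar>real_of_int i\<bar>" and "v = \<bar>real_of_int j\<bar>"
  have N: "(cmod (eis (1 + 3 * i) (3 * j)))^2 = a^2 - a * b + b^2"
    by (simp add: cmod_eis_squared a_def b_def)
  have "0 \<le> (a - b)^2" by simp
  then have 1: "a^2 + b^2 \<le> 2 * (a^2 - a * b + b^2)" by (simp add: power2_eq_square algebra_simps)
  have "1 + \<bar>i\<bar> \<le> 2 * \<bar>1 + 3 * i\<bar>" by presburger
  then have "real_of_int (1 + \<bar>i\<bar>) \<le> real_of_int (2 * \<bar>1 + 3 * i\<bar>)" by (rule of_int_le_iff[THEN iffD2])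
  then have "u \<le> 2 * \<bar>a\<bar>" by (simp add: u_def a_def)
  then have "u^2 \<le> (2 * \<bar>a\<bar>)^2" by (intro power_mono) (auto simp: u_def)
  then have 2: "u^2 \<le> 4 * a^2" by (simp add: power_mult_distrib)
  have 3: "v^2 \<le> b^2" by (simp add: v_def b_def power_mult_distrib)
  have "1 \<le> u" by (simp add: u_def)
  then have 4: "u \<le> u^2" by (simp add: power2_eq_square)
  have "0 \<le> (u - v)^2" by simp
  then have 5: "2 * (u * v) \<le> u^2 + v^2" by (simp add: power2_eq_square algebra_simps)
  have "u * (1 + v) \<le> 16 * (a^2 - a * b + b^2)"
    using 1 2 3 4 5 zero_le_power2[of a] zero_le_power2[of b] unfolding distrib_left by linarith
  then show ?thesis unfolding N by (simp add: u_def v_def)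
qed

lemma primary_summable_powr:
  assumes "r > 2"
  shows "(\<lambda>z. cmod z powr (- r)) summable_on primary"
proof -
  define q where "q = r / 2"
  have q: "q > 1" using assms by (simp add: q_def)
  define g where "g i = (1 + \<bar>real_of_int i\<bar>) powr (- q)" for i :: int
  have g: "g summable_on UNIV" unfolding g_def using q by (rule summable_on_int_powr)
  have gg: "(\<lambda>(i, j). g i * g j) summable_on (UNIV \<times> UNIV)"
  proof (rule summable_on_SigmaI[where g = "\<lambda>i. g i * infsum g UNIV"])
    show "((\<lambda>j. case (i, j) of (i, j) \<Rightarrow> g i * g j) has_sum g i * infsum g UNIV) UNIV" for i
      using g by (auto intro!: has_sum_cmult_right)
    show "(\<lambda>i. g i * infsum g UNIV) summable_on UNIV"
      using g by (rule summable_on_cmult_left)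
  qed (auto simp: g_def)
  have "(\<lambda>p. (1/16) powr (- q) * (case p of (i, j) \<Rightarrow> g i * g j)) summable_on UNIV"
    using gg by (intro summable_on_cmult_right) simp
  then have "(\<lambda>(i, j). cmod (eis (1 + 3 * i) (3 * j)) powr (- r)) summable_on UNIV"
  proof (rule summable_on_comparison_test)
    fix p :: "int \<times> int"
    obtain i j where p: "p = (i, j)" by force
    define N where "N = (cmod (eis (1 + 3 * i) (3 * j)))^2"
    have nz: "eis (1 + 3 * i) (3 * j) \<noteq> 0"
    proof
      assume "eis (1 + 3 * i) (3 * j) = 0"
      moreover have "eis (1 + 3 * i) (3 * j) \<in> primary" by (simp add: eis_primary_iff)
      ultimately show False using primary_nonzero by metis
    qed
    have "N = cmod (eis (1 + 3 * i) (3 * j)) powr 2" using nz by (simp add: N_def)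
    then have "cmod (eis (1 + 3 * i) (3 * j)) powr (- r) = N powr (- q)"
      by (simp only: powr_powr) (simp add: q_def)
    also have "\<dots> \<le> ((1 + \<bar>real_of_int i\<bar>) * (1 + \<bar>real_of_int j\<bar>) / 16) powr (- q)"
      unfolding N_def using cmod_primary_lower[of i j] q by (intro powr_mono2') auto
    also have "\<dots> = (1/16) powr (- q) * (g i * g j)"
      by (simp add: g_def powr_mult powr_divide)
    finally show "(case p of (i, j) \<Rightarrow> cmod (eis (1 + 3 * i) (3 * j)) powr (- r))
        \<le> (1/16) powr (- q) * (case p of (i, j) \<Rightarrow> g i * g j)" by (simp add: p)
  qed (auto simp: split_beta)
  then show ?thesis
    unfolding primary_eq_image by (subst summable_on_reindex[OF inj_primary_param]) (simp add: o_def case_prod_unfold)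
qed

lemma finite_primary_ball: "finite {z \<in> primary. cmod z \<le> R}"
proof -
  define B where "B = {- \<lceil>16 * R^2\<rceil>..\<lceil>16 * R^2\<rceil>}"
  have "{z \<in> primary. cmod z \<le> R} \<subseteq> (\<lambda>(i, j). eis (1 + 3 * i) (3 * j)) ` (B \<times> B)"
  proof
    fix z assume z: "z \<in> {z \<in> primary. cmod z \<le> R}"
    then obtain i j where ij: "z = eis (1 + 3 * i) (3 * j)" by (auto simp: primary_eq_image)
    have "(cmod z)^2 \<le> R^2" using z by (intro power_mono) auto
    then have le: "(1 + \<bar>real_of_int i\<bar>) * (1 + \<bar>real_of_int j\<bar>) \<le> 16 * R^2"
      using cmod_primary_lower[of i j] unfolding ij by linarith
    have "\<bar>real_of_int i\<bar> \<le> (1 + \<bar>real_of_int i\<bar>) * (1 + \<bar>real_of_int j\<bar>)"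
      "\<bar>real_of_int j\<bar> \<le> (1 + \<bar>real_of_int i\<bar>) * (1 + \<bar>real_of_int j\<bar>)"
      by (simp_all add: algebra_simps)
    then have "\<bar>real_of_int i\<bar> \<le> 16 * R^2" "\<bar>real_of_int j\<bar> \<le> 16 * R^2" using le by linarith+
    then have "i \<in> B" "j \<in> B" unfolding B_def by (simp_all add: abs_le_iff) linarith+
    then show "z \<in> (\<lambda>(i, j). eis (1 + 3 * i) (3 * j)) ` (B \<times> B)" by (auto simp: ij)
  qed
  moreover have "finite ((\<lambda>(i, j). eis (1 + 3 * i) (3 * j)) ` (B \<times> B))"
    by (intro finite_imageI finite_cartesian_product) (simp_all add: B_def)
  ultimately show ?thesis by (rule finite_subset)
qed

lemma twist_abs_summable: "s > 2 \<Longrightarrow> (\<lambda>z. cmod (twist k s z)) summable_on primary"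
  by (subst summable_on_cong[where g = "\<lambda>z. cmod z powr (- s)"])
     (auto intro!: primary_summable_powr norm_twist dest: primary_nonzero)

lemma twist_summable: "s > 2 \<Longrightarrow> twist k s summable_on primary"
  using twist_abs_summable by (rule abs_summable_summable)

section \<open>Variation of the summands under bounded translations and in s\<close>

lemma sgn_diff_le:
  fixes z w :: complex
  assumes "z \<noteq> 0" "w \<noteq> 0"
  shows "cmod (sgn z - sgn w) \<le> 2 * cmod (z - w) / cmod z"
proof -
  have "sgn z - sgn w = (z - w) / of_real (cmod z) + w * of_real ((cmod w - cmod z) / (cmod z * cmod w))"
    using assms by (simp add: sgn_eq field_simps)
  then have "cmod (sgn z - sgn w) \<le> cmod ((z - w) / of_real (cmod z)) + cmod (w * of_real ((cmod w - cmod z) / (cmod z * cmod w)))"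
    by (metis norm_triangle_ineq)
  also have "\<dots> = cmod (z - w) / cmod z + \<bar>cmod w - cmod z\<bar> / cmod z"
    using assms by (simp only: norm_divide norm_mult norm_of_real) (simp add: abs_mult)
  also have "\<dots> \<le> cmod (z - w) / cmod z + cmod (z - w) / cmod z"
    using norm_triangle_ineq3[of w z] by (intro add_left_mono divide_right_mono) (auto simp: norm_minus_commute)
  finally show ?thesis by simp
qed

lemma inverse_le_of_near:
  fixes x y :: real
  assumes "x \<ge> 1" "y \<ge> 1" "\<bar>x - y\<bar> \<le> D"
  shows "1 / y \<le> (1 + D) / x"
proof -
  have "x \<le> y + D" using assms by linarith
  also have "\<dots> \<le> (1 + D) * y" using assms by (simp add: distrib_right mult_le_cancel_left1)
  finally show ?thesis using assms by (simp add: field_simps)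
qed

text \<open>A bounded translation changes the summand by one power of \<open>cmod z\<close> less
  than its size: the exponent 3 lies in the range of convergence, while 2 does not.\<close>

lemma twist_2_diff_le:
  assumes "cmod z \<ge> 1" "cmod w \<ge> 1" "cmod (z - w) \<le> D"
  shows "cmod (twist k 2 z - twist k 2 w) \<le> (2 * real k * D + 2 * D * (1 + D)^2) / (cmod z)^3"
proof -
  define x y where "x = cmod z" and "y = cmod w"
  have x: "x \<ge> 1" and y: "y \<ge> 1" using assms by (auto simp: x_def y_def)
  have D: "D \<ge> 0" using assms(3) norm_ge_zero order_trans by blast
  have nz: "z \<noteq> 0" "w \<noteq> 0" using assms by auto
  have xy: "\<bar>x - y\<bar> \<le> D" using norm_triangle_ineq3[of z w] assms(3) by (simp add: x_def y_def)
  have xDy: "1 / y \<le> (1 + D) / x" using x y xy by (rule inverse_le_of_near)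
  have t: "twist k 2 u = sgn u ^ k * of_real (1 / (cmod u)^2)" if "u \<noteq> 0" for u
    using that by (simp add: twist_def powr_minus field_simps)
  have s1: "cmod (sgn z ^ k - sgn w ^ k) \<le> 2 * real k * D / x"
  proof -
    have "cmod (sgn z ^ k - sgn w ^ k) \<le> k * cmod (sgn z - sgn w)"
      by (rule norm_power_diff) (simp_all add: norm_sgn)
    also have "\<dots> \<le> k * (2 * cmod (z - w) / cmod z)"
      using nz by (intro mult_left_mono sgn_diff_le) auto
    also have "\<dots> \<le> k * (2 * D / x)"
      unfolding x_def using assms by (intro mult_left_mono divide_right_mono) auto
    finally show ?thesis by (simp add: mult_ac)
  qed
  have s2: "\<bar>1 / x^2 - 1 / y^2\<bar> \<le> 2 * D * (1 + D)^2 / x^3"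
  proof -
    have "1 / x^2 - 1 / y^2 = (y - x) * (1 / (x^2 * y) + 1 / (x * y^2))"
      using x y by (simp add: field_simps power2_eq_square)
    then have "\<bar>1 / x^2 - 1 / y^2\<bar> = \<bar>y - x\<bar> * (1 / (x^2 * y) + 1 / (x * y^2))"
      using x y by (simp add: abs_mult)
    also have "\<dots> \<le> D * ((1 + D)^2 / x^3 + (1 + D)^2 / x^3)"
    proof (intro mult_mono add_mono)
      have "1 / (x^2 * y) = (1 / x^2) * (1 / y)" by simp
      also have "\<dots> \<le> (1 / x^2) * ((1 + D) / x)" using xDy by (intro mult_left_mono) auto
      also have "\<dots> = (1 + D) / x^3" by (simp add: power2_eq_square power3_eq_cube)
      also have "\<dots> \<le> (1 + D)^2 / x^3" using x D by (intro divide_right_mono) (auto simp: power2_eq_square mult_le_cancel_left1)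
      finally show "1 / (x^2 * y) \<le> (1 + D)^2 / x^3" .
      have "1 / (x * y^2) = (1 / x) * (1 / y)^2" by (simp add: power_divide)
      also have "\<dots> \<le> (1 / x) * ((1 + D) / x)^2" using xDy x y by (intro mult_left_mono power_mono) auto
      also have "\<dots> = (1 + D)^2 / x^3" by (simp add: power_divide power2_eq_square power3_eq_cube)
      finally show "1 / (x * y^2) \<le> (1 + D)^2 / x^3" .
    qed (use xy D x y in auto)
    finally show ?thesis by (simp add: mult_ac)
  qed
  have "twist k 2 z - twist k 2 w = (sgn z ^ k - sgn w ^ k) * of_real (1 / x^2) + sgn w ^ k * of_real (1 / x^2 - 1 / y^2)"
    unfolding t[OF nz(1)] t[OF nz(2)] x_def y_def of_real_diff
    by (simp only: left_diff_distrib right_diff_distrib) simp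
  then have "cmod (twist k 2 z - twist k 2 w) \<le> cmod ((sgn z ^ k - sgn w ^ k) * of_real (1 / x^2)) + cmod (sgn w ^ k * of_real (1 / x^2 - 1 / y^2))"
    by (metis norm_triangle_ineq)
  also have "\<dots> = cmod (sgn z ^ k - sgn w ^ k) * (1 / x^2) + \<bar>1 / x^2 - 1 / y^2\<bar>"
    using nz by (simp only: norm_mult norm_of_real norm_power norm_sgn) simp
  also have "\<dots> \<le> (2 * real k * D / x) * (1 / x^2) + 2 * D * (1 + D)^2 / x^3"
    using s1 s2 by (intro add_mono mult_right_mono) auto
  also have "\<dots> = (2 * real k * D + 2 * D * (1 + D)^2) / x^3"
    by (simp add: add_divide_distrib power2_eq_square power3_eq_cube)
  finally show ?thesis by (simp add: x_def)
qed

lemma powr_minus_near_1: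
  assumes "x \<ge> 1" "t \<ge> 0"
  shows "\<bar>x powr (- t) - 1\<bar> \<le> t * ln (x::real)"
proof -
  have "1 - t * ln x \<le> exp (- t * ln x)" using exp_ge_add_one_self[of "- t * ln x"] by simp
  moreover have "exp (- t * ln x) \<le> 1" using assms by simp
  moreover have "x powr (- t) = exp (- t * ln x)" using assms by (simp add: powr_def)
  ultimately show ?thesis by simp
qed

lemma powr_minus_diff_le:
  assumes "x \<ge> 1" "y \<ge> 1" "t \<ge> 0"
  shows "\<bar>x powr (- t) - y powr (- t)\<bar> \<le> t * \<bar>x - y\<bar> / min x (y::real)"
  using assms
proof (induction x y rule: linorder_wlog)
  case (le x y)
  have y: "y powr (- t) = x powr (- t) * (y / x) powr (- t)"
    using le by (simp add: powr_mult[symmetric])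
  have "x powr (- t) - y powr (- t) = x powr (- t) * (1 - (y / x) powr (- t))"
    unfolding y by (simp add: algebra_simps)
  then have "\<bar>x powr (- t) - y powr (- t)\<bar> = x powr (- t) * \<bar>(y / x) powr (- t) - 1\<bar>"
    by (simp add: abs_mult abs_minus_commute)
  also have "\<dots> \<le> 1 * (t * ln (y / x))"
  proof (intro mult_mono powr_minus_near_1)
    show "x powr (- t) \<le> 1" using le powr_mono[of "- t" 0 x] by simp
  qed (use le in auto)
  also have "\<dots> \<le> 1 * (t * (y / x - 1))"
    using le by (intro mult_left_mono ln_le_minus_one) auto
  also have "\<dots> = t * \<bar>x - y\<bar> / min x y" using le by (simp add: field_simps)
  finally show ?case .
next
  case (sym x y)
  then show ?case by (simp add: abs_minus_commute min.commute)
qed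

text \<open>The summand at \<open>2 + t\<close> is the one at 2 times
  \<open>cmod z powr (- t)\<close>, so the second difference obeys a product rule. The factor
  \<open>t\<close> comes with a logarithm, which is absorbed by a square root; this lowers the
  exponent 3 to 5/2, still above 2.\<close>

lemma twist_increment_diff_le:
  assumes "cmod z \<ge> 1" "cmod w \<ge> 1" "cmod (z - w) \<le> D" "0 \<le> t" "t \<le> 1"
  shows "cmod ((twist k (2 + t) z - twist k (2 + t) w) - (twist k 2 z - twist k 2 w))
    \<le> t * (2 * (2 * real k * D + 2 * D * (1 + D)^2) + D * (1 + D)^3) * cmod z powr (-(5/2))"
proof -
  define x y where "x = cmod z" and "y = cmod w"
  define C where "C = 2 * real k * D + 2 * D * (1 + D)^2"
  have x: "x \<ge> 1" and y: "y \<ge> 1" using assms by (auto simp: x_def y_def)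
  have D: "D \<ge> 0" using assms(3) norm_ge_zero order_trans by blast
  have C: "C \<ge> 0" using D by (simp add: C_def)
  have nz: "z \<noteq> 0" "w \<noteq> 0" using assms by auto
  have xy: "\<bar>x - y\<bar> \<le> D" using norm_triangle_ineq3[of z w] assms(3) by (simp add: x_def y_def)
  have xDy: "1 / y \<le> (1 + D) / x" using x y xy by (rule inverse_le_of_near)
  have tw: "twist k (2 + t) u = twist k 2 u * of_real (cmod u powr (- t))" if "u \<noteq> 0" for u
    using that by (simp add: twist_def powr_add[symmetric] flip: of_real_mult)
  have p3: "1 / x^3 = x powr (-3)" using x by (simp add: powr_minus field_simps)
  have lnx: "ln x \<le> 2 * x powr (1/2)"
  proof -
    have "ln x = 2 * ln (x powr (1/2))" using x by (simp add: ln_powr)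
    also have "\<dots> \<le> 2 * (x powr (1/2) - 1)" using x by (intro mult_left_mono ln_le_minus_one) auto
    finally show ?thesis by simp
  qed
  have h1: "\<bar>x powr (- t) - 1\<bar> \<le> t * (2 * x powr (1/2))"
    using powr_minus_near_1[OF x assms(4)] mult_left_mono[OF lnx assms(4)] by linarith
  have h2: "\<bar>x powr (- t) - y powr (- t)\<bar> \<le> t * (D * (1 + D) / x)"
  proof -
    have "\<bar>x powr (- t) - y powr (- t)\<bar> \<le> t * \<bar>x - y\<bar> / min x y"
      using x y assms(4) by (rule powr_minus_diff_le)
    also have "\<dots> \<le> t * D * (1 / min x y)"
      using xy x y assms(4) by (simp add: divide_right_mono mult_left_mono)
    also have "1 / min x y \<le> (1 + D) / x"
      using xDy x D by (auto simp: min_def divide_right_mono)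
    finally show ?thesis using assms(4) D by (simp add: mult_left_mono mult.assoc)
  qed
  have d: "cmod (twist k 2 z - twist k 2 w) \<le> C / x^3"
    unfolding C_def x_def using assms by (intro twist_2_diff_le)
  have e: "cmod (twist k 2 w) \<le> (1 + D)^2 / x^2"
  proof -
    have "cmod (twist k 2 w) = (1 / y)^2" using nz y by (simp add: norm_twist y_def powr_minus power_divide field_simps)
    also have "\<dots> \<le> ((1 + D) / x)^2" using xDy y by (intro power_mono) auto
    finally show ?thesis by (simp add: power_divide)
  qed
  have "(twist k (2 + t) z - twist k (2 + t) w) - (twist k 2 z - twist k 2 w) =
     (twist k 2 z - twist k 2 w) * of_real (x powr (- t) - 1) + twist k 2 w * of_real (x powr (- t) - y powr (- t))"
    unfolding tw[OF nz(1)] tw[OF nz(2)] x_def y_def by (simp add: algebra_simps)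
  then have "cmod ((twist k (2 + t) z - twist k (2 + t) w) - (twist k 2 z - twist k 2 w)) \<le>
     cmod ((twist k 2 z - twist k 2 w) * of_real (x powr (- t) - 1)) + cmod (twist k 2 w * of_real (x powr (- t) - y powr (- t)))"
    by (metis norm_triangle_ineq)
  also have "\<dots> = cmod (twist k 2 z - twist k 2 w) * \<bar>x powr (- t) - 1\<bar> + cmod (twist k 2 w) * \<bar>x powr (- t) - y powr (- t)\<bar>"
    by (simp only: norm_mult norm_of_real)
  also have "\<dots> \<le> (C / x^3) * (t * (2 * x powr (1/2))) + ((1 + D)^2 / x^2) * (t * (D * (1 + D) / x))"
    using d e h1 h2 C x by (intro add_mono mult_mono) auto
  also have "\<dots> = t * (2 * C * (1 / x^3 * x powr (1/2)) + D * (1 + D)^3 * (1 / x^3))"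
    by (simp add: field_simps power2_eq_square power3_eq_cube)
  also have "1 / x^3 * x powr (1/2) = x powr (-(5/2))"
    unfolding p3 using x by (simp add: powr_add[symmetric])
  also have "t * (2 * C * x powr (-(5/2)) + D * (1 + D)^3 * (1 / x^3)) \<le>
     t * (2 * C * x powr (-(5/2)) + D * (1 + D)^3 * x powr (-(5/2)))"
    unfolding p3 using x D assms(4) by (intro mult_left_mono add_left_mono powr_mono) auto
  finally show ?thesis by (simp add: C_def x_def algebra_simps)
qed

section \<open>Behaviour of the Hecke series at the edge of convergence\<close>

text \<open>An element of \<open>primary\<close> of norm 7 whose argument is not a rational multiple of \<open>\<pi>\<close>.\<close>
definition beta :: complex where "beta = eis 1 3"

lemma beta_primary: "beta \<in> primary"
  by (simp add: beta_def eis_primary_iff)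

lemma cmod_beta_squared: "(cmod beta)^2 = 7"
  by (simp add: beta_def cmod_eis_squared)

lemma cmod_beta_powr: "cmod beta powr (- s) = 7 powr (- s / 2)"
proof -
  have "cmod beta powr (- s) = (cmod beta powr 2) powr (- s / 2)"
    by (simp only: powr_powr) simp
  also have "cmod beta powr 2 = 7"
    using cmod_beta_squared primary_nonzero[OF beta_primary] by simp
  finally show ?thesis .
qed

section \<open>Arithmetic modulo \<open>beta\<close>\<close>

lemma beta_mult_eis_add:
  "beta * eis a b + 3 * of_nat d = eis (a - 3 * b + 3 * int d) (3 * a - 2 * b)"
  by (simp add: beta_def eis_mult) (simp add: eis_def algebra_simps)

lemma primary_add_3: "z \<in> primary \<Longrightarrow> x \<in> eisenstein \<Longrightarrow> z + 3 * x \<in> primary"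
  unfolding primary_def by (auto intro!: bexI[of _ "_ + x"] simp: algebra_simps)

lemma eisenstein_of_nat: "of_nat n \<in> eisenstein"
  using eisenstein_of_int[of "int n"] by simp

text \<open>Modulo \<open>beta\<close> the ring is the field with seven elements, in which \<omega>
  is 2. The numbers \<open>3 * d\<close> represent all its classes, and adding them respects the
  congruence modulo 3.\<close>

lemma primary_seven_cosets:
  "bij_betw (\<lambda>(x, d). beta * x + 3 * of_nat d) (primary \<times> {..<7}) primary"
proof (rule bij_betwI')
  fix p q :: "complex \<times> nat"
  assume p: "p \<in> primary \<times> {..<7}" and q: "q \<in> primary \<times> {..<7}"
  obtain x d y e where pq: "p = (x, d)" "q = (y, e)" by force
  have x: "x \<in> primary" and y: "y \<in> primary" and de: "d < 7" "e < 7" using p q pq by auto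
  obtain a b a' b' where ab: "x = eis a b" "y = eis a' b'"
    using x y primary_eisenstein by (metis eisensteinE)
  show "((case p of (x, d) \<Rightarrow> beta * x + 3 * of_nat d) = (case q of (x, d) \<Rightarrow> beta * x + 3 * of_nat d)) = (p = q)"
  proof
    assume "(case p of (x, d) \<Rightarrow> beta * x + 3 * of_nat d) = (case q of (x, d) \<Rightarrow> beta * x + 3 * of_nat d)"
    then have 1: "a - 3 * b + 3 * int d = a' - 3 * b' + 3 * int e" and 2: "3 * a - 2 * b = 3 * a' - 2 * b'"
      unfolding pq ab by (simp_all add: beta_mult_eis_add)
    define D where "D = int d - int e"
    have "7 * (b - b') = 9 * D" unfolding D_def using 1 2 by (simp add: algebra_simps)
    then have "7 dvd 9 * D" by (metis dvd_triv_left)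
    then have "7 dvd D" by presburger
    moreover have "-7 < D" "D < 7" using de by (simp_all add: D_def)
    ultimately have "D = 0" by presburger
    then have "d = e" by (simp add: D_def)
    moreover have "b = b'" using \<open>7 * (b - b') = 9 * D\<close> \<open>D = 0\<close> by simp
    ultimately show "p = q" using 1 by (simp add: pq ab)
  qed simp
  show "(case p of (x, d) \<Rightarrow> beta * x + 3 * of_nat d) \<in> primary"
    using x by (auto simp: pq intro!: primary_add_3 primary_mult beta_primary eisenstein_of_nat)
next
  fix z assume z: "z \<in> primary"
  obtain a b where ab: "z = eis a b" using z primary_eisenstein by (blast elim: eisensteinE)
  \<comment> \<open>\<open>z - 3 * d\<close> has to vanish modulo \<open>beta\<close>, where
    \<open>z\<close> becomes \<open>a + 2 * b\<close>; 5 is the inverse of 3 modulo 7.\<close>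
  define d where "d = nat ((5 * (a + 2 * b)) mod 7)"
  have d: "int d = (5 * (a + 2 * b)) mod 7" "d < 7" by (simp_all add: d_def nat_less_iff)
  have "7 dvd y - 3 * ((5 * y) mod 7)" for y :: int by presburger
  from this[of "a + 2 * b"] obtain k where "(a + 2 * b) - 3 * int d = 7 * k" unfolding d(1) by (elim dvdE)
  then have k: "a = 7 * k + 3 * int d - 2 * b" by simp
  define x where "x = eis (b - 2 * k) (b - 3 * k)"
  have eq: "beta * x + 3 * of_nat d = z"
    unfolding x_def beta_mult_eis_add ab by (simp add: k)
  then have "beta * x = z + 3 * (- of_nat d)" by (simp add: algebra_simps)
  also have "\<dots> \<in> primary" using z by (intro primary_add_3 eisenstein_uminus eisenstein_of_nat)
  finally have "x \<in> primary" using primary_quotient[OF beta_primary] by (auto simp: x_def)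
  then show "\<exists>p\<in>primary \<times> {..<7}. z = (case p of (x, d) \<Rightarrow> beta * x + 3 * of_nat d)"
    using d(2) eq by (intro bexI[of _ "(x, d)"]) auto
qed

text \<open>A value 1 would make \<open>beta ^ k\<close> real. The denominator
  \<open>1 - sgn beta ^ k\<close> in \<open>hecke_L_lipschitz\<close> depends on this.\<close>

lemma sgn_beta_power_ne_1:
  assumes "k > 0"
  shows "sgn beta ^ k \<noteq> 1"
proof
  assume one: "sgn beta ^ k = 1"
  have nz: "beta \<noteq> 0" using primary_nonzero[OF beta_primary] .
  have "sgn beta * of_real (cmod beta) = beta" using nz by (simp add: sgn_eq)
  then have "beta ^ k = of_real (cmod beta ^ k)" using one by (metis mult_1 of_real_power power_mult_distrib)
  then have real: "beta ^ k = cnj (beta ^ k)" by simp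
  \<comment> \<open>The congruence says that \<open>beta\<close> divides \<open>eis u (3 * v)\<close>; if in addition 7 divided \<open>v\<close>, then 7 would
    divide \<open>beta ^ k\<close>, which is prime to \<open>cnj beta\<close>.\<close>
  have "\<exists>u v :: int. beta ^ k = eis u (3 * v) \<and> [u = (-2) * (3 * v)] (mod 7) \<and> \<not> 7 dvd v" if "k > 0" for k
    using that
  proof (induction k rule: nat_induct_non_zero)
    case 1
    then show ?case by (intro exI[of _ 1]) (simp add: beta_def cong_iff_dvd_diff)
  next
    case (Suc n)
    then obtain u v where uv: "beta ^ n = eis u (3 * v)" "[u = (-2) * (3 * v)] (mod 7)" "\<not> 7 dvd v" by blast
    obtain w where w: "u = 7 * w - 6 * v" using uv(2) by (auto simp: cong_iff_dvd_diff elim!: dvdE) (metis add_diff_cancel_right')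
    have "beta ^ Suc n = eis (u - 9 * v) (3 * (u - 2 * v))"
      by (simp add: uv(1)) (simp add: beta_def eis_mult)
    moreover have "[u - 9 * v = (-2) * (3 * (u - 2 * v))] (mod 7)"
    proof -
      have "u - 9 * v - (-2) * (3 * (u - 2 * v)) = 7 * (u - 3 * v)" by simp
      then show ?thesis unfolding cong_iff_dvd_diff by (metis dvd_triv_left)
    qed
    moreover have "\<not> 7 dvd u - 2 * v"
      using uv(3) unfolding w by presburger
    ultimately show ?case by blast
  qed
  then obtain u v where uv: "beta ^ k = eis u (3 * v)" "\<not> 7 dvd v" using assms by blast
  have "v = 0" using real unfolding uv(1) cnj_eis by simp
  then show False using uv(2) by simp
qed

text \<open>A Hecke L-series of an angular character modulo 3, in a variable that is twice the usual
  one; the prime above 3 does not occur.\<close>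

definition hecke_L :: "nat \<Rightarrow> real \<Rightarrow> complex" where
  "hecke_L k s = infsum (twist k s) primary"

text \<open>
  The set \<open>primary\<close> splits into the seven translates \<open>beta * primary + 3 d\<close>. Replacing each of them by
  \<open>beta * primary\<close> turns the sum over \<open>primary\<close> into a multiple of itself, and the error converges
  absolutely beyond \<open>s = 2\<close>. This is the only analytic continuation that is needed.
\<close>
definition coset_diff :: "nat \<Rightarrow> real \<Rightarrow> complex \<Rightarrow> complex" where
  "coset_diff k s x = (\<Sum>d<7. twist k s (beta * x + 3 * of_nat d) - twist k s (beta * x))"

lemma beta_translate_bounds:
  assumes "x \<in> primary" "d < (7::nat)"
  shows "cmod (beta * x) \<ge> 1" "cmod (beta * x + 3 * of_nat d) \<ge> 1"
    "cmod (beta * x - (beta * x + 3 * of_nat d)) \<le> 18" "cmod (beta * x) \<ge> cmod x"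
proof -
  show "cmod (beta * x) \<ge> 1" using assms beta_primary by (intro primary_cmod_ge_1 primary_mult)
  have "beta * x + 3 * of_nat d \<in> primary"
    using primary_seven_cosets assms by (auto simp: bij_betw_def)
  then show "cmod (beta * x + 3 * of_nat d) \<ge> 1" by (rule primary_cmod_ge_1)
  have "beta * x - (beta * x + 3 * of_nat d) = - of_real (3 * real d)" by simp
  then show "cmod (beta * x - (beta * x + 3 * of_nat d)) \<le> 18"
    using assms(2) by (simp only: norm_minus_cancel norm_of_real)
  show "cmod (beta * x) \<ge> cmod x"
    using primary_cmod_ge_1[OF beta_primary] by (simp add: norm_mult mult_le_cancel_right1)
qed

text \<open>The translations are by at most \<open>3 * 6 = 18\<close>. Both bounds have a summable
  majorant, and the factor \<open>t\<close> in the second is the source of the Lipschitz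
  estimate.\<close>

lemma coset_diff_bounds:
  "\<exists>C\<ge>0. \<forall>x\<in>primary. cmod (coset_diff k 2 x) \<le> C * cmod x powr (-(5/2)) \<and>
     (\<forall>t. 0 \<le> t \<and> t \<le> 1 \<longrightarrow> cmod (coset_diff k (2 + t) x - coset_diff k 2 x) \<le> t * C * cmod x powr (-(5/2)))"
proof -
  define C1 where "C1 = 2 * real k * 18 + 2 * 18 * (1 + 18)^2"
  define C2 where "C2 = 2 * C1 + 18 * (1 + 18)^3"
  define C where "C = 7 * C1 + 7 * C2"
  have nonneg: "C1 \<ge> 0" "C2 \<ge> 0" "C \<ge> 0" by (simp_all add: C_def C1_def C2_def)
  have "cmod (coset_diff k 2 x) \<le> C * cmod x powr (-(5/2)) \<and>
     (\<forall>t. 0 \<le> t \<and> t \<le> 1 \<longrightarrow> cmod (coset_diff k (2 + t) x - coset_diff k 2 x) \<le> t * C * cmod x powr (-(5/2)))"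
    if x: "x \<in> primary" for x
  proof -
    have x1: "cmod x \<ge> 1" using x by (rule primary_cmod_ge_1)
    define P where "P = cmod x powr (-(5/2))"
    have bz: "cmod (beta * x) powr (-(5/2)) \<le> P"
      unfolding P_def using beta_translate_bounds[OF x, of 0] x1 by (intro powr_mono2') auto
    have P: "P \<ge> 0" by (simp add: P_def)
    have 1: "cmod (twist k 2 (beta * x + 3 * of_nat d) - twist k 2 (beta * x)) \<le> C1 * P" if d: "d < 7" for d
    proof -
      note b = beta_translate_bounds[OF x d]
      have "cmod (twist k 2 (beta * x) - twist k 2 (beta * x + 3 * of_nat d)) \<le> C1 / (cmod (beta * x))^3"
        unfolding C1_def using b by (intro twist_2_diff_le) auto
      also have "\<dots> = C1 * cmod (beta * x) powr (-3)"
        using b by (simp add: powr_minus field_simps)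
      also have "\<dots> \<le> C1 * cmod (beta * x) powr (-(5/2))"
        using b nonneg by (intro mult_left_mono powr_mono) auto
      also have "\<dots> \<le> C1 * P" using bz nonneg by (intro mult_left_mono) auto
      finally show ?thesis by (simp add: norm_minus_commute)
    qed
    have "cmod (coset_diff k 2 x) \<le> (\<Sum>d<7::nat. C1 * P)"
      unfolding coset_diff_def using 1 by (intro sum_norm_le) auto
    also have "\<dots> = 7 * C1 * P" by simp
    also have "\<dots> \<le> C * P" using nonneg P by (intro mult_right_mono) (auto simp: C_def)
    finally have A: "cmod (coset_diff k 2 x) \<le> C * P" .
    have B: "cmod (coset_diff k (2 + t) x - coset_diff k 2 x) \<le> t * C * P" if t: "0 \<le> t" "t \<le> 1" for t
    proof -
      have 2: "cmod ((twist k (2 + t) (beta * x + 3 * of_nat d) - twist k (2 + t) (beta * x))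
         - (twist k 2 (beta * x + 3 * of_nat d) - twist k 2 (beta * x))) \<le> t * C2 * P" if d: "d < 7" for d
      proof -
        note b = beta_translate_bounds[OF x d]
        have "cmod ((twist k (2 + t) (beta * x) - twist k (2 + t) (beta * x + 3 * of_nat d))
           - (twist k 2 (beta * x) - twist k 2 (beta * x + 3 * of_nat d))) \<le> t * C2 * cmod (beta * x) powr (-(5/2))"
          unfolding C2_def C1_def using b t by (intro twist_increment_diff_le) auto
        also have "\<dots> \<le> t * C2 * P" using bz nonneg t by (intro mult_left_mono) auto
        finally show ?thesis
          by (subst norm_minus_cancel[symmetric]) (simp add: algebra_simps)
      qed
      have "cmod (coset_diff k (2 + t) x - coset_diff k 2 x) \<le> (\<Sum>d<7::nat. t * C2 * P)"
        unfolding coset_diff_def sum_subtractf[symmetric] using 2 by (intro sum_norm_le) auto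
      also have "\<dots> = t * (7 * C2) * P" by simp
      also have "\<dots> \<le> t * C * P" using nonneg P t by (intro mult_right_mono mult_left_mono) (auto simp: C_def)
      finally show ?thesis .
    qed
    show ?thesis using A B unfolding P_def by blast
  qed
  then show ?thesis using nonneg(3) by blast
qed

section \<open>The series near s = 2\<close>

lemma coset_diff_sum:
  "\<exists>G C. \<forall>t. 0 < t \<and> t \<le> 1 \<longrightarrow> coset_diff k (2 + t) summable_on primary \<and>
      cmod (infsum (coset_diff k (2 + t)) primary - G) \<le> C * t"
proof -
  obtain C where C: "C \<ge> 0"
    "\<And>x. x \<in> primary \<Longrightarrow> cmod (coset_diff k 2 x) \<le> C * cmod x powr (-(5/2))"
    "\<And>x t. x \<in> primary \<Longrightarrow> 0 \<le> t \<Longrightarrow> t \<le> 1 \<Longrightarrow>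
       cmod (coset_diff k (2 + t) x - coset_diff k 2 x) \<le> t * C * cmod x powr (-(5/2))"
    using coset_diff_bounds[of k] by blast
  define S where "S = infsum (\<lambda>x. cmod x powr (-(5/2))) primary"
  have S: "(\<lambda>x. cmod x powr (-(5/2))) summable_on primary" by (rule primary_summable_powr) simp
  have "(\<lambda>x. cmod (coset_diff k 2 x)) summable_on primary"
    using summable_on_cmult_right[OF S, of C] C(2) by (rule summable_on_comparison_test) auto
  then have s2: "coset_diff k 2 summable_on primary" by (rule abs_summable_summable)
  have "coset_diff k (2 + t) summable_on primary \<and>
      cmod (infsum (coset_diff k (2 + t)) primary - infsum (coset_diff k 2) primary) \<le> (C * S) * t"
    if t: "0 < t \<and> t \<le> 1" for t
  proof -
    have tS: "(\<lambda>x. t * C * cmod x powr (-(5/2))) summable_on primary" using S by (rule summable_on_cmult_right)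
    have ad: "(\<lambda>x. cmod (coset_diff k (2 + t) x - coset_diff k 2 x)) summable_on primary"
      using tS by (rule summable_on_comparison_test) (use C(3) t in auto)
    then have sd: "(\<lambda>x. coset_diff k (2 + t) x - coset_diff k 2 x) summable_on primary" by (rule abs_summable_summable)
    have "(\<lambda>x. (coset_diff k (2 + t) x - coset_diff k 2 x) + coset_diff k 2 x) summable_on primary"
      using sd s2 by (rule summable_on_add)
    then have st: "coset_diff k (2 + t) summable_on primary" by simp
    have "infsum (\<lambda>x. (coset_diff k (2 + t) x - coset_diff k 2 x) + coset_diff k 2 x) primary =
       infsum (\<lambda>x. coset_diff k (2 + t) x - coset_diff k 2 x) primary + infsum (coset_diff k 2) primary"
      using sd s2 by (rule infsum_add)
    then have "infsum (coset_diff k (2 + t)) primary - infsum (coset_diff k 2) primary =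
       infsum (\<lambda>x. coset_diff k (2 + t) x - coset_diff k 2 x) primary" by simp
    then have "cmod (infsum (coset_diff k (2 + t)) primary - infsum (coset_diff k 2) primary) \<le>
       infsum (\<lambda>x. cmod (coset_diff k (2 + t) x - coset_diff k 2 x)) primary"
      using norm_infsum_bound[OF ad] by simp
    also have "\<dots> \<le> infsum (\<lambda>x. t * C * cmod x powr (-(5/2))) primary"
      using ad tS by (rule infsum_mono) (use C(3) t in auto)
    also have "\<dots> = t * C * S" unfolding S_def by (rule infsum_cmult_right) (use S in auto)
    finally show ?thesis using st by (simp add: mult_ac)
  qed
  then show ?thesis by blast
qed

text \<open>Without the errors each of the seven translates would contribute
  \<open>twist k s beta\<close> times the whole series. As \<open>beta\<close> has norm 7,
  \<open>7 * cmod beta powr (-2)\<close> is 1, so at \<open>t = 0\<close> only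
  \<open>sgn beta ^ k\<close> is left of the factor.\<close>

lemma hecke_L_functional:
  assumes "0 < t" "t \<le> 1"
  shows "hecke_L k (2 + t) * (1 - sgn beta ^ k * of_real (7 powr (- t / 2))) = infsum (coset_diff k (2 + t)) primary"
proof -
  let ?s = "2 + t"
  have sum: "twist k ?s summable_on primary" using assms by (intro twist_summable) auto
  have sb: "(\<lambda>(x, d). twist k ?s (beta * x + 3 * of_nat d)) summable_on primary \<times> {..<7::nat}"
  proof -
    have "(\<lambda>p. twist k ?s (case p of (x, d) \<Rightarrow> beta * x + 3 * of_nat d)) summable_on primary \<times> {..<7::nat}"
      using sum summable_on_reindex_bij_betw[OF primary_seven_cosets, of "twist k ?s"] by blast
    then show ?thesis by (simp add: case_prod_unfold)
  qed
  have "hecke_L k ?s = infsum (\<lambda>p. twist k ?s (case p of (x, d) \<Rightarrow> beta * x + 3 * of_nat d)) (primary \<times> {..<7::nat})"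
    unfolding hecke_L_def by (rule infsum_reindex_bij_betw[OF primary_seven_cosets, symmetric])
  also have "\<dots> = infsum (\<lambda>(x, d). twist k ?s (beta * x + 3 * of_nat d)) (primary \<times> {..<7::nat})"
    by (simp add: case_prod_unfold)
  also have "\<dots> = infsum (\<lambda>x. infsum (\<lambda>d. twist k ?s (beta * x + 3 * of_nat d)) {..<7::nat}) primary"
    using infsum_Sigma'_banach[OF sb] by simp
  also have "\<dots> = infsum (\<lambda>x. coset_diff k ?s x + 7 * twist k ?s beta * twist k ?s x) primary"
    by (intro infsum_cong) (simp add: coset_diff_def sum_subtractf twist_mult)
  also have "\<dots> = infsum (coset_diff k ?s) primary + 7 * twist k ?s beta * hecke_L k ?s"
  proof -
    have "coset_diff k ?s summable_on primary" using coset_diff_sum[of k] assms by blast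
    moreover have "(\<lambda>x. 7 * twist k ?s beta * twist k ?s x) summable_on primary"
      using sum by (rule summable_on_cmult_right)
    ultimately have "infsum (\<lambda>x. coset_diff k ?s x + 7 * twist k ?s beta * twist k ?s x) primary =
      infsum (coset_diff k ?s) primary + infsum (\<lambda>x. 7 * twist k ?s beta * twist k ?s x) primary"
      by (rule infsum_add)
    also have "infsum (\<lambda>x. 7 * twist k ?s beta * twist k ?s x) primary = 7 * twist k ?s beta * hecke_L k ?s"
      unfolding hecke_L_def by (rule infsum_cmult_right) (use sum in auto)
    finally show ?thesis .
  qed
  finally have "hecke_L k ?s * (1 - 7 * twist k ?s beta) = infsum (coset_diff k ?s) primary"
    by (simp add: algebra_simps)
  also have "7 * twist k ?s beta = sgn beta ^ k * of_real (7 powr (- t / 2))"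
  proof -
    have "7 * cmod beta powr (- ?s) = 7 powr 1 * 7 powr (- ?s / 2)" unfolding cmod_beta_powr by simp
    also have "\<dots> = 7 powr (- t / 2)" unfolding powr_add[symmetric] by (simp add: field_simps)
    finally have "complex_of_real (7 * cmod beta powr (- ?s)) = of_real (7 powr (- t / 2))" by (rule arg_cong)
    then show ?thesis unfolding twist_def by (simp add: mult_ac)
  qed
  finally show ?thesis .
qed

lemma hecke_L_lipschitz:
  assumes "k > 0"
  shows "\<exists>L C. \<forall>t. 0 < t \<and> t \<le> 1 \<longrightarrow> cmod (hecke_L k (2 + t) - L) \<le> C * t"
proof -
  obtain G C where G: "\<And>t. 0 < t \<Longrightarrow> t \<le> 1 \<Longrightarrow> cmod (infsum (coset_diff k (2 + t)) primary - G) \<le> C * t"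
    using coset_diff_sum[of k] by blast
  define c where "c = sgn beta ^ k"
  have c1: "c \<noteq> 1" using sgn_beta_power_ne_1[OF assms] by (simp add: c_def)
  have cn: "cmod c = 1" using primary_nonzero[OF beta_primary] by (simp add: c_def norm_power norm_sgn)
  define e where "e = cmod (1 - c)"
  have e: "e > 0" using c1 by (simp add: e_def)
  have "cmod (hecke_L k (2 + t) - G / (1 - c)) \<le> (2 * C / e + 2 * cmod G / (e * e) * ln 7) * t"
    if t: "0 < t" "t \<le> 1" for t
  proof -
    define r where "r = (7::real) powr (- t / 2)"
    define d where "d = 1 - c * of_real r"
    have r: "r \<le> 1" "r \<ge> 0" using t powr_mono[of "- t / 2" 0 7] by (auto simp: r_def)
    have r1: "1 - r \<le> ln 7 * t"
    proof -
      have "\<bar>7 powr (- (t / 2)) - 1\<bar> \<le> (t / 2) * ln (7::real)" using t by (intro powr_minus_near_1) auto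
      moreover have "(t / 2) * ln (7::real) \<le> t * ln 7" using t by (intro mult_right_mono) auto
      ultimately show ?thesis unfolding r_def by (simp add: mult_ac abs_if split: if_splits)
    qed
    \<comment> \<open>\<open>cmod d\<close> is at least \<open>1 - r\<close> and also at least
      \<open>e - (1 - r)\<close>, hence at least half of \<open>e\<close>, uniformly in
      \<open>t\<close>.\<close>
    have dd: "e \<le> 2 * cmod d"
    proof -
      have "1 - r \<le> cmod d"
        using norm_triangle_ineq2[of 1 "c * of_real r"] r by (simp add: d_def norm_mult cn)
      moreover have "1 - c = d + c * of_real (r - 1)" by (simp add: d_def algebra_simps)
      then have "e \<le> cmod d + cmod (c * of_real (r - 1))" unfolding e_def by (metis norm_triangle_ineq)
      moreover have "cmod (c * of_real (r - 1)) = 1 - r" unfolding norm_mult norm_of_real cn using r by simp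
      ultimately show ?thesis by linarith
    qed
    then have d0: "d \<noteq> 0" using e by auto
    define G' where "G' = infsum (coset_diff k (2 + t)) primary"
    have "hecke_L k (2 + t) * d = G'"
      using hecke_L_functional[OF t, of k] by (simp add: d_def c_def r_def G'_def)
    then have H: "hecke_L k (2 + t) = G' / d" using d0 by (simp add: field_simps)
    have "G' / d - G / (1 - c) = (G' - G) / d + G * (c * of_real (r - 1)) / (d * (1 - c))"
    proof -
      have "G' / d - G / q = (G' - G) / d + G * (q - d) / (d * q)" if "q \<noteq> 0" for q
        using d0 that by (simp add: field_simps)
      from this[of "1 - c"] show ?thesis using c1 by (simp add: d_def algebra_simps)
    qed
    then have "cmod (G' / d - G / (1 - c)) \<le> cmod ((G' - G) / d) + cmod (G * (c * of_real (r - 1)) / (d * (1 - c)))"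
      by (metis norm_triangle_ineq)
    also have "\<dots> = cmod (G' - G) / cmod d + cmod G * (1 - r) / (cmod d * e)"
      using r unfolding norm_divide norm_mult norm_of_real cn e_def by simp
    also have "\<dots> \<le> (C * t) / (e / 2) + cmod G * (ln 7 * t) / ((e / 2) * e)"
    proof (intro add_mono frac_le mult_mono)
      show "cmod (G' - G) \<le> C * t" unfolding G'_def using G t by auto
      then show "0 \<le> C * t" using norm_ge_zero order_trans by blast
    qed (use e dd r r1 t in auto)
    also have "\<dots> = (2 * C / e + 2 * cmod G / (e * e) * ln 7) * t"
      using e by (simp add: field_simps)
    finally show ?thesis unfolding H .
  qed
  then show ?thesis by blast
qed

text \<open>For \<open>k = 0\<close> the factor on the left of \<open>hecke_L_functional\<close> is
  \<open>1 - 7 powr (- t / 2)\<close>, which is at least \<open>t / 4\<close>: the series has at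
  most a simple pole.\<close>

lemma hecke_L_0_upper:
  "\<exists>C>0. \<forall>t. 0 < t \<and> t \<le> 1 \<longrightarrow> cmod (hecke_L 0 (2 + t)) \<le> C / t"
proof -
  obtain G C where G: "\<And>t. 0 < t \<Longrightarrow> t \<le> 1 \<Longrightarrow> cmod (infsum (coset_diff 0 (2 + t)) primary - G) \<le> C * t"
    using coset_diff_sum[of 0] by blast
  define B where "B = \<bar>C\<bar> + cmod G + 1"
  have B: "B > 0" by (simp add: B_def add_nonneg_pos)
  have "cmod (hecke_L 0 (2 + t)) \<le> 4 * B / t" if t: "0 < t" "t \<le> 1" for t
  proof -
    define r where "r = (7::real) powr (- t / 2)"
    have r1: "t / 4 \<le> 1 - r"
    proof -
      have "exp (t / 2) \<le> exp (t / 2 * ln 7)"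
      proof -
        have "exp 1 \<le> (7::real)" using exp_le by linarith
        then have "1 \<le> ln (7::real)" by (subst ln_ge_iff) auto
        then show ?thesis using t by (simp add: mult_le_cancel_left1)
      qed
      then have "r \<le> exp (- (t / 2))" unfolding r_def powr_def by (simp add: exp_minus)
      moreover have "1 + t / 2 \<le> exp (t / 2)" by (rule exp_ge_add_one_self)
      then have "exp (- (t / 2)) \<le> 1 / (1 + t / 2)"
        using t unfolding exp_minus by (subst inverse_eq_divide, intro divide_left_mono) auto
      moreover have "1 / (1 + t / 2) \<le> 1 - t / 4"
      proof -
        have "1 \<le> (1 - t / 4) * (1 + t / 2)" using t mult_right_mono[of t 1 t] by (simp add: algebra_simps)
        then show ?thesis using t by (simp add: divide_le_eq)
      qed
      ultimately show ?thesis by linarith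
    qed
    have pos: "1 - r > 0" using r1 t by linarith
    define G' where "G' = infsum (coset_diff 0 (2 + t)) primary"
    have "hecke_L 0 (2 + t) * of_real (1 - r) = G'"
      using hecke_L_functional[OF t, of 0] by (simp add: r_def G'_def)
    then have "cmod (hecke_L 0 (2 + t)) * (1 - r) = cmod G'"
      using pos by (metis abs_of_pos norm_mult norm_of_real)
    also have "cmod G' \<le> cmod (G' - G) + cmod G" using norm_triangle_ineq[of "G' - G" G] by simp
    also have "\<dots> \<le> \<bar>C\<bar> * 1 + cmod G"
    proof -
      have "cmod (G' - G) \<le> C * t" unfolding G'_def using G t by auto
      also have "\<dots> \<le> \<bar>C\<bar> * 1" using t by (intro mult_mono) auto
      finally show ?thesis by simp
    qed
    also have "\<dots> \<le> B" by (simp add: B_def)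
    finally have "cmod (hecke_L 0 (2 + t)) * (1 - r) \<le> B" .
    moreover have "cmod (hecke_L 0 (2 + t)) * (t / 4) \<le> cmod (hecke_L 0 (2 + t)) * (1 - r)"
      using r1 by (intro mult_left_mono) auto
    ultimately show ?thesis using t by (simp add: field_simps)
  qed
  then show ?thesis using B by (intro exI[of _ "4 * B"]) auto
qed

section \<open>The Euler product\<close>

text \<open>The cofactor is asked to be primary; for primary \<open>x\<close> and \<open>z\<close>
  this agrees with divisibility in the ring by \<open>primary_quotient\<close>.\<close>

definition pdvd :: "complex \<Rightarrow> complex \<Rightarrow> bool" where
  "pdvd x z \<longleftrightarrow> (\<exists>q\<in>primary. z = x * q)"

lemma pdvd_mult_right: "pdvd x y \<Longrightarrow> z \<in> primary \<Longrightarrow> pdvd x (y * z)"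
  unfolding pdvd_def by (metis mult.assoc primary_mult)

lemma pdvd_mult_left: "pdvd x y \<Longrightarrow> z \<in> primary \<Longrightarrow> pdvd x (z * y)"
  using pdvd_mult_right by (simp add: mult.commute)

lemma pdvd_prime_mult:
  assumes "\<pi> \<in> primary_primes" "x \<in> primary" "y \<in> primary" "pdvd \<pi> (x * y)"
  shows "pdvd \<pi> x \<or> pdvd \<pi> y"
proof -
  obtain q where "q \<in> primary" "x * y = \<pi> * q" using assms(4) by (auto simp: pdvd_def)
  then have "(\<exists>q\<in>eisenstein. x = \<pi> * q) \<or> (\<exists>q\<in>eisenstein. y = \<pi> * q)"
    using assms by (intro primary_prime_euclid[of \<pi> x y q]) (auto intro: primary_eisenstein)
  then show ?thesis
    using assms primary_quotient[OF primary_primes_primary[OF assms(1)]] unfolding pdvd_def by metis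
qed

lemma pdvd_primes_eq:
  assumes "\<pi> \<in> primary_primes" "\<rho> \<in> primary_primes" "pdvd \<rho> \<pi>"
  shows "\<rho> = \<pi>"
  using assms unfolding pdvd_def primary_primes_def by auto

lemma not_pdvd_1:
  assumes "\<pi> \<in> primary_primes"
  shows "\<not> pdvd \<pi> 1"
proof
  assume "pdvd \<pi> 1"
  then obtain q where q: "q \<in> primary" "1 = \<pi> * q" by (auto simp: pdvd_def)
  have "1 = cmod \<pi> * cmod q" using q(2) by (metis norm_mult norm_one)
  moreover have "2 * 1 \<le> cmod \<pi> * cmod q"
    using primary_primes_cmod[OF assms] primary_cmod_ge_1[OF q(1)] by (intro mult_mono) auto
  ultimately show False by simp
qed

lemma pdvd_prime_power:
  assumes "\<pi> \<in> primary_primes" "\<rho> \<in> primary_primes" "pdvd \<rho> (\<pi> ^ m)"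
  shows "\<rho> = \<pi>"
  using assms(3)
proof (induction m)
  case 0
  then show ?case using not_pdvd_1[OF assms(2)] by simp
next
  case (Suc m)
  then have "pdvd \<rho> \<pi> \<or> pdvd \<rho> (\<pi> ^ m)"
    using pdvd_prime_mult[OF assms(2), of \<pi> "\<pi> ^ m"] primary_primes_primary[OF assms(1)] by auto
  then show ?case using Suc.IH pdvd_primes_eq[OF assms(1,2)] by blast
qed

lemma primary_prime_multiplicity:
  assumes \<pi>: "\<pi> \<in> primary_primes" and "z \<in> primary"
  shows "\<exists>m. \<exists>q\<in>primary. z = \<pi> ^ m * q \<and> \<not> pdvd \<pi> q"
  using assms(2)
proof (induction "nat \<lfloor>(cmod z)^2\<rfloor>" arbitrary: z rule: less_induct)
  case less
  show ?case
  proof (cases "pdvd \<pi> z")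
    case False
    then show ?thesis using less.prems by (intro exI[of _ 0]) auto
  next
    case True
    then obtain y where y: "y \<in> primary" "z = \<pi> * y" by (auto simp: pdvd_def)
    obtain n where n: "(cmod z)^2 = of_int n" "n \<ge> 1" using less.prems(1) by (rule primary_norm)
    obtain m where m: "(cmod y)^2 = of_int m" "m \<ge> 1" using y(1) by (rule primary_norm)
    have "1 * cmod y < cmod \<pi> * cmod y"
      using primary_primes_cmod[OF \<pi>] primary_cmod_ge_1[OF y(1)] by (intro mult_strict_right_mono) auto
    then have "cmod y < cmod z" using y(2) by (simp add: norm_mult)
    then have "(cmod y)^2 < (cmod z)^2" by (intro power_strict_mono) auto
    then have "nat \<lfloor>(cmod y)^2\<rfloor> < nat \<lfloor>(cmod z)^2\<rfloor>" using n m by simp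
    then obtain i q where "q \<in> primary" "y = \<pi> ^ i * q" "\<not> pdvd \<pi> q"
      using less.hyps y(1) by blast
    then show ?thesis using y(2) by (intro exI[of _ "Suc i"] bexI[of _ q]) auto
  qed
qed

definition smooth :: "complex set \<Rightarrow> complex set" where
  "smooth Q = {z \<in> primary. \<forall>\<pi>\<in>primary_primes. pdvd \<pi> z \<longrightarrow> \<pi> \<in> Q}"

lemma smooth_empty: "smooth {} = {1}"
proof -
  have "z = 1" if "z \<in> smooth {}" for z
    using that primary_prime_divisor_exists[of z] by (auto simp: smooth_def pdvd_def)
  then show ?thesis using not_pdvd_1 by (auto simp: smooth_def)
qed

text \<open>Unique factorization, one prime at a time: the exact power of \<open>\<pi>\<close>
  splits off in one way only, and the primes of the cofactor lie in \<open>Q\<close>.\<close>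

lemma smooth_insert_bij:
  assumes \<pi>: "\<pi> \<in> primary_primes" and nin: "\<pi> \<notin> Q"
  shows "bij_betw (\<lambda>(m, z). \<pi> ^ m * z) (UNIV \<times> smooth Q) (smooth (insert \<pi> Q))"
proof -
  have \<pi>P: "\<pi> \<in> primary" and \<pi>0: "\<pi> \<noteq> 0" using \<pi> primary_primes_primary primary_nonzero by blast+
  have le: "m \<le> n" if "\<pi> ^ m * x = \<pi> ^ n * y" "y \<in> smooth Q" "x \<in> smooth Q" for m n x y
  proof (rule ccontr)
    assume "\<not> m \<le> n"
    then obtain i where m: "m = n + Suc i" using less_imp_Suc_add[of n m] by auto
    have "\<pi> ^ n * (\<pi> * (\<pi> ^ i * x)) = \<pi> ^ n * y"
      using that(1) unfolding m by (simp add: power_add mult_ac)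
    then have "y = \<pi> * (\<pi> ^ i * x)" using \<pi>0 by simp
    then have "pdvd \<pi> y" using that(3) \<pi>P unfolding pdvd_def smooth_def by blast
    then show False using that(2) \<pi> nin by (auto simp: smooth_def)
  qed
  show ?thesis
  proof (rule bij_betwI')
    fix p q :: "nat \<times> complex"
    assume p: "p \<in> UNIV \<times> smooth Q" and q: "q \<in> UNIV \<times> smooth Q"
    obtain m x n y where pq: "p = (m, x)" "q = (n, y)" by force
    have xy: "x \<in> smooth Q" "y \<in> smooth Q" using p q pq by auto
    show "((case p of (m, z) \<Rightarrow> \<pi> ^ m * z) = (case q of (m, z) \<Rightarrow> \<pi> ^ m * z)) = (p = q)"
    proof
      assume "(case p of (m, z) \<Rightarrow> \<pi> ^ m * z) = (case q of (m, z) \<Rightarrow> \<pi> ^ m * z)"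
      then have eq: "\<pi> ^ m * x = \<pi> ^ n * y" by (simp add: pq)
      then have "m = n" using le[OF eq xy(2,1)] le[OF eq[symmetric] xy] by simp
      then show "p = q" using eq \<pi>0 by (simp add: pq)
    qed simp
    have x: "x \<in> primary" using xy by (simp add: smooth_def)
    have "\<rho> \<in> insert \<pi> Q" if "\<rho> \<in> primary_primes" "pdvd \<rho> (\<pi> ^ m * x)" for \<rho>
    proof -
      have "pdvd \<rho> (\<pi> ^ m) \<or> pdvd \<rho> x" using that \<pi>P x by (intro pdvd_prime_mult) auto
      then show ?thesis using pdvd_prime_power[OF \<pi> that(1)] xy(1) that(1) by (auto simp: smooth_def)
    qed
    then show "(case p of (m, z) \<Rightarrow> \<pi> ^ m * z) \<in> smooth (insert \<pi> Q)"
      using \<pi>P x by (auto simp: pq smooth_def)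
  next
    fix z assume z: "z \<in> smooth (insert \<pi> Q)"
    then have "z \<in> primary" by (simp add: smooth_def)
    then obtain m q where mq: "q \<in> primary" "z = \<pi> ^ m * q" "\<not> pdvd \<pi> q"
      using primary_prime_multiplicity[OF \<pi>] by blast
    have "\<rho> \<in> Q" if "\<rho> \<in> primary_primes" "pdvd \<rho> q" for \<rho>
    proof -
      have "pdvd \<rho> z" using that(2) \<pi>P unfolding mq(2) by (intro pdvd_mult_left) auto
      then show ?thesis using z that mq(3) by (auto simp: smooth_def)
    qed
    then have "q \<in> smooth Q" using mq(1) by (simp add: smooth_def)
    then show "\<exists>p\<in>UNIV \<times> smooth Q. z = (case p of (m, z) \<Rightarrow> \<pi> ^ m * z)"
      using mq(2) by (intro bexI[of _ "(m, q)"]) auto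
  qed
qed

lemma norm_twist_prime:
  assumes "\<pi> \<in> primary_primes" "s \<ge> 2"
  shows "cmod (twist k s \<pi>) \<le> 1/4"
proof -
  have c: "cmod \<pi> \<ge> 2" using assms(1) by (rule primary_primes_cmod)
  have "cmod (twist k s \<pi>) = cmod \<pi> powr (- s)" using c by (intro norm_twist) auto
  also have "\<dots> \<le> cmod \<pi> powr (-2)" using c assms(2) by (intro powr_mono) auto
  also have "\<dots> \<le> 2 powr (-2)" using c by (intro powr_mono2') auto
  also have "\<dots> = 1/4" by (simp add: powr_minus)
  finally show ?thesis .
qed

text \<open>Each new prime multiplies the sum by a geometric series; absolute convergence permits
  summing over the exponent and the cofactor separately.\<close>

lemma infsum_smooth:
  assumes "finite Q" "Q \<subseteq> primary_primes" "s > 2"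
  shows "infsum (twist k s) (smooth Q) = (\<Prod>\<pi>\<in>Q. 1 / (1 - twist k s \<pi>))"
  using assms(1,2)
proof (induction Q rule: finite_induct)
  case empty
  then show ?case by (simp add: smooth_empty)
next
  case (insert \<pi> Q)
  have \<pi>: "\<pi> \<in> primary_primes" using insert.prems by simp
  define c where "c = twist k s \<pi>"
  have c: "cmod c < 1" using norm_twist_prime[OF \<pi>, of s k] assms(3) by (simp add: c_def)
  have sub: "twist k s summable_on smooth R" for R
    using twist_summable[OF assms(3)] by (rule summable_on_subset_banach) (auto simp: smooth_def)
  note bij = smooth_insert_bij[OF \<pi> insert.hyps(2)]
  have eq: "twist k s (case p of (m, z) \<Rightarrow> \<pi> ^ m * z) = (case p of (m, z) \<Rightarrow> c ^ m * twist k s z)" for p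
    by (simp add: case_prod_unfold twist_mult twist_power c_def)
  have "(\<lambda>p. twist k s (case p of (m, z) \<Rightarrow> \<pi> ^ m * z)) summable_on UNIV \<times> smooth Q"
    using sub summable_on_reindex_bij_betw[OF bij, of "twist k s"] by blast
  then have sb: "(\<lambda>(m, z). c ^ m * twist k s z) summable_on UNIV \<times> smooth Q" unfolding eq by simp
  have "infsum (twist k s) (smooth (insert \<pi> Q)) = infsum (\<lambda>(m, z). c ^ m * twist k s z) (UNIV \<times> smooth Q)"
    using infsum_reindex_bij_betw[OF bij, of "twist k s"] unfolding eq by simp
  also have "\<dots> = infsum (\<lambda>m. infsum (\<lambda>z. c ^ m * twist k s z) (smooth Q)) UNIV"
    using infsum_Sigma'_banach[OF sb] by simp
  also have "\<dots> = infsum (\<lambda>m. c ^ m * infsum (twist k s) (smooth Q)) UNIV"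
    by (intro infsum_cong infsum_cmult_right) (use sub in auto)
  also have "\<dots> = infsum (\<lambda>m. c ^ m) UNIV * infsum (twist k s) (smooth Q)"
    by (rule infsum_cmult_left')
  also have "infsum (\<lambda>m. c ^ m) UNIV = 1 / (1 - c)"
  proof (rule infsumI, rule norm_summable_imp_has_sum)
    show "summable (\<lambda>n. norm (c ^ n))" using c by (simp add: norm_power summable_geometric)
    show "(\<lambda>n. c ^ n) sums (1 / (1 - c))" using c by (rule geometric_sums)
  qed
  also have "1 / (1 - c) * infsum (twist k s) (smooth Q) = (\<Prod>\<pi>\<in>insert \<pi> Q. 1 / (1 - twist k s \<pi>))"
    using insert by (simp add: c_def)
  finally show ?case .
qed

text \<open>A finite set \<open>A\<close> carries all but \<open>e / 2\<close> of the absolute sum.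
  Once \<open>Q\<close> contains the finitely many prime divisors of its elements, what
  \<open>smooth Q\<close> misses weighs at most \<open>e / 2\<close>.\<close>

lemma infsum_smooth_tendsto:
  assumes "s > 2"
  shows "((\<lambda>Q. infsum (twist k s) (smooth Q)) \<longlongrightarrow> hecke_L k s) (finite_subsets_at_top primary_primes)"
proof (rule tendstoI)
  fix e :: real assume e: "e > 0"
  let ?n = "\<lambda>z. cmod (twist k s z)"
  have abs: "?n summable_on primary" using assms by (rule twist_abs_summable)
  obtain A where A: "finite A" "A \<subseteq> primary" "dist (sum ?n A) (infsum ?n primary) \<le> e / 2"
    using infsum_finite_approximation[OF abs, of "e / 2"] e by auto
  define Q0 where "Q0 = {\<pi> \<in> primary_primes. \<exists>z\<in>A. pdvd \<pi> z}"
  have "finite Q0"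
  proof -
    obtain R where R: "\<And>z. z \<in> A \<Longrightarrow> cmod z \<le> R"
      using A(1) by (metis bounded_iff finite_imp_bounded)
    have "Q0 \<subseteq> {z \<in> primary. cmod z \<le> R}"
    proof
      fix \<pi> assume "\<pi> \<in> Q0"
      then obtain z q where z: "\<pi> \<in> primary_primes" "z \<in> A" "q \<in> primary" "z = \<pi> * q"
        by (auto simp: Q0_def pdvd_def)
      have "cmod \<pi> * 1 \<le> cmod \<pi> * cmod q"
        using primary_cmod_ge_1[OF z(3)] by (intro mult_left_mono) auto
      also have "\<dots> = cmod z" by (simp add: z(4) norm_mult)
      also have "\<dots> \<le> R" using R z(2) by blast
      finally show "\<pi> \<in> {z \<in> primary. cmod z \<le> R}" using primary_primes_primary z(1) by simp
    qed
    then show ?thesis using finite_primary_ball finite_subset by blast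
  qed
  moreover have "Q0 \<subseteq> primary_primes" by (auto simp: Q0_def)
  moreover have "dist (infsum (twist k s) (smooth Q)) (hecke_L k s) < e"
    if Q: "Q0 \<subseteq> Q" for Q
  proof -
    have AQ: "A \<subseteq> smooth Q" using A(2) Q by (auto simp: smooth_def Q0_def)
    have S: "smooth Q \<subseteq> primary" by (auto simp: smooth_def)
    have tw: "twist k s summable_on X" if "X \<subseteq> primary" for X
      using twist_summable[OF assms] that by (rule summable_on_subset_banach)
    have ns: "?n summable_on X" if "X \<subseteq> primary" for X
      using abs that by (rule summable_on_subset_banach)
    have "hecke_L k s = infsum (twist k s) (smooth Q) + infsum (twist k s) (primary - smooth Q)"
    proof -
      have "primary = smooth Q \<union> (primary - smooth Q)" using S by blast
      then show ?thesis unfolding hecke_L_def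
        using infsum_Un_disjoint[of "twist k s" "smooth Q" "primary - smooth Q"] tw S by auto
    qed
    then have "dist (infsum (twist k s) (smooth Q)) (hecke_L k s) = cmod (infsum (twist k s) (primary - smooth Q))"
      by (simp add: dist_norm)
    also have "\<dots> \<le> infsum ?n (primary - smooth Q)" using ns by (intro norm_infsum_bound) auto
    also have "\<dots> \<le> infsum ?n (primary - A)" using AQ ns by (intro infsum_mono2) auto
    also have "\<dots> = infsum ?n primary - sum ?n A"
    proof -
      have "primary = A \<union> (primary - A)" using A by blast
      then have "infsum ?n primary = infsum ?n A + infsum ?n (primary - A)"
        using infsum_Un_disjoint[of ?n A "primary - A"] ns A by auto
      then show ?thesis using A(1) by simp
    qed
    also have "\<dots> \<le> e / 2" using A(3) unfolding dist_real_def by linarith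
    finally show ?thesis using e by simp
  qed
  ultimately show "\<forall>\<^sub>F Q in finite_subsets_at_top primary_primes. dist (infsum (twist k s) (smooth Q)) (hecke_L k s) < e"
    unfolding eventually_finite_subsets_at_top by blast
qed

section \<open>Logarithm of the product\<close>

lemma log_one_minus_bound:
  assumes "cmod z \<le> 1/2"
  shows "\<bar>- ln (cmod (1 - z)) - Re z\<bar> \<le> 2 * (cmod z)^2"
proof -
  have "1 - z \<noteq> 0" using assms by auto
  then have "- ln (cmod (1 - z)) - Re z = - Re (ln (1 + (- z)) - (- z))" by simp
  then have "\<bar>- ln (cmod (1 - z)) - Re z\<bar> \<le> cmod (ln (1 + (- z)) - (- z))"
    using abs_Re_le_cmod by (metis abs_minus_cancel)
  also have "\<dots> \<le> (cmod (- z))^2 / (1 - cmod (- z))" using assms by (intro Ln_approx_linear) auto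
  also have "\<dots> \<le> (cmod z)^2 / (1/2)" using assms by (simp only: norm_minus_cancel) (intro divide_left_mono, auto)
  finally show ?thesis by simp
qed

definition prime_sum :: "nat \<Rightarrow> real \<Rightarrow> real" where
  "prime_sum k s = infsum (\<lambda>\<pi>. Re (twist k s \<pi>)) primary_primes"

lemma twist_Re_summable: "s > 2 \<Longrightarrow> (\<lambda>\<pi>. Re (twist k s \<pi>)) summable_on primary_primes"
  using summable_on_subset_banach[OF twist_summable, of s primary_primes k]
  by (intro summable_on_Re) (auto intro: primary_primes_primary)

text \<open>Logarithms of absolute values avoid a choice of branch. The linear terms of the Euler
  factors add up to \<open>prime_sum\<close>; each remainder is at most
  \<open>2 * cmod \<pi> powr (-4)\<close>, so one \<open>C\<close> serves all \<open>k\<close> and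
  \<open>s\<close>. The series is nonzero because its absolute value is an exponential.\<close>

lemma hecke_L_log:
  "\<exists>C. \<forall>k s. s > 2 \<longrightarrow> hecke_L k s \<noteq> 0 \<and> \<bar>prime_sum k s - ln (cmod (hecke_L k s))\<bar> \<le> C"
proof -
  define C where "C = infsum (\<lambda>z. 2 * cmod z powr (-4)) primary"
  have sC: "(\<lambda>z. 2 * cmod z powr (-4)) summable_on primary"
    by (intro summable_on_cmult_right primary_summable_powr) simp
  have "hecke_L k s \<noteq> 0 \<and> \<bar>prime_sum k s - ln (cmod (hecke_L k s))\<bar> \<le> C" if s: "s > 2" for k s
  proof -
    define l where "l \<pi> = - ln (cmod (1 - twist k s \<pi>))" for \<pi>
    have bound: "\<bar>l \<pi> - Re (twist k s \<pi>)\<bar> \<le> 2 * cmod \<pi> powr (-4)" if \<pi>: "\<pi> \<in> primary_primes" for \<pi>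
    proof -
      have c: "cmod \<pi> \<ge> 2" using \<pi> by (rule primary_primes_cmod)
      have "cmod (twist k s \<pi>) \<le> 1/2" using norm_twist_prime[OF \<pi>, of s k] s by simp
      then have "\<bar>l \<pi> - Re (twist k s \<pi>)\<bar> \<le> 2 * (cmod (twist k s \<pi>))^2"
        unfolding l_def by (rule log_one_minus_bound)
      also have "(cmod (twist k s \<pi>))^2 = (cmod \<pi> powr (- s)) * (cmod \<pi> powr (- s))"
        using c by (subst norm_twist) (auto simp: power2_eq_square)
      also have "\<dots> = cmod \<pi> powr (- 2 * s)" by (simp add: powr_add[symmetric])
      also have "\<dots> \<le> cmod \<pi> powr (-4)" using c s by (intro powr_mono) auto
      finally show ?thesis by simp
    qed
    have sP: "(\<lambda>\<pi>. 2 * cmod \<pi> powr (-4)) summable_on primary_primes"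
      using sC by (rule summable_on_subset_banach) (auto intro: primary_primes_primary)
    have ad: "(\<lambda>\<pi>. \<bar>l \<pi> - Re (twist k s \<pi>)\<bar>) summable_on primary_primes"
      using sP bound by (rule summable_on_comparison_test) auto
    then have "(\<lambda>\<pi>. norm (l \<pi> - Re (twist k s \<pi>))) summable_on primary_primes"
      by (simp only: real_norm_def)
    then have sd: "(\<lambda>\<pi>. l \<pi> - Re (twist k s \<pi>)) summable_on primary_primes"
      by (rule abs_summable_summable)
    have sR: "(\<lambda>\<pi>. Re (twist k s \<pi>)) summable_on primary_primes" using s by (rule twist_Re_summable)
    have "(\<lambda>\<pi>. (l \<pi> - Re (twist k s \<pi>)) + Re (twist k s \<pi>)) summable_on primary_primes"
      using sd sR by (rule summable_on_add)
    then have sl: "l summable_on primary_primes" by simp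
    have "infsum (\<lambda>\<pi>. (l \<pi> - Re (twist k s \<pi>)) + Re (twist k s \<pi>)) primary_primes =
       infsum (\<lambda>\<pi>. l \<pi> - Re (twist k s \<pi>)) primary_primes + prime_sum k s"
      unfolding prime_sum_def using sd sR by (rule infsum_add)
    then have diff: "infsum l primary_primes - prime_sum k s = infsum (\<lambda>\<pi>. l \<pi> - Re (twist k s \<pi>)) primary_primes" by simp
    have "\<bar>infsum l primary_primes - prime_sum k s\<bar> \<le> infsum (\<lambda>\<pi>. \<bar>l \<pi> - Re (twist k s \<pi>)\<bar>) primary_primes"
      unfolding diff using norm_infsum_bound[of "\<lambda>\<pi>. l \<pi> - Re (twist k s \<pi>)" primary_primes] ad
      by (simp only: real_norm_def)
    also have "\<dots> \<le> infsum (\<lambda>\<pi>. 2 * cmod \<pi> powr (-4)) primary_primes"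
      using ad sP bound by (rule infsum_mono)
    also have "\<dots> \<le> C" unfolding C_def
      using sP sC by (rule infsum_mono2) (auto intro: primary_primes_primary)
    finally have 1: "\<bar>infsum l primary_primes - prime_sum k s\<bar> \<le> C" .
    have "(sum l \<longlongrightarrow> infsum l primary_primes) (finite_subsets_at_top primary_primes)"
      using sl by (rule infsum_tendsto)
    then have lim1: "((\<lambda>Q. exp (sum l Q)) \<longlongrightarrow> exp (infsum l primary_primes)) (finite_subsets_at_top primary_primes)"
      by (intro tendsto_intros)
    have "((\<lambda>Q. cmod (infsum (twist k s) (smooth Q))) \<longlongrightarrow> cmod (hecke_L k s)) (finite_subsets_at_top primary_primes)"
      using infsum_smooth_tendsto[OF s] by (rule tendsto_norm)
    moreover have "\<forall>\<^sub>F Q in finite_subsets_at_top primary_primes. cmod (infsum (twist k s) (smooth Q)) = exp (sum l Q)"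
    proof (rule eventually_finite_subsets_at_top_weakI)
      fix Q assume Q: "finite Q" "Q \<subseteq> primary_primes"
      have "cmod (infsum (twist k s) (smooth Q)) = (\<Prod>\<pi>\<in>Q. 1 / cmod (1 - twist k s \<pi>))"
        unfolding infsum_smooth[OF Q s] by (simp add: prod_norm[symmetric] norm_divide)
      also have "\<dots> = (\<Prod>\<pi>\<in>Q. exp (l \<pi>))"
      proof (rule prod.cong)
        fix \<pi> assume "\<pi> \<in> Q"
        then have "cmod (twist k s \<pi>) \<le> 1/4" using Q s by (intro norm_twist_prime) auto
        then have "cmod (1 - twist k s \<pi>) > 0" by auto
        then show "1 / cmod (1 - twist k s \<pi>) = exp (l \<pi>)" unfolding l_def by (simp add: exp_minus inverse_eq_divide)
      qed simp
      also have "\<dots> = exp (sum l Q)" using Q by (simp add: exp_sum)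
      finally show "cmod (infsum (twist k s) (smooth Q)) = exp (sum l Q)" .
    qed
    ultimately have "((\<lambda>Q. exp (sum l Q)) \<longlongrightarrow> cmod (hecke_L k s)) (finite_subsets_at_top primary_primes)"
      by (rule Lim_transform_eventually)
    then have H: "cmod (hecke_L k s) = exp (infsum l primary_primes)"
      using lim1 by (rule tendsto_unique[OF finite_subsets_at_top_neq_bot])
    then have "hecke_L k s \<noteq> 0" by (metis exp_not_eq_zero norm_zero)
    then show ?thesis using 1 H by (simp add: abs_minus_commute)
  qed
  then show ?thesis by blast
qed

section \<open>Primes in sectors\<close>

lemma prime_sum_341:
  assumes "s > 2"
  shows "3 * prime_sum 0 s + 4 * prime_sum k s + prime_sum (2 * k) s \<ge> 0"
proof -
  let ?f = "\<lambda>j \<pi>. Re (twist j s \<pi>)"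
  have sm: "?f j summable_on primary_primes" for j using assms by (rule twist_Re_summable)
  have "3 * prime_sum 0 s + 4 * prime_sum k s + prime_sum (2 * k) s =
     infsum (\<lambda>\<pi>. 3 * ?f 0 \<pi> + 4 * ?f k \<pi> + ?f (2 * k) \<pi>) primary_primes"
    unfolding prime_sum_def
    by (simp add: infsum_add summable_on_add summable_on_cmult_right sm infsum_cmult_right)
  also have "\<dots> \<ge> 0"
  proof (rule infsum_nonneg)
    fix \<pi> assume "\<pi> \<in> primary_primes"
    then have nz: "\<pi> \<noteq> 0" using primary_primes_primary primary_nonzero by blast
    define w where "w = sgn \<pi> ^ k"
    have "cmod w = 1" using nz by (simp add: w_def norm_power norm_sgn)
    then have w: "(Re w)^2 + (Im w)^2 = 1" by (metis cmod_power2 one_power2)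
    have "sgn \<pi> ^ (2 * k) = w * w" by (simp add: w_def power_mult power2_eq_square power_mult_distrib mult.commute[of 2])
    then have "3 * ?f 0 \<pi> + 4 * ?f k \<pi> + ?f (2 * k) \<pi> = (3 + 4 * Re w + Re (w * w)) * cmod \<pi> powr (- s)"
      unfolding twist_def w_def[symmetric] by (simp add: algebra_simps)
    also have "3 + 4 * Re w + Re (w * w) = 2 * (1 + Re w)^2" using w by (simp add: power2_eq_square algebra_simps)
    finally show "0 \<le> 3 * ?f 0 \<pi> + 4 * ?f k \<pi> + ?f (2 * k) \<pi>" by simp
  qed
  finally show ?thesis .
qed

text \<open>The upper bound only needs \<open>hecke_L k\<close> to stay bounded, the lower bound is
  the non-vanishing at \<open>s = 2\<close>. In \<open>lower\<close>, three times the pole of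
  \<open>hecke_L 0\<close> is weighed against four times a possible zero of
  \<open>hecke_L k\<close>.\<close>

lemma prime_sum_bounded:
  assumes "k > 0"
  shows "\<exists>C. \<forall>t. 0 < t \<and> t \<le> 1 \<longrightarrow> \<bar>prime_sum k (2 + t)\<bar> \<le> C"
proof -
  obtain K where K: "\<And>k s. s > 2 \<Longrightarrow> hecke_L k s \<noteq> 0" "\<And>k s. s > 2 \<Longrightarrow> \<bar>prime_sum k s - ln (cmod (hecke_L k s))\<bar> \<le> K"
    using hecke_L_log by blast
  have upper: "\<exists>U. \<forall>t. 0 < t \<and> t \<le> 1 \<longrightarrow> prime_sum j (2 + t) \<le> U" if j: "j > 0" for j
  proof -
    obtain L C where LC: "\<And>t. 0 < t \<Longrightarrow> t \<le> 1 \<Longrightarrow> cmod (hecke_L j (2 + t) - L) \<le> C * t"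
      using hecke_L_lipschitz[OF j] by blast
    have "prime_sum j (2 + t) \<le> ln (cmod L + \<bar>C\<bar>) + K" if t: "0 < t" "t \<le> 1" for t
    proof -
      have "cmod (hecke_L j (2 + t)) \<le> cmod L + cmod (hecke_L j (2 + t) - L)"
        using norm_triangle_ineq[of L "hecke_L j (2 + t) - L"] by simp
      also have "\<dots> \<le> cmod L + C * t" using LC t by simp
      also have "\<dots> \<le> cmod L + \<bar>C\<bar> * 1" using t by (intro add_left_mono mult_mono) auto
      finally have "cmod (hecke_L j (2 + t)) \<le> cmod L + \<bar>C\<bar>" by simp
      moreover have "cmod (hecke_L j (2 + t)) > 0" using K(1)[of "2 + t" j] t by simp
      ultimately have "ln (cmod (hecke_L j (2 + t))) \<le> ln (cmod L + \<bar>C\<bar>)" by (subst ln_le_cancel_iff) linarith+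
      then show ?thesis using K(2)[of "2 + t" j] t by simp
    qed
    then show ?thesis by blast
  qed
  obtain U where U: "\<And>t. 0 < t \<Longrightarrow> t \<le> 1 \<Longrightarrow> prime_sum k (2 + t) \<le> U" using upper[OF assms] by blast
  obtain U2 where U2: "\<And>t. 0 < t \<Longrightarrow> t \<le> 1 \<Longrightarrow> prime_sum (2 * k) (2 + t) \<le> U2"
    using upper[of "2 * k"] assms by auto
  obtain C0 where C0: "C0 > 0" "\<And>t. 0 < t \<Longrightarrow> t \<le> 1 \<Longrightarrow> cmod (hecke_L 0 (2 + t)) \<le> C0 / t"
    using hecke_L_0_upper by blast
  obtain L C where LC: "\<And>t. 0 < t \<Longrightarrow> t \<le> 1 \<Longrightarrow> cmod (hecke_L k (2 + t) - L) \<le> C * t"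
    using hecke_L_lipschitz[OF assms] by blast
  define M where "M = (3 * (ln C0 + K) + U2) / 4 + K"
  define C' where "C' = \<bar>C\<bar> + 1"
  have C': "C' > 0" "C \<le> C'" by (auto simp: C'_def)
  have lower: "ln (cmod (hecke_L k (2 + t))) \<ge> 3 / 4 * ln t - M" if t: "0 < t" "t \<le> 1" for t
  proof -
    have "cmod (hecke_L 0 (2 + t)) > 0" using K(1)[of "2 + t" 0] t by simp
    then have "ln (cmod (hecke_L 0 (2 + t))) \<le> ln (C0 / t)" using C0(2)[OF t] by (subst ln_le_cancel_iff) linarith+
    also have "\<dots> = ln C0 - ln t" using C0 t by (simp add: ln_div)
    finally have "prime_sum 0 (2 + t) \<le> ln C0 - ln t + K" using K(2)[of "2 + t" 0] t by simp
    then have "3 * prime_sum 0 (2 + t) \<le> 3 * (ln C0 - ln t + K)" by (rule mult_left_mono) simp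
    moreover have "3 * prime_sum 0 (2 + t) + 4 * prime_sum k (2 + t) + prime_sum (2 * k) (2 + t) \<ge> 0"
      using t by (intro prime_sum_341) simp
    moreover have "prime_sum (2 * k) (2 + t) \<le> U2" using U2 t by blast
    ultimately have "4 * prime_sum k (2 + t) \<ge> - (3 * (ln C0 - ln t + K)) - U2" by linarith
    moreover have "prime_sum k (2 + t) \<le> ln (cmod (hecke_L k (2 + t))) + K" using K(2)[of "2 + t" k] t by simp
    ultimately show ?thesis unfolding M_def by (simp add: field_simps)
  qed
  \<comment> \<open>A zero at \<open>s = 2\<close> would be of order at least 1, but \<open>lower\<close> allows only order \<open>3/4\<close>.\<close>
  have L0: "L \<noteq> 0"
  proof
    assume "L = 0"
    \<comment> \<open>With this \<open>T\<close> the lower bound \<open>- 3 * T - M\<close> and the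
      upper bound \<open>ln C' - 4 * T\<close> for the same logarithm contradict each other.\<close>
    define T where "T = \<bar>M + ln C'\<bar> + 1"
    define t where "t = exp (- (4 * T))"
    have T: "T > M + ln C'" "T > 0" by (auto simp: T_def)
    have t: "0 < t" "t \<le> 1" "ln t = - (4 * T)" using T by (auto simp: t_def)
    have "cmod (hecke_L k (2 + t)) \<le> C * t" using LC[OF t(1,2)] \<open>L = 0\<close> by simp
    also have "\<dots> \<le> C' * t" using C' t by (intro mult_right_mono) auto
    finally have "cmod (hecke_L k (2 + t)) \<le> C' * t" .
    moreover have "cmod (hecke_L k (2 + t)) > 0" using K(1)[of "2 + t" k] t by simp
    ultimately have "ln (cmod (hecke_L k (2 + t))) \<le> ln (C' * t)" by (subst ln_le_cancel_iff) linarith+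
    also have "\<dots> = ln C' + ln t" using C' t by (simp add: ln_mult)
    finally show False using lower[OF t(1,2)] T(1) unfolding t(3) by simp
  qed
  \<comment> \<open>Up to \<open>t0\<close> the series stays within half of \<open>cmod L\<close>
    from its limit; beyond \<open>t0\<close>, \<open>lower\<close> is itself a uniform
    bound.\<close>
  define t0 where "t0 = cmod L / (2 * C')"
  have t0: "t0 > 0" using L0 C' by (simp add: t0_def)
  have "prime_sum k (2 + t) \<ge> min (ln (cmod L / 2)) (3 / 4 * ln t0 - M) - K" if t: "0 < t" "t \<le> 1" for t
  proof -
    have "ln (cmod (hecke_L k (2 + t))) \<ge> min (ln (cmod L / 2)) (3 / 4 * ln t0 - M)"
    proof (cases "t \<le> t0")
      case True
      have "cmod (hecke_L k (2 + t) - L) \<le> C * t" using LC t by blast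
      also have "\<dots> \<le> C' * t0" using C' t True by (intro mult_mono) auto
      also have "\<dots> = cmod L / 2" using C' by (simp add: t0_def)
      finally have "cmod L / 2 \<le> cmod (hecke_L k (2 + t))"
        using norm_triangle_ineq[of "hecke_L k (2 + t)" "L - hecke_L k (2 + t)"] by (simp add: norm_minus_commute)
      moreover have "cmod L / 2 > 0" using L0 by simp
      ultimately have "ln (cmod L / 2) \<le> ln (cmod (hecke_L k (2 + t)))" by (subst ln_le_cancel_iff) linarith+
      then show ?thesis by linarith
    next
      case False
      then have "ln t0 \<le> ln t" using t0 t by simp
      then show ?thesis using lower[OF t] by linarith
    qed
    then show ?thesis using K(2)[of "2 + t" k] t by simp
  qed
  then have "\<bar>prime_sum k (2 + t)\<bar> \<le> \<bar>U\<bar> + \<bar>min (ln (cmod L / 2)) (3 / 4 * ln t0 - M) - K\<bar>" if "0 < t" "t \<le> 1" for t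
    using U[OF that] that by fastforce
  then show ?thesis by blast
qed

text \<open>The diagonal \<open>i + j = n\<close> of a quadrant of parameters has
  \<open>n + 1\<close> elements of absolute value at most \<open>3 * (n + 1)\<close>, so it
  contributes at least \<open>1 / (9 * (n + 1))\<close>, and the harmonic series diverges.\<close>

lemma primary_inverse_square_sums_unbounded:
  "\<exists>A. finite A \<and> A \<subseteq> primary \<and> R \<le> (\<Sum>z\<in>A. cmod z powr (-2))"
proof -
  have "\<forall>\<^sub>F n in sequentially. 9 * R \<le> harm n"
    using harm_at_top by (auto simp: filterlim_at_top)
  then obtain m where m: "9 * R \<le> harm m" by (auto simp: eventually_sequentially)
  define e where "e = (\<lambda>(n::nat, i::nat). eis (1 + 3 * int i) (3 * int (n - i)))"
  define S where "S = Sigma {..<m} (\<lambda>n. {..n})"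
  have inj: "inj_on e S"
  proof (rule inj_onI)
    fix p q assume "p \<in> S" "q \<in> S" "e p = e q"
    then show "p = q" by (cases p; cases q) (auto simp: e_def S_def)
  qed
  have "R \<le> (\<Sum>n<m. 1 / (9 * real (Suc n)))"
  proof -
    have "harm m = (\<Sum>n<m. 1 / real (Suc n))"
      by (simp add: harm_altdef inverse_eq_divide)
    also have "\<dots> = 9 * (\<Sum>n<m. 1 / (9 * real (Suc n)))" unfolding sum_distrib_left by (intro sum.cong) (simp_all del: of_nat_Suc)
    finally show ?thesis using m by simp
  qed
  also have "\<dots> = (\<Sum>n<m. \<Sum>i\<le>n. 1 / (3 * real (Suc n))^2)"
  proof (rule sum.cong)
    fix n
    have "(\<Sum>i\<le>n. 1 / (3 * real (Suc n))^2) = real (Suc n) / (3 * real (Suc n))^2" by simp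
    also have "\<dots> = 1 / (9 * real (Suc n))" by (simp add: power2_eq_square field_simps del: of_nat_Suc)
    finally show "1 / (9 * real (Suc n)) = (\<Sum>i\<le>n. 1 / (3 * real (Suc n))^2)" by simp
  qed simp
  also have "\<dots> \<le> (\<Sum>n<m. \<Sum>i\<le>n. cmod (e (n, i)) powr (-2))"
  proof (intro sum_mono)
    fix n i :: nat assume i: "i \<in> {..n}"
    define a b where "a = 1 + 3 * int i" and "b = 3 * int (n - i)"
    have ab: "a \<ge> 1" "b \<ge> 0" by (auto simp: a_def b_def)
    have e: "e (n, i) = eis a b" by (simp add: e_def a_def b_def)
    have "eis a b \<in> primary" by (simp add: eis_primary_iff a_def b_def)
    then have nz: "eis a b \<noteq> 0" by (rule primary_nonzero)
    have "a^2 - a * b + b^2 \<le> (a + b)^2" using mult_nonneg_nonneg[of a b] ab by (simp add: power2_eq_square algebra_simps)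
    also have "\<dots> \<le> (3 * (int n + 1))^2" using i ab by (intro power_mono) (auto simp: a_def b_def)
    finally have "real_of_int (a^2 - a * b + b^2) \<le> real_of_int ((3 * (int n + 1))^2)" by (rule of_int_le_iff[THEN iffD2])
    then have "(cmod (eis a b))^2 \<le> (3 * real (Suc n))^2" unfolding cmod_eis_squared by (simp add: algebra_simps)
    then have "1 / (3 * real (Suc n))^2 \<le> 1 / (cmod (eis a b))^2" using nz by (intro divide_left_mono) auto
    also have "\<dots> = cmod (eis a b) powr (-2)" using nz by (simp add: powr_minus inverse_eq_divide)
    finally show "1 / (3 * real (Suc n))^2 \<le> cmod (e (n, i)) powr (-2)" by (simp only: e)
  qed
  also have "\<dots> = (\<Sum>p\<in>S. cmod (e p) powr (-2))"
    unfolding S_def by (subst sum.Sigma) auto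
  also have "\<dots> = (\<Sum>z\<in>e ` S. cmod z powr (-2))" using inj by (simp add: sum.reindex)
  finally have "R \<le> (\<Sum>z\<in>e ` S. cmod z powr (-2))" .
  moreover have "finite (e ` S)" by (simp add: S_def)
  moreover have "e ` S \<subseteq> primary" by (auto simp: e_def eis_primary_iff)
  ultimately show ?thesis by blast
qed

text \<open>No asymptotics are required: a finite part of the divergent series at
  \<open>s = 2\<close> exceeds the given bound, and by continuity still does so for some small
  \<open>t > 0\<close>. Then \<open>hecke_L_log\<close> passes to the primes.\<close>

lemma prime_sum_0_unbounded: "\<exists>t. 0 < t \<and> t \<le> 1 \<and> R \<le> prime_sum 0 (2 + t)"
proof -
  obtain K where K: "\<And>k s. s > 2 \<Longrightarrow> hecke_L k s \<noteq> 0" "\<And>k s. s > 2 \<Longrightarrow> \<bar>prime_sum k s - ln (cmod (hecke_L k s))\<bar> \<le> K"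
    using hecke_L_log by blast
  define X where "X = exp (R + K)"
  obtain A where A: "finite A" "A \<subseteq> primary" "X + 1 \<le> (\<Sum>z\<in>A. cmod z powr (-2))"
    using primary_inverse_square_sums_unbounded by blast
  have "((\<lambda>t. \<Sum>z\<in>A. cmod z powr (- (2 + t))) \<longlongrightarrow> (\<Sum>z\<in>A. cmod z powr (- (2 + 0)))) (at_right 0)"
    using A(2) by (intro tendsto_sum tendsto_intros) (use primary_nonzero in auto)
  moreover have "(\<Sum>z\<in>A. cmod z powr (- (2 + 0))) > X" using A(3) by simp
  ultimately have "\<forall>\<^sub>F t in at_right 0. X < (\<Sum>z\<in>A. cmod z powr (- (2 + t)))" by (rule order_tendstoD(1))
  moreover have "\<forall>\<^sub>F t in at_right (0::real). t < 1" by (rule eventually_at_right_real[THEN eventually_mono]) auto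
  moreover have "\<forall>\<^sub>F t in at_right (0::real). t > 0" by (rule eventually_at_right_less)
  ultimately have "\<forall>\<^sub>F t in at_right 0. X < (\<Sum>z\<in>A. cmod z powr (- (2 + t))) \<and> t < 1 \<and> t > 0"
    by eventually_elim auto
  then obtain t where t: "X < (\<Sum>z\<in>A. cmod z powr (- (2 + t)))" "t < 1" "t > 0"
    using eventually_happens' trivial_limit_at_right_real by fastforce
  have sm: "twist 0 (2 + t) summable_on primary" using t by (intro twist_summable) simp
  have "(\<Sum>z\<in>A. cmod z powr (- (2 + t))) = (\<Sum>z\<in>A. Re (twist 0 (2 + t) z))" by (simp add: twist_def)
  also have "\<dots> \<le> infsum (\<lambda>z. Re (twist 0 (2 + t) z)) primary"
    using A by (intro finite_sum_le_infsum summable_on_Re sm) (auto simp: twist_def)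
  also have "\<dots> = Re (hecke_L 0 (2 + t))" unfolding hecke_L_def using sm by (rule infsum_Re)
  also have "\<dots> \<le> cmod (hecke_L 0 (2 + t))" by (rule complex_Re_le_cmod)
  finally have "X < cmod (hecke_L 0 (2 + t))" using t(1) by simp
  moreover have "X > 0" by (simp add: X_def)
  ultimately have "ln X \<le> ln (cmod (hecke_L 0 (2 + t)))" by (subst ln_le_cancel_iff) linarith+
  then have "R + K \<le> ln (cmod (hecke_L 0 (2 + t)))" by (simp add: X_def)
  then have "R \<le> prime_sum 0 (2 + t)" using K(2)[of "2 + t" 0] t by simp
  then show ?thesis using t by auto
qed

section \<open>Equidistribution tested on polynomials in the cosine\<close>

definition angular_sum :: "(real \<Rightarrow> real) \<Rightarrow> real \<Rightarrow> real" where
  "angular_sum h t = infsum (\<lambda>\<pi>. h (Arg \<pi>) * cmod \<pi> powr (- (2 + t))) primary_primes"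

lemma angular_summable:
  assumes "t > 0" "\<And>x. \<bar>h x\<bar> \<le> B"
  shows "(\<lambda>\<pi>. h (Arg \<pi>) * cmod \<pi> powr (- (2 + t))) summable_on primary_primes"
proof -
  have "(\<lambda>\<pi>. B * cmod \<pi> powr (- (2 + t))) summable_on primary_primes"
    using assms(1) by (intro summable_on_cmult_right summable_on_subset_banach[OF primary_summable_powr])
      (auto intro: primary_primes_primary)
  then have "(\<lambda>\<pi>. norm (h (Arg \<pi>) * cmod \<pi> powr (- (2 + t)))) summable_on primary_primes"
    by (rule summable_on_comparison_test) (auto simp: abs_mult intro!: mult_right_mono assms(2))
  then show ?thesis by (rule abs_summable_summable)
qed

lemma angular_sum_cos: "angular_sum (\<lambda>x. cos (real k * x)) t = prime_sum k (2 + t)"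
  unfolding angular_sum_def prime_sum_def
proof (rule infsum_cong)
  fix \<pi> assume "\<pi> \<in> primary_primes"
  then have "\<pi> \<noteq> 0" using primary_primes_primary primary_nonzero by blast
  then have "sgn \<pi> = cis (Arg \<pi>)" by (simp add: cis_Arg)
  then have sgn: "sgn \<pi> ^ k = cis (real k * Arg \<pi>)" by (simp only: Complex.DeMoivre)
  show "cos (real k * Arg \<pi>) * cmod \<pi> powr (- (2 + t)) = Re (twist k (2 + t) \<pi>)"
  proof -
    have "Re (cis a * complex_of_real r) = cos a * r" for a r by simp
    then show ?thesis unfolding twist_def sgn by (simp only:)
  qed
qed

text \<open>
  In the sense of logarithmic density: the sum of \<open>h\<close> over the arguments of the primes is its mean
  times the unweighted sum, up to a bounded error.
\<close>
definition equidistributed :: "(real \<Rightarrow> real) \<Rightarrow> bool" where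
  "equidistributed h \<longleftrightarrow> continuous_on UNIV h \<and> (\<exists>B. \<forall>x. \<bar>h x\<bar> \<le> B) \<and>
     (\<exists>C. \<forall>t. 0 < t \<and> t \<le> 1 \<longrightarrow>
        \<bar>angular_sum h t - integral {0..2 * pi} h / (2 * pi) * prime_sum 0 (2 + t)\<bar> \<le> C)"

lemma integral_cos_multiple:
  assumes "k > 0"
  shows "integral {0..2 * pi} (\<lambda>x. cos (real k * x)) = 0"
proof (rule integral_unique)
  have "((\<lambda>x. cos (real k * x)) has_integral (sin (real k * (2 * pi)) / real k - sin (real k * 0) / real k)) {0..2 * pi}"
    by (rule fundamental_theorem_of_calculus)
       (use assms in \<open>auto intro!: derivative_eq_intros simp flip: has_real_derivative_iff_has_vector_derivative\<close>)
  moreover have "sin (real k * (2 * pi)) = 0" by (metis mult.commute mult.left_commute sin_npi2 mult_2 sin_2npi)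
  ultimately show "((\<lambda>x. cos (real k * x)) has_integral 0) {0..2 * pi}" by simp
qed

lemma equidistributed_cos: "equidistributed (\<lambda>x. cos (real k * x))"
proof -
  have "\<exists>C. \<forall>t. 0 < t \<and> t \<le> 1 \<longrightarrow> \<bar>angular_sum (\<lambda>x. cos (real k * x)) t -
        integral {0..2 * pi} (\<lambda>x. cos (real k * x)) / (2 * pi) * prime_sum 0 (2 + t)\<bar> \<le> C"
  proof (cases "k = 0")
    case True
    then show ?thesis unfolding angular_sum_cos by auto
  next
    case False
    then show ?thesis unfolding angular_sum_cos using integral_cos_multiple[of k] prime_sum_bounded[of k] by simp
  qed
  moreover have "\<exists>B. \<forall>x. \<bar>cos (real k * x)\<bar> \<le> B" by (intro exI[of _ 1]) simp
  ultimately show ?thesis unfolding equidistributed_def by (auto intro!: continuous_intros)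
qed

lemma equidistributed_add:
  assumes "equidistributed f" "equidistributed g"
  shows "equidistributed (\<lambda>x. a * f x + b * g x)"
proof -
  obtain Bf Cf where f: "continuous_on UNIV f" "\<And>x. \<bar>f x\<bar> \<le> Bf"
    "\<And>t. 0 < t \<Longrightarrow> t \<le> 1 \<Longrightarrow> \<bar>angular_sum f t - integral {0..2 * pi} f / (2 * pi) * prime_sum 0 (2 + t)\<bar> \<le> Cf"
    using assms(1) unfolding equidistributed_def by blast
  obtain Bg Cg where g: "continuous_on UNIV g" "\<And>x. \<bar>g x\<bar> \<le> Bg"
    "\<And>t. 0 < t \<Longrightarrow> t \<le> 1 \<Longrightarrow> \<bar>angular_sum g t - integral {0..2 * pi} g / (2 * pi) * prime_sum 0 (2 + t)\<bar> \<le> Cg"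
    using assms(2) unfolding equidistributed_def by blast
  have "continuous_on UNIV (\<lambda>x. a * f x + b * g x)" using f g by (intro continuous_intros)
  moreover have "\<bar>a * f x + b * g x\<bar> \<le> \<bar>a\<bar> * Bf + \<bar>b\<bar> * Bg" for x
  proof -
    have "\<bar>a * f x + b * g x\<bar> \<le> \<bar>a\<bar> * \<bar>f x\<bar> + \<bar>b\<bar> * \<bar>g x\<bar>" by (metis abs_mult abs_triangle_ineq)
    also have "\<dots> \<le> \<bar>a\<bar> * Bf + \<bar>b\<bar> * Bg" using f g by (intro add_mono mult_left_mono) auto
    finally show ?thesis .
  qed
  moreover have "\<bar>angular_sum (\<lambda>x. a * f x + b * g x) t -
      integral {0..2 * pi} (\<lambda>x. a * f x + b * g x) / (2 * pi) * prime_sum 0 (2 + t)\<bar> \<le> \<bar>a\<bar> * Cf + \<bar>b\<bar> * Cg"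
    if t: "0 < t" "t \<le> 1" for t
  proof -
    have "f integrable_on {0..2 * pi}" "g integrable_on {0..2 * pi}"
      using f(1) g(1) by (auto intro!: integrable_continuous_real intro: continuous_on_subset)
    then have I: "integral {0..2 * pi} (\<lambda>x. a * f x + b * g x) = a * integral {0..2 * pi} f + b * integral {0..2 * pi} g"
      by (subst integral_add) (auto intro: integrable_on_mult_right)
    have sf: "(\<lambda>\<pi>. f (Arg \<pi>) * cmod \<pi> powr (- (2 + t))) summable_on primary_primes"
      and sg: "(\<lambda>\<pi>. g (Arg \<pi>) * cmod \<pi> powr (- (2 + t))) summable_on primary_primes"
      using angular_summable[OF t(1)] f(2) g(2) by blast+
    have "angular_sum (\<lambda>x. a * f x + b * g x) t =
       infsum (\<lambda>\<pi>. a * (f (Arg \<pi>) * cmod \<pi> powr (- (2 + t))) + b * (g (Arg \<pi>) * cmod \<pi> powr (- (2 + t)))) primary_primes"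
      unfolding angular_sum_def by (intro infsum_cong) (simp add: algebra_simps)
    also have "\<dots> = a * angular_sum f t + b * angular_sum g t"
      unfolding angular_sum_def using sf sg
      by (simp only: infsum_add summable_on_cmult_right infsum_cmult_right)
    finally have S: "angular_sum (\<lambda>x. a * f x + b * g x) t = a * angular_sum f t + b * angular_sum g t" .
    have "angular_sum (\<lambda>x. a * f x + b * g x) t -
        integral {0..2 * pi} (\<lambda>x. a * f x + b * g x) / (2 * pi) * prime_sum 0 (2 + t) =
      a * (angular_sum f t - integral {0..2 * pi} f / (2 * pi) * prime_sum 0 (2 + t)) +
      b * (angular_sum g t - integral {0..2 * pi} g / (2 * pi) * prime_sum 0 (2 + t))"
      unfolding I S by (simp add: algebra_simps add_divide_distrib)
    also have "\<bar>\<dots>\<bar> \<le> \<bar>a\<bar> * \<bar>angular_sum f t - integral {0..2 * pi} f / (2 * pi) * prime_sum 0 (2 + t)\<bar> +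
      \<bar>b\<bar> * \<bar>angular_sum g t - integral {0..2 * pi} g / (2 * pi) * prime_sum 0 (2 + t)\<bar>"
      by (rule order_trans[OF abs_triangle_ineq]) (simp add: abs_mult)
    also have "\<dots> \<le> \<bar>a\<bar> * Cf + \<bar>b\<bar> * Cg" using f(3)[OF t] g(3)[OF t] by (intro add_mono mult_left_mono) auto
    finally show ?thesis .
  qed
  ultimately show ?thesis unfolding equidistributed_def by blast
qed

text \<open>The factor \<open>cos (real k * x)\<close> is what the induction needs: one more factor
  \<open>cos x\<close> shifts the frequency by one in both directions. Frequency 0 is apart, since
  its lower neighbour would be -1.\<close>

lemma equidistributed_poly_cos_mult: "equidistributed (\<lambda>x. poly p (cos x) * cos (real k * x))"
proof (induction p arbitrary: k)
  case 0
  show ?case using equidistributed_add[OF equidistributed_cos[of 0] equidistributed_cos[of 0], of 0 0] by simp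
next
  case (pCons a p)
  show ?case
  proof (cases k)
    case 0
    have "equidistributed (\<lambda>x. a * cos (real 0 * x) + 1 * (poly p (cos x) * cos (real 1 * x)))"
      by (intro equidistributed_add equidistributed_cos pCons.IH)
    then show ?thesis by (simp add: 0 mult.commute)
  next
    case (Suc j)
    have "equidistributed (\<lambda>x. a * cos (real k * x) + 1 * ((1/2) * (poly p (cos x) * cos (real (Suc k) * x))
        + (1/2) * (poly p (cos x) * cos (real j * x))))"
      by (intro equidistributed_add equidistributed_cos pCons.IH)
    moreover have "cos x * cos (real k * x) = (1/2) * cos (real (Suc k) * x) + (1/2) * cos (real j * x)" for x
    proof -
      have "real (Suc k) * x = real k * x + x" "real j * x = real k * x - x"
        by (simp_all add: Suc algebra_simps)
      then show ?thesis by (simp only: cos_add cos_diff) (simp add: field_simps)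
    qed
    then have "poly (pCons a p) (cos x) * cos (real k * x) = a * cos (real k * x) + 1 * ((1/2) * (poly p (cos x) * cos (real (Suc k) * x))
        + (1/2) * (poly p (cos x) * cos (real j * x)))" for x
    proof -
      have "poly (pCons a p) (cos x) * cos (real k * x) = a * cos (real k * x) + poly p (cos x) * (cos x * cos (real k * x))"
        by (simp add: algebra_simps)
      also have "cos x * cos (real k * x) = (1/2) * cos (real (Suc k) * x) + (1/2) * cos (real j * x)" by fact
      finally show ?thesis by (simp add: algebra_simps)
    qed
    ultimately show ?thesis by simp
  qed
qed

lemma equidistributed_poly_cos: "equidistributed (\<lambda>x. poly p (cos x))"
  using equidistributed_poly_cos_mult[of p 0] by simp

text \<open>\<open>Q\<close> is a parabola with maximum 1 at the midpoint \<open>c0\<close> and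
  value \<open>q\<close> at \<open>u\<close> and \<open>v\<close>, so \<open>Q c ^ n - q ^ n\<close>
  is at most 0 outside the interval. The polynomial never drops below \<open>- q ^ n\<close> on
  [-1, 1], whereas near \<open>arccos c0\<close> it is at least of the order of
  \<open>\<rho> ^ n\<close> with \<open>\<rho> > q\<close>; for large \<open>n\<close> this
  wins.\<close>

lemma localizing_polynomial:
  fixes u v :: real
  assumes uv: "-1 \<le> u" "u < v" "v \<le> 1"
  obtains p where "\<And>c. -1 \<le> c \<Longrightarrow> c \<le> 1 \<Longrightarrow> \<not> (u \<le> c \<and> c \<le> v) \<Longrightarrow> poly p c \<le> 0"
    "poly p 1 = 0" "poly p (-1) = 0" "integral {0..2 * pi} (\<lambda>x. poly p (cos x)) > 0"
proof -
  define c0 where "c0 = (u + v) / 2"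
  define \<eta> where "\<eta> = (v - u) / 2"
  \<comment> \<open>On [-1, 1] the distance from \<open>c0\<close> is at most 2, so division by 4
    keeps \<open>Q\<close> between 0 and 1 and taking powers preserves the order.\<close>
  define Q where "Q c = 1 - (c - c0)^2 / 4" for c
  define q where "q = 1 - \<eta>^2 / 4"
  define \<rho> where "\<rho> = (1 + q) / 2"
  have c0: "-1 < c0" "c0 < 1" and \<eta>: "0 < \<eta>" "\<eta> \<le> 1" using uv by (auto simp: c0_def \<eta>_def)
  have "\<eta>^2 \<le> 1" using \<eta> by (simp add: power_le_one)
  then have q: "0 < q" "q < 1" using \<eta> by (auto simp: q_def)
  have \<rho>: "q < \<rho>" "\<rho> < 1" using q by (auto simp: \<rho>_def)
  have Q0: "0 \<le> Q c" "Q c \<le> 1" if "-1 \<le> c" "c \<le> 1" for c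
  proof -
    have "(c - c0)^2 \<le> 2^2" using that c0 by (intro power2_le_iff_abs_le[THEN iffD2]) auto
    then show "0 \<le> Q c" "Q c \<le> 1" by (auto simp: Q_def)
  qed
  define x0 where "x0 = arccos c0"
  have x0: "cos x0 = c0" "0 < x0" "x0 < pi" using c0 arccos_lt_bounded[of c0] by (auto simp: x0_def)
  define s0 where "s0 = 1 - c0^2"
  have "c0^2 < 1" using c0 by (simp add: abs_square_less_1 abs_less_iff)
  then have s0: "s0 > 0" by (simp add: s0_def)
  have "isCont (\<lambda>x. 1 - (cos x)^2) x0" "isCont (\<lambda>x. Q (cos x)) x0"
    unfolding Q_def by (intro continuous_intros; simp)+
  then have lim: "((\<lambda>x. 1 - (cos x)^2) \<longlongrightarrow> s0) (at x0)" "((\<lambda>x. Q (cos x)) \<longlongrightarrow> 1) (at x0)"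
    by (simp_all add: isCont_def x0 s0_def Q_def)
  have "\<forall>\<^sub>F x in at x0. s0 / 2 < 1 - (cos x)^2" "\<forall>\<^sub>F x in at x0. \<rho> < Q (cos x)"
    using order_tendstoD(1)[OF lim(1), of "s0 / 2"] order_tendstoD(1)[OF lim(2), of \<rho>] s0 \<rho>
    by simp_all
  then have "\<forall>\<^sub>F x in at x0. s0 / 2 < 1 - (cos x)^2 \<and> \<rho> < Q (cos x)" by (rule eventually_conj)
  then obtain d where d: "d > 0" "\<And>x. x \<noteq> x0 \<Longrightarrow> dist x x0 < d \<Longrightarrow> s0 / 2 < 1 - (cos x)^2 \<and> \<rho> < Q (cos x)"
    unfolding eventually_at by auto
  define \<epsilon> where "\<epsilon> = min (d / 2) (min x0 (pi - x0))"
  have \<epsilon>: "\<epsilon> > 0" "\<epsilon> < d" "\<epsilon> \<le> x0" "x0 + \<epsilon> \<le> pi" using d x0 by (auto simp: \<epsilon>_def)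
  have near: "s0 / 2 \<le> 1 - (cos x)^2 \<and> \<rho> \<le> Q (cos x)" if "x \<in> {x0 - \<epsilon>..x0 + \<epsilon>}" for x
  proof (cases "x = x0")
    case True
    then show ?thesis using x0 s0 \<rho> by (simp add: s0_def Q_def)
  next
    case False
    moreover have "dist x x0 < d" using that \<epsilon> by (auto simp: dist_real_def)
    ultimately show ?thesis using d(2)[of x] by auto
  qed
  \<comment> \<open>This is what makes the gain
    \<open>\<epsilon> * s0 * (\<rho> ^ n - q ^ n)\<close> near \<open>x0\<close> exceed
    \<open>2 * pi * q ^ n\<close>, the greatest possible loss over a period.\<close>
  have "\<exists>n. 2 * pi / (\<epsilon> * s0) + 1 < (\<rho> / q) ^ n"
    using q \<rho> by (intro real_arch_pow) simp
  then obtain n where n: "2 * pi / (\<epsilon> * s0) + 1 < (\<rho> / q) ^ n" by blast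
  \<comment> \<open>The factor \<open>1 - c\<^sup>2\<close> discards the primes on the real axis.\<close>
  define p where "p = [:1, 0, -1:] * ([:1 - c0^2 / 4, c0 / 2, -1/4:] ^ n - [:q ^ n:])"
  have p: "poly p c = (1 - c^2) * (Q c ^ n - q ^ n)" for c
  proof -
    have 1: "poly [:1 - c0^2 / 4, c0 / 2, -1/4:] c = Q c"
      by (simp add: Q_def power2_eq_square field_simps)
    have 2: "poly [:1, 0, -1:] c = 1 - c^2" by (simp add: power2_eq_square)
    have 3: "poly [:q ^ n:] c = q ^ n" by simp
    show ?thesis unfolding p_def by (simp only: poly_mult poly_diff poly_power 1 2 3)
  qed
  show ?thesis
  proof (rule that[of p])
    fix c assume c: "-1 \<le> c" "c \<le> 1" "\<not> (u \<le> c \<and> c \<le> v)"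
    have "\<eta> \<le> \<bar>c - c0\<bar>" using c(3) by (auto simp: \<eta>_def c0_def abs_if field_simps)
    then have "\<eta>^2 \<le> (c - c0)^2" using \<eta> by (metis abs_le_square_iff abs_of_pos)
    then have "Q c \<le> q" by (simp add: Q_def q_def)
    then have "Q c ^ n \<le> q ^ n" using Q0[OF c(1,2)] by (intro power_mono)
    moreover have "c^2 \<le> 1" using c by (simp add: abs_square_le_1 abs_le_iff)
    ultimately show "poly p c \<le> 0" unfolding p by (intro mult_nonneg_nonpos) auto
  next
    show "poly p 1 = 0" "poly p (-1) = 0" by (simp_all add: p)
  next
    let ?f = "\<lambda>x. poly p (cos x)"
    have int: "?f integrable_on {a..b}" for a b
      by (intro integrable_continuous_real continuous_intros)
    have nonneg: "0 \<le> ?f x + q ^ n" for x :: real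
    proof -
      have "(cos x)^2 \<le> 1" using sin_cos_squared_add[of x] zero_le_power2[of "sin x"] by linarith
      moreover have "0 \<le> Q (cos x)" using Q0[of "cos x"] by simp
      ultimately have "(1 - (cos x)^2) * (Q (cos x) ^ n) + (cos x)^2 * q ^ n \<ge> 0" using q by simp
      also have "(1 - (cos x)^2) * (Q (cos x) ^ n) + (cos x)^2 * q ^ n = ?f x + q ^ n"
        unfolding p by (simp add: algebra_simps)
      finally show ?thesis .
    qed
    have "\<epsilon> * s0 * (\<rho> ^ n - q ^ n) = integral {x0 - \<epsilon>..x0 + \<epsilon>} (\<lambda>x. s0 / 2 * (\<rho> ^ n - q ^ n))"
      using \<epsilon> by simp
    also have "\<dots> \<le> integral {x0 - \<epsilon>..x0 + \<epsilon>} (\<lambda>x. ?f x + q ^ n)"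
    proof (rule integral_le)
      show "(\<lambda>x. ?f x + q ^ n) integrable_on {x0 - \<epsilon>..x0 + \<epsilon>}" by (intro integrable_add int) auto
      fix x assume "x \<in> {x0 - \<epsilon>..x0 + \<epsilon>}"
      then have x: "s0 / 2 \<le> 1 - (cos x)^2" "\<rho> \<le> Q (cos x)" using near by auto
      have "s0 / 2 * (\<rho> ^ n - q ^ n) \<le> (1 - (cos x)^2) * (Q (cos x) ^ n - q ^ n)"
        using x s0 q \<rho> by (intro mult_mono diff_right_mono power_mono) (auto intro!: power_mono)
      then show "s0 / 2 * (\<rho> ^ n - q ^ n) \<le> ?f x + q ^ n" using q by (simp add: p add_increasing2)
    qed auto
    also have "\<dots> \<le> integral {0..2 * pi} (\<lambda>x. ?f x + q ^ n)"
    proof (rule integral_subset_le)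
      show "{x0 - \<epsilon>..x0 + \<epsilon>} \<subseteq> {0..2 * pi}" using \<epsilon> x0 by auto
      show "(\<lambda>x. ?f x + q ^ n) integrable_on {x0 - \<epsilon>..x0 + \<epsilon>}" "(\<lambda>x. ?f x + q ^ n) integrable_on {0..2 * pi}"
        by (intro integrable_add int; auto)+
    qed (use nonneg in auto)
    also have "\<dots> = integral {0..2 * pi} ?f + 2 * pi * q ^ n"
      by (subst integral_add[OF int]) auto
    finally have 1: "\<epsilon> * s0 * (\<rho> ^ n - q ^ n) \<le> integral {0..2 * pi} ?f + 2 * pi * q ^ n" .
    have "2 * pi < \<epsilon> * s0 * ((\<rho> / q) ^ n - 1)"
      using n \<epsilon> s0 by (simp add: field_simps)
    then have "q ^ n * (2 * pi) < q ^ n * (\<epsilon> * s0 * ((\<rho> / q) ^ n - 1))" using q by (intro mult_strict_left_mono) auto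
    also have "\<dots> = \<epsilon> * s0 * (\<rho> ^ n - q ^ n)" using q by (simp add: power_divide field_simps)
    finally show "integral {0..2 * pi} ?f > 0" using 1 by (simp add: mult.commute)
  qed
qed

text \<open>With finitely many primes in the sector, all others would contribute nonpositive terms
  and \<open>angular_sum h\<close> would be bounded above; but up to a bounded error it is
  \<open>\<mu> > 0\<close> times the unbounded \<open>prime_sum 0\<close>.\<close>

theorem primary_primes_in_sector:
  fixes u v :: real
  assumes uv: "-1 \<le> u" "u < v" "v \<le> 1"
  shows "infinite {\<pi> \<in> primary_primes. Im \<pi> \<noteq> 0 \<and> u \<le> cos (Arg \<pi>) \<and> cos (Arg \<pi>) \<le> v}"
proof
  define S where "S = {\<pi> \<in> primary_primes. Im \<pi> \<noteq> 0 \<and> u \<le> cos (Arg \<pi>) \<and> cos (Arg \<pi>) \<le> v}"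
  assume "finite {\<pi> \<in> primary_primes. Im \<pi> \<noteq> 0 \<and> u \<le> cos (Arg \<pi>) \<and> cos (Arg \<pi>) \<le> v}"
  then have fin: "finite S" by (simp add: S_def)
  obtain p where p: "\<And>c. -1 \<le> c \<Longrightarrow> c \<le> 1 \<Longrightarrow> \<not> (u \<le> c \<and> c \<le> v) \<Longrightarrow> poly p c \<le> 0"
    "poly p 1 = 0" "poly p (-1) = 0" "integral {0..2 * pi} (\<lambda>x. poly p (cos x)) > 0"
    using localizing_polynomial[OF uv] by blast
  define h where "h x = poly p (cos x)" for x
  define \<mu> where "\<mu> = integral {0..2 * pi} h / (2 * pi)"
  have \<mu>: "\<mu> > 0" using p(4) unfolding \<mu>_def h_def[abs_def] by simp
  obtain B C where B: "\<And>x. \<bar>h x\<bar> \<le> B"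
    and C: "\<And>t. 0 < t \<Longrightarrow> t \<le> 1 \<Longrightarrow> \<bar>angular_sum h t - \<mu> * prime_sum 0 (2 + t)\<bar> \<le> C"
    using equidistributed_poly_cos[of p] unfolding equidistributed_def h_def[symmetric] \<mu>_def by blast
  have upper: "angular_sum h t \<le> real (card S) * B" if t: "t > 0" for t
  proof -
    let ?g = "\<lambda>\<pi>. h (Arg \<pi>) * cmod \<pi> powr (- (2 + t))"
    have sm: "?g summable_on X" if "X \<subseteq> primary_primes" for X
      using angular_summable[OF t B] that by (rule summable_on_subset_banach)
    have "primary_primes = S \<union> (primary_primes - S)" by (auto simp: S_def)
    then have "angular_sum h t = infsum ?g S + infsum ?g (primary_primes - S)"
      unfolding angular_sum_def using infsum_Un_disjoint[of ?g S "primary_primes - S"] sm by (auto simp: S_def)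
    also have "infsum ?g (primary_primes - S) \<le> infsum (\<lambda>_. 0) (primary_primes - S)"
    proof (rule infsum_mono)
      fix \<pi> assume \<pi>: "\<pi> \<in> primary_primes - S"
      then have nz: "\<pi> \<noteq> 0" using primary_primes_primary primary_nonzero by blast
      have "h (Arg \<pi>) \<le> 0"
      proof (cases "Im \<pi> = 0")
        \<comment> \<open>A real prime is outside \<open>S\<close> even if its cosine, 1 or -1, lies
          between \<open>u\<close> and \<open>v\<close>; here the zeros of \<open>p\<close> at these
          points are used.\<close>
        case True
        have "sgn \<pi> = cis (Arg \<pi>)" using nz by (simp add: cis_Arg)
        then have "sin (Arg \<pi>) = Im (sgn \<pi>)" by simp
        also have "\<dots> = 0" using True by (simp add: sgn_eq)
        finally have "(cos (Arg \<pi>))^2 = 1" using sin_cos_squared_add[of "Arg \<pi>"] by simp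
        then have "cos (Arg \<pi>) = 1 \<or> cos (Arg \<pi>) = -1" by (simp add: power2_eq_1_iff)
        then show ?thesis using p(2,3) by (auto simp: h_def)
      next
        case False
        then show ?thesis using \<pi> p(1)[of "cos (Arg \<pi>)"] by (auto simp: h_def S_def)
      qed
      then show "?g \<pi> \<le> 0" by (simp add: mult_nonpos_nonneg)
    qed (use sm in auto)
    also have "infsum ?g S + infsum (\<lambda>_. 0) (primary_primes - S) = (\<Sum>\<pi>\<in>S. ?g \<pi>)" using fin by simp
    also have "\<dots> \<le> (\<Sum>\<pi>\<in>S. B)"
    proof (rule sum_mono)
      fix \<pi> assume "\<pi> \<in> S"
      then have "cmod \<pi> \<ge> 2" using primary_primes_cmod by (simp add: S_def)
      moreover have "\<pi> \<noteq> 0" using calculation by auto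
      ultimately have "cmod \<pi> powr (- (2 + t)) \<le> 1" using t powr_mono[of "- (2 + t)" 0 "cmod \<pi>"] by simp
      then have "\<bar>h (Arg \<pi>)\<bar> * cmod \<pi> powr (- (2 + t)) \<le> B * 1"
        using B[of "Arg \<pi>"] by (intro mult_mono) auto
      then show "?g \<pi> \<le> B" using abs_ge_self[of "?g \<pi>"] by (simp add: abs_mult)
    qed
    finally show ?thesis by simp
  qed
  obtain t where t: "0 < t" "t \<le> 1" "(real (card S) * B + C) / \<mu> + 1 \<le> prime_sum 0 (2 + t)"
    using prime_sum_0_unbounded by blast
  have "real (card S) * B + C < \<mu> * prime_sum 0 (2 + t)"
  proof -
    have "(real (card S) * B + C) / \<mu> < prime_sum 0 (2 + t)" using t(3) by simp
    then show ?thesis using \<mu> by (simp add: field_simps)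
  qed
  then show False using upper[OF t(1)] C[OF t(1,2)] by linarith
qed

text \<open>For a nonreal \<open>\<pi>\<close> of norm \<open>p\<close> the deviation is
  \<open>- 2 * cos (Arg \<pi>)\<close> times \<open>p powr (3/2)\<close>, so the sector is given by
  cosines from \<open>- b / 2\<close> to \<open>- a / 2\<close>.\<close>

lemma primes_in_interval:
  fixes a b :: real
  assumes ab: "-2 \<le> a" "a < b" "b \<le> 2"
  shows "infinite {p::int. prime p \<and> [p = 1] (mod 3) \<and>
           a * real_of_int p powr (3/2) \<le> real_of_int (A2 p - (p^2 - int (n32 p) * p - 1)) \<and>
           real_of_int (A2 p - (p^2 - int (n32 p) * p - 1)) \<le> b * real_of_int p powr (3/2)}" (is "infinite ?P")
proof
  assume fin: "finite ?P"
  define S where "S = {\<pi> \<in> primary_primes. Im \<pi> \<noteq> 0 \<and> - b / 2 \<le> cos (Arg \<pi>) \<and> cos (Arg \<pi>) \<le> - a / 2}"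
  have "infinite S" unfolding S_def using ab by (intro primary_primes_in_sector) auto
  have norm_in_P: "\<exists>p\<in>?P. (cmod \<pi>)^2 = of_int p" if "\<pi> \<in> S" for \<pi>
  proof -
    have \<pi>: "\<pi> \<in> primary_primes" "Im \<pi> \<noteq> 0" and c: "- b / 2 \<le> cos (Arg \<pi>)" "cos (Arg \<pi>) \<le> - a / 2"
      using that by (auto simp: S_def)
    obtain p :: int where p: "prime p" "p mod 3 = 1" "(cmod \<pi>)^2 = of_int p"
      using primary_prime_norm[OF \<pi>] by blast
    have "p \<noteq> 2" using p(2) by auto
    then have p2: "p > 2" using prime_ge_2_int[OF p(1)] by simp
    interpret odd_prime p using p(1) p2 by unfold_locales
    have "cmod \<pi> = sqrt (of_int p)" using p(3) by (metis norm_ge_zero real_sqrt_unique)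
    moreover have "Re \<pi> = cmod \<pi> * cos (Arg \<pi>)" by (metis Re_rcis rcis_cmod_Arg)
    ultimately have Re: "Re \<pi> = sqrt (of_int p) * cos (Arg \<pi>)" by simp
    have pw: "real_of_int p powr (3/2) = of_int p * sqrt (of_int p)"
    proof -
      have "real_of_int p powr (1 + 1/2) = real_of_int p powr 1 * real_of_int p powr (1/2)" by (rule powr_add)
      then show ?thesis using p2 by (simp add: powr_half_sqrt)
    qed
    have "real_of_int (A2 p - (p^2 - int (n32 p) * p - 1)) = of_int p * real_of_int (\<Sum>x\<in>{0..<p}. Legendre (4 * x^3 + 1) p)"
      unfolding A2_formula by simp
    also have "\<dots> = of_int p * (- 2 * Re \<pi>)" by (simp only: Legendre_sum_primary_prime[OF \<pi>(1) p])
    also have "\<dots> = (- 2 * cos (Arg \<pi>)) * real_of_int p powr (3/2)" unfolding Re pw by simp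
    finally have val: "real_of_int (A2 p - (p^2 - int (n32 p) * p - 1)) = (- 2 * cos (Arg \<pi>)) * real_of_int p powr (3/2)" .
    have "a * real_of_int p powr (3/2) \<le> (- 2 * cos (Arg \<pi>)) * real_of_int p powr (3/2)"
      "(- 2 * cos (Arg \<pi>)) * real_of_int p powr (3/2) \<le> b * real_of_int p powr (3/2)"
      using c by (intro mult_right_mono; simp)+
    then have "p \<in> ?P" using p(1,2) unfolding mem_Collect_eq val by (simp add: unique_euclidean_semiring_class.cong_def)
    then show ?thesis using p(3) by blast
  qed
  \<comment> \<open>Infinitely many \<open>\<pi>\<close> give infinitely many \<open>p\<close>,
    because only finitely many primary elements have absolute value at most \<open>R\<close>. The
    inserted 0 guards against an empty set.\<close>
  define R where "R = Max (insert 0 ((\<lambda>p. sqrt (real_of_int p)) ` ?P))"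
  have "S \<subseteq> {z \<in> primary. cmod z \<le> R}"
  proof
    fix \<pi> assume \<pi>: "\<pi> \<in> S"
    then obtain p where p: "p \<in> ?P" "(cmod \<pi>)^2 = of_int p" using norm_in_P by blast
    have "cmod \<pi> = sqrt (of_int p)" using p(2) by (metis norm_ge_zero real_sqrt_unique)
    also have "\<dots> \<le> R" unfolding R_def using fin p(1) by (intro Max_ge) auto
    finally show "\<pi> \<in> {z \<in> primary. cmod z \<le> R}" using \<pi> primary_primes_primary by (simp add: S_def)
  qed
  then have "finite S" using finite_primary_ball finite_subset by blast
  then show False using \<open>infinite S\<close> by simp
qed

theorem mainTheorem1:
  shows "(\<forall>p::int. prime p \<and> p > 2 \<longrightarrow>
            A2 p = p^2 - int (n32 p) * p - 1 + p * (\<Sum>x\<in>{0..<p}. Legendre (4 * x^3 + 1) p))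
       \<and> (\<forall>a b :: real. -2 \<le> a \<and> a < b \<and> b \<le> 2 \<longrightarrow>
            infinite {p::int. prime p \<and> [p = 1] (mod 3) \<and>
               a * real_of_int p powr (3/2) \<le> real_of_int (A2 p - (p^2 - int (n32 p) * p - 1)) \<and>
               real_of_int (A2 p - (p^2 - int (n32 p) * p - 1)) \<le> b * real_of_int p powr (3/2)})"
proof (intro conjI allI impI)
  fix p :: int
  assume "prime p \<and> p > 2"
  then have "odd_prime p" by (simp add: odd_prime_def)
  then show "A2 p = p^2 - int (n32 p) * p - 1 + p * (\<Sum>x\<in>{0..<p}. Legendre (4 * x^3 + 1) p)"
    by (rule odd_prime.A2_formula)
next
  fix a b :: real
  assume "-2 \<le> a \<and> a < b \<and> b \<le> 2"
  then show "infinite {p::int. prime p \<and> [p = 1] (mod 3) \<and>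
      a * real_of_int p powr (3/2) \<le> real_of_int (A2 p - (p^2 - int (n32 p) * p - 1)) \<and>
      real_of_int (A2 p - (p^2 - int (n32 p) * p - 1)) \<le> b * real_of_int p powr (3/2)}"
    by (intro primes_in_interval) auto
qed

end
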